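(* Let $C_{n,w}$ be the number of $w$-NAFs of length $n\in\mathbb N_0$. Then \[ C_{n,w}=\frac{1}{(|N(\tau)|-1)w+1}|N(\tau)|^{n+w}+O\bigl((\rho|N(\tau)|)^n\bigr),\qquad \rho=\Bigl(1+\frac{1}{|N(\tau)|w^3}\Bigr)^{-1}<1. \] Let $0\ne\eta\in\mathcal D$ and let $X_{n,w,\eta}$ be the number of occurrences of $\eta$ in a $w$-NAF of length $n$ chosen uniformly at random. Then, writing $M=|N(\tau)|$, \[ \mathbb E(X_{n,w,\eta})=e_wn+\frac{(M-1)(w-1)w}{M^{w-1}((M-1)w+1)^2}+O(n\rho^n), \] \[ \mathbb V(X_{n,w,\eta})=v_wn+\frac{(w-1)w\bigl(-(w-1)^2-M^2w^2+(M-1)M^{w-1}((M-1)w+1)^2+2M(w^2-w+1)\bigr)}{M^{2w-2}((M-1)w+1)^4}+O(n^2\rho^n), \] where \[ e_w=\frac{1}{M^{w-1}((M-1)w+1)},\qquad v_w=\frac{M^{w-1}((M-1)w+1)^2-\bigl((M-1)w^2+2w-1\bigr)}{M^{2w-2}((M-1)w+1)^3}. \] Moreover \[ \mathbb P\Bigl(\frac{X_{n,w,\eta}-e_wn}{\sqrt{v_wn}}\le x\Bigr)=\Phi(x)+O\Bigl(\frac1{\sqrt n}\Bigr) \] uniformly in $x\in\mathbb R$, where $\Phi(x)=(2\pi)^{-1/2}\int_{t\le x}e^{-t^2/2}\,dt$.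
   Context: Let $\tau\in\mathbb C$ be an algebraic integer with $|\tau|>1$, let $N(\tau)$ denote its norm, and let $w\ge2$ be an integer. $\mathcal D\subseteq\mathbb Z[\tau]$ is a reduced residue digit set modulo $\tau^w$: it consists of $0$ and exactly one representative of each residue class of $\mathbb Z[\tau]$ modulo $\tau^w$ that is not divisible by $\tau$. A $w$-NAF of length $n$ is a word $\eta_{n-1}\dots\eta_1\eta_0$ with digits in $\mathcal D$ (leading zeros allowed, i.e. all $w$-NAFs with $\eta_j=0$ for $j<0$ and $j\ge n$) such that every block of $w$ consecutive digits contains at most one nonzero digit. *)

theory Defs
  imports
    "HOL-Probability.Probability"
    "HOL-Library.Landau_Symbols"
    "HOL-Computational_Algebra.Computational_Algebra"
begin

definition min_poly :: "complex \<Rightarrow> rat poly" where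
  "min_poly x = (THE p. lead_coeff p = 1 \<and> irreducible p \<and> poly (map_poly of_rat p) x = 0)"

text \<open>The norm of \<open>x\<close> with respect to the extension \<open>\<rat>(x)/\<rat>\<close>, i.e. the product of the conjugates
  of \<open>x\<close>. The minimal polynomial is separable, so each conjugate is a simple root.\<close>

definition alg_norm :: "complex \<Rightarrow> complex" where
  "alg_norm x = \<Prod> {z. poly (map_poly of_rat (min_poly x)) z = 0}"

text \<open>The ring \<open>\<int>[\<tau>]\<close>.\<close>

definition int_adjoin :: "complex \<Rightarrow> complex set" where
  "int_adjoin \<tau> = range (\<lambda>p :: int poly. poly (map_poly of_int p) \<tau>)"

text \<open>Divisibility of \<open>b\<close> by \<open>a\<close> in \<open>\<int>[\<tau>]\<close>; the overloaded \<^term>\<open>(dvd)\<close> on type \<^typ>\<open>complex\<close> would be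
  divisibility in the field of complex numbers.\<close>

definition adjoin_dvd :: "complex \<Rightarrow> complex \<Rightarrow> complex \<Rightarrow> bool" where
  "adjoin_dvd \<tau> a b \<longleftrightarrow> (\<exists>c\<in>int_adjoin \<tau>. b = a * c)"

definition reduced_residue_digit_set :: "complex \<Rightarrow> nat \<Rightarrow> complex set \<Rightarrow> bool" where
  "reduced_residue_digit_set \<tau> w D \<longleftrightarrow>
     D \<subseteq> int_adjoin \<tau> \<and> 0 \<in> D \<and>
     (\<forall>d\<in>D - {0}. \<not> adjoin_dvd \<tau> \<tau> d) \<and>
     (\<forall>z\<in>int_adjoin \<tau>. \<not> adjoin_dvd \<tau> \<tau> z \<longrightarrow>
        (\<exists>!d. d \<in> D - {0} \<and> adjoin_dvd \<tau> (\<tau> ^ w) (z - d)))"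

text \<open>Words are two-sided sequences of digits; a word of length \<open>n\<close> vanishes outside the positions
  \<open>0, \<dots>, n - 1\<close>. In particular, for \<open>n < w\<close> a \<open>w\<close>-NAF of length \<open>n\<close> has at most one nonzero digit.\<close>

definition is_wNAF :: "complex set \<Rightarrow> nat \<Rightarrow> (int \<Rightarrow> complex) \<Rightarrow> bool" where
  "is_wNAF D w \<eta> \<longleftrightarrow>
     (\<forall>j. \<eta> j \<in> D) \<and> (\<forall>i. card {j \<in> {i..<i + int w}. \<eta> j \<noteq> 0} \<le> 1)"

definition wNAFs :: "complex set \<Rightarrow> nat \<Rightarrow> nat \<Rightarrow> (int \<Rightarrow> complex) set" where
  "wNAFs D w n = {\<eta>. is_wNAF D w \<eta> \<and> (\<forall>j. j < 0 \<or> j \<ge> int n \<longrightarrow> \<eta> j = 0)}"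

definition wNAF_count :: "complex set \<Rightarrow> nat \<Rightarrow> nat \<Rightarrow> nat" where
  "wNAF_count D w n = card (wNAFs D w n)"

definition random_wNAF :: "complex set \<Rightarrow> nat \<Rightarrow> nat \<Rightarrow> (int \<Rightarrow> complex) pmf" where
  "random_wNAF D w n = pmf_of_set (wNAFs D w n)"

definition occurrences :: "nat \<Rightarrow> complex \<Rightarrow> (int \<Rightarrow> complex) \<Rightarrow> real" where
  "occurrences n d \<eta> = real (card {j \<in> {0..<int n}. \<eta> j = d})"

definition rho :: "real \<Rightarrow> nat \<Rightarrow> real" where
  "rho M w = inverse (1 + 1 / (M * real w ^ 3))"

definition e_coeff :: "real \<Rightarrow> nat \<Rightarrow> real" where
  "e_coeff M w = 1 / (M ^ (w - 1) * ((M - 1) * real w + 1))"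

definition v_coeff :: "real \<Rightarrow> nat \<Rightarrow> real" where
  "v_coeff M w =
     (M ^ (w - 1) * ((M - 1) * real w + 1)\<^sup>2 - ((M - 1) * (real w)\<^sup>2 + 2 * real w - 1))
     / (M ^ (2 * w - 2) * ((M - 1) * real w + 1) ^ 3)"

definition std_normal_Phi :: "real \<Rightarrow> real" where
  "std_normal_Phi x = 1 / sqrt (2 * pi) * (LBINT t:{..x}. exp (- (t\<^sup>2) / 2))"

end

theory Submission
  imports Defs "HOL-Complex_Analysis.Complex_Analysis" "HOL-Real_Asymp.Real_Asymp"
begin

text \<open>
  Writing \<open>M = |N(\<tau>)|\<close>, the quotient \<open>\<int>[\<tau>] / \<tau>\<close> is \<open>\<int> / M\<close>, so there are
  \<open>N = (M - 1) M\<^bsup>w-1\<^esup>\<close> nonzero digits. Splitting off the leading digit, the generating polynomial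
  of the occurrences of \<open>\<eta>\<close> satisfies \<open>P\<^bsub>n+1\<^esub>(y) = P\<^bsub>n\<^esub>(y) + (N - 1 + y) P\<^bsub>n+1-w\<^esub>(y)\<close>.

  The counts and the first two factorial moments are therefore coefficients of \<open>t\<close>, \<open>t\<^sup>2\<close> and \<open>t\<^sup>3\<close>,
  where after rescaling \<open>t(u) = 1 / ((1 - u) q(u))\<close> with
  \<open>q(u) = 1/M + (M - 1)/M (1 + u + \<dots> + u\<^bsup>w-1\<^esup>)\<close>. All zeros of \<open>q\<close> have modulus greater than
  \<open>1 + 1 / (M w\<^sup>3)\<close>, so the main terms are the polar parts at \<open>u = 1\<close>.

  For the central limit theorem, \<open>P\<^sub>n\<close> has only real, negative zeros. Hence the number of
  occurrences is distributed as a sum of independent Bernoulli variables, and Fourier inversion on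
  \<open>[-\<pi>, \<pi>]\<close>, which is exact for integer-valued variables, compares its distribution function with
  the normal one.
\<close>

section \<open>Residue classes of \<open>\<int>[\<tau>]\<close> modulo powers of \<open>\<tau>\<close>\<close>

text \<open>Coefficients of a power series are controlled only strictly inside its disc of
  convergence. The zeros of \<open>q\<close> are therefore kept beyond 1 + 9 / (8 M w^3), strictly
  more than 1 / rho = 1 + 1 / (M w^3), and the error terms come out with rho itself.

  Following the dominant zero as a function of y would describe the characteristic function near t =
  0 only. Real-rootedness gives more: a product of Bernoulli factors decays like a Gaussian on all
  of [-pi, pi], at a rate set by the exact variance. Distribution functions are partial sums of
  coefficients and bring a kernel of size 1 / |t| into the inversion integral; it is absorbed by the
  |t|^3 in the error of the Gaussian approximation, uniformly in the point at which the sum stops.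

  The number \<open>\<tau>\<close> may be a unit, so the count has to cover M = 1, where 0 is the
  only digit and q = 1. A nonzero digit forces M >= 2.\<close>

lemma poly_map_poly_add:
  fixes h :: "'a::comm_ring_1 \<Rightarrow> 'b::comm_ring_1"
  assumes "h 0 = 0" "\<And>a b. h (a + b) = h a + h b"
  shows "poly (map_poly h (p + q)) x = poly (map_poly h p) x + poly (map_poly h q) x"
  by (induction p q rule: poly_induct2) (simp_all add: map_poly_pCons assms algebra_simps)

lemma poly_map_poly_mult:
  fixes h :: "'a::comm_ring_1 \<Rightarrow> 'b::comm_ring_1"
  assumes "h 0 = 0" "\<And>a b. h (a + b) = h a + h b" "\<And>a b. h (a * b) = h a * h b"
  shows "poly (map_poly h (p * q)) x = poly (map_poly h p) x * poly (map_poly h q) x"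
proof (induction p)
  case 0
  show ?case by simp
next
  case (pCons a p)
  have "poly (map_poly h (smult a q)) x = h a * poly (map_poly h q) x"
    by (induction q) (simp_all add: map_poly_pCons assms algebra_simps)
  with pCons show ?case
    by (simp add: map_poly_pCons assms poly_map_poly_add algebra_simps)
qed

definition ieval :: "complex \<Rightarrow> int poly \<Rightarrow> complex" where
  "ieval x p = poly (map_poly of_int p) x"

definition qeval :: "complex \<Rightarrow> rat poly \<Rightarrow> complex" where
  "qeval x p = poly (map_poly of_rat p) x"

lemma ieval_simps [simp]:
  "ieval x 0 = 0" "ieval x 1 = 1" "ieval x (pCons a p) = of_int a + x * ieval x p"
  "ieval x (p + q) = ieval x p + ieval x q"
  "ieval x (p * q) = ieval x p * ieval x q"
  "ieval x (smult a p) = of_int a * ieval x p"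
proof -
  show m: "ieval x (p * q) = ieval x p * ieval x q" for p q
    by (simp add: ieval_def poly_map_poly_mult)
  show "ieval x (smult a p) = of_int a * ieval x p"
    using m[of "[:a:]" p] by (simp add: ieval_def map_poly_pCons)
qed (simp_all add: ieval_def map_poly_pCons poly_map_poly_add)

lemma ieval_minus [simp]: "ieval x (- p) = - ieval x p"
  using ieval_simps(6)[of x "-1" p] by simp

lemma ieval_diff [simp]: "ieval x (p - q) = ieval x p - ieval x q"
  using ieval_simps(4)[of x p "- q"] by simp

lemma qeval_simps [simp]:
  "qeval x 0 = 0" "qeval x 1 = 1" "qeval x (pCons a p) = of_rat a + x * qeval x p"
  "qeval x (p + q) = qeval x p + qeval x q"
  "qeval x (p * q) = qeval x p * qeval x q"
  by (simp_all add: qeval_def map_poly_pCons poly_map_poly_add poly_map_poly_mult of_rat_add of_rat_mult)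

lemma qeval_smult [simp]: "qeval x (smult a p) = of_rat a * qeval x p"
  using qeval_simps(5)[of x "[:a:]" p] by simp

lemma map_poly_of_rat_of_int:
  "map_poly of_rat (map_poly of_int p) = (map_poly of_int p :: complex poly)"
  by (subst map_poly_map_poly) (simp_all add: o_def)

lemma qeval_of_int [simp]: "qeval x (map_poly of_int p) = ieval x p"
  by (simp add: qeval_def ieval_def map_poly_of_rat_of_int)

lemma degree_map_poly_of_int [simp]:
  "degree (map_poly of_int p :: 'a::ring_char_0 poly) = degree p"
  by (rule degree_map_poly) auto

lemma rat_poly_clear_denominators:
  obtains c :: int and q :: "int poly"
  where "c \<noteq> 0" "smult (of_int c) p = map_poly rat_of_int q"
proof -
  have "\<exists>c q. c \<noteq> 0 \<and> smult (of_int c) p = map_poly rat_of_int q"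
  proof (induction p)
    case 0
    show ?case by (intro exI[of _ 1] exI[of _ 0]) simp
  next
    case (pCons a p)
    then obtain c q where cq: "c \<noteq> 0" "smult (of_int c) p = map_poly rat_of_int q"
      by blast
    obtain n d where nd: "quotient_of a = (n, d)" by fastforce
    have d: "d > 0" "a = of_int n / of_int d"
      using quotient_of_denom_pos[OF nd] quotient_of_div[OF nd] by auto
    have "smult (of_int (c * d)) p = smult (of_int d) (smult (of_int c) p)"
      by (simp add: mult.commute)
    also have "\<dots> = map_poly rat_of_int (smult d q)"
      unfolding cq(2) by (rule poly_eqI) (simp add: coeff_map_poly)
    finally have "smult (of_int (c * d)) (pCons a p) = map_poly rat_of_int (pCons (c * n) (smult d q))"
      using d by (simp add: map_poly_pCons)
    with cq d show ?case by (intro exI[of _ "c * d"]) auto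
  qed
  with that show ?thesis by blast
qed

section \<open>Integral minimal polynomials and the norm\<close>

text \<open>Gauss's lemma. The primitive part \<open>g\<close> of an annihilator of least degree
  pseudo-divides the monic annihilator \<open>F\<close> with remainder 0. Comparing contents turns
  this into a factorisation of \<open>F\<close> over the integers, so the leading coefficient of
  \<open>g\<close> is a unit.\<close>

lemma algebraic_int_minimal_int_poly:
  assumes "algebraic_int (\<tau> :: complex)"
  obtains f :: "int poly" where "lead_coeff f = 1" "ieval \<tau> f = 0"
    "\<And>p. ieval \<tau> p = 0 \<Longrightarrow> p \<noteq> 0 \<Longrightarrow> degree f \<le> degree p"
proof -
  obtain F :: "int poly" where F: "ieval \<tau> F = 0" "lead_coeff F = 1"
    using assms unfolding algebraic_int_altdef_ipoly ieval_def by blast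
  hence "\<exists>p. p \<noteq> 0 \<and> ieval \<tau> p = 0" by (intro exI[of _ F]) auto
  then obtain g0 where g0: "g0 \<noteq> 0" "ieval \<tau> g0 = 0"
    and g0_min: "\<And>p. p \<noteq> 0 \<and> ieval \<tau> p = 0 \<Longrightarrow> degree g0 \<le> degree p"
    using ex_has_least_nat[of "\<lambda>p. p \<noteq> 0 \<and> ieval \<tau> p = 0" _ degree] by metis
  define g where "g = primitive_part g0"
  have g: "g \<noteq> 0" "content g = 1" "degree g = degree g0"
    using g0 by (auto simp: g_def)
  have "ieval \<tau> (smult (content g0) g) = 0"
    unfolding g_def content_times_primitive_part by fact
  hence g_root: "ieval \<tau> g = 0" using g0 by simp
  obtain a q where aq: "a \<noteq> 0" "smult a F = g * q + pseudo_mod F g"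
    using pseudo_mod(1)[OF g(1), of F] by blast
  have "ieval \<tau> (smult a F) = ieval \<tau> (g * q + pseudo_mod F g)" by (simp add: aq)
  hence "ieval \<tau> (pseudo_mod F g) = 0" by (simp add: F g_root)
  hence "pseudo_mod F g = 0"
    using pseudo_mod(2)[OF g(1), of F] g0_min[of "pseudo_mod F g"] g(3) by fastforce
  hence eq: "smult a F = g * q" using aq by simp
  have "content F = 1"
    using content_dvd_coeff[of F "degree F"] F by (metis is_unit_content_iff)
  \<comment> \<open>\<open>F\<close> and \<open>g\<close> have content 1, so \<open>q\<close>
    carries exactly the factor \<open>a\<close> up to sign, and \<open>a\<close> cancels.\<close>
  hence "content q = normalize a"
    using arg_cong[OF eq, of content] g by (simp add: content_mult)
  hence "smult a F = smult (normalize a) (g * primitive_part q)"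
    using eq content_times_primitive_part[of q] by (metis mult_smult_right)
  moreover have "normalize a = a \<or> normalize a = - a" by (auto simp: abs_if)
  ultimately have "smult a F = smult a (g * primitive_part q) \<or>
      smult a F = smult a (- (g * primitive_part q))" by auto
  hence "F = g * primitive_part q \<or> F = g * (- primitive_part q)"
    using aq(1) smult_eq_iff[of a] by (metis mult_minus_right smult_cancel)
  then obtain q' where "F = g * q'" by blast
  hence "lead_coeff g * lead_coeff q' = 1" using F by (simp add: lead_coeff_mult)
  hence lc: "lead_coeff g * lead_coeff g = 1"
    by (metis dvd_triv_left zdvd1_eq abs_mult_self_eq mult_1)
  show ?thesis
  proof (rule that[of "smult (lead_coeff g) g"])
    show "lead_coeff (smult (lead_coeff g) g) = 1" using lc g(1) by simp
    show "ieval \<tau> (smult (lead_coeff g) g) = 0" by (simp add: g_root)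
    show "degree (smult (lead_coeff g) g) \<le> degree p" if "ieval \<tau> p = 0" "p \<noteq> 0" for p
      using g0_min[of p] that g by simp
  qed
qed

text \<open>Minimality ranges over all nonzero integer polynomials, not only monic ones, so that it
  passes to rational polynomials by clearing denominators.\<close>

definition is_min_int_poly :: "complex \<Rightarrow> int poly \<Rightarrow> bool" where
  "is_min_int_poly \<tau> f \<longleftrightarrow> lead_coeff f = 1 \<and> ieval \<tau> f = 0 \<and>
     (\<forall>p. ieval \<tau> p = 0 \<longrightarrow> p \<noteq> 0 \<longrightarrow> degree f \<le> degree p)"

text \<open>For a monic divisor, pseudo-division multiplies the dividend by a power of 1 and so is
  ordinary division over the integers. The remainder vanishes by minimality of the degree.\<close>

lemma ieval_eq_0_imp_dvd:
  assumes "is_min_int_poly \<tau> f" "ieval \<tau> p = 0"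
  shows "f dvd p"
proof -
  have f0: "f \<noteq> 0" using assms by (auto simp: is_min_int_poly_def)
  obtain q r where qr: "pseudo_divmod p f = (q, r)" by fastforce
  have eq: "p = f * q + r"
    using pseudo_divmod(1)[OF f0 qr] assms by (simp add: is_min_int_poly_def)
  have "ieval \<tau> r = 0" using assms arg_cong[OF eq, of "ieval \<tau>"] by (simp add: is_min_int_poly_def)
  with pseudo_divmod(2)[OF f0 qr] have "r = 0"
    using assms unfolding is_min_int_poly_def by force
  with eq show ?thesis by simp
qed

lemma qeval_eq_0_imp_degree_ge:
  assumes "is_min_int_poly \<tau> f" "qeval \<tau> p = 0" "p \<noteq> 0"
  shows "degree f \<le> degree p"
proof -
  obtain c q where cq: "c \<noteq> 0" "smult (of_int c) p = map_poly rat_of_int q"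
    by (rule rat_poly_clear_denominators)
  have deg: "degree q = degree p"
    using arg_cong[OF cq(2), of degree] cq(1) by simp
  have "ieval \<tau> q = 0"
    using arg_cong[OF cq(2), of "qeval \<tau>"] assms by simp
  moreover have "q \<noteq> 0" using cq assms by auto
  ultimately show ?thesis using assms deg by (auto simp: is_min_int_poly_def)
qed

lemma qeval_eq_0_imp_dvd:
  assumes "is_min_int_poly \<tau> f" "qeval \<tau> p = 0"
  shows "map_poly of_int f dvd p"
proof -
  let ?f = "map_poly rat_of_int f"
  have f0: "?f \<noteq> 0" using assms by (auto simp: is_min_int_poly_def map_poly_eq_0_iff)
  have "qeval \<tau> (p mod ?f) = 0"
  proof -
    have "qeval \<tau> p = qeval \<tau> (p div ?f * ?f + p mod ?f)" by (simp only: div_mult_mod_eq)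
    also have "\<dots> = qeval \<tau> (p mod ?f)"
      using assms unfolding qeval_simps is_min_int_poly_def by simp
    finally show ?thesis using assms by simp
  qed
  hence "p mod ?f = 0"
    using qeval_eq_0_imp_degree_ge[OF assms(1), of "p mod ?f"] degree_mod_less[OF f0, of p] by force
  thus ?thesis by auto
qed

lemma is_min_int_poly_degree_pos:
  assumes "is_min_int_poly \<tau> f" shows "degree f > 0"
proof (rule ccontr)
  assume "\<not> degree f > 0"
  hence "f = [:lead_coeff f:]" using degree_eq_zeroE[of f] by (metis gr0I lead_coeff_pCons(2) pCons_0_0)
  hence "f = 1" using assms by (simp add: is_min_int_poly_def one_pCons)
  thus False using assms by (simp add: is_min_int_poly_def)
qed

lemma lead_coeff_map_poly_of_int:
  assumes "lead_coeff f = (1 :: int)" shows "lead_coeff (map_poly rat_of_int f) = 1"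
  using assms by (simp add: coeff_map_poly)

text \<open>One of two factors annihilates \<open>\<tau>\<close> and has full degree, which leaves a
  constant for the other.\<close>

lemma is_min_int_poly_irreducible:
  assumes f: "is_min_int_poly \<tau> f"
  shows "irreducible (map_poly rat_of_int f)"
proof (rule irreducibleI)
  let ?f = "map_poly rat_of_int f"
  note deg = is_min_int_poly_degree_pos[OF f]
  show nz: "?f \<noteq> 0" using deg by (metis degree_0 degree_map_poly_of_int less_irrefl)
  show "\<not> ?f dvd 1" using deg by (simp add: is_unit_iff_degree nz)
  fix a b assume ab: "?f = a * b"
  have "qeval \<tau> (a * b) = 0" using f unfolding ab[symmetric] by (simp add: is_min_int_poly_def)
  hence or: "qeval \<tau> a = 0 \<or> qeval \<tau> b = 0" by simp
  have ab0: "a \<noteq> 0" "b \<noteq> 0" using nz ab by auto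
  have "degree f = degree a + degree b"
    using arg_cong[OF ab, of degree] ab0 by (simp add: degree_mult_eq)
  with or qeval_eq_0_imp_degree_ge[OF f, of a] qeval_eq_0_imp_degree_ge[OF f, of b] ab0
  have "degree a = 0 \<or> degree b = 0" by auto
  thus "a dvd 1 \<or> b dvd 1" using ab0 by (auto simp: is_unit_iff_degree)
qed

lemma monic_irreducible_eq_min_int_poly:
  assumes f: "is_min_int_poly \<tau> f" and p: "lead_coeff p = 1" "irreducible p" "qeval \<tau> p = 0"
  shows "p = map_poly of_int f"
proof -
  let ?f = "map_poly rat_of_int f"
  obtain q where q: "p = ?f * q" using qeval_eq_0_imp_dvd[OF f p(3)] by blast
  have "\<not> ?f dvd 1" using is_min_int_poly_irreducible[OF f] by (auto simp: irreducible_def)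
  hence "q dvd 1" using p(2) q by (auto simp: irreducible_def)
  then obtain c where c: "q = [:c:]" by (auto simp: is_unit_poly_iff)
  have "lead_coeff p = lead_coeff ?f * c" unfolding q lead_coeff_mult c by simp
  hence "c = 1"
    using p(1) f lead_coeff_map_poly_of_int[of f] by (simp only: is_min_int_poly_def)
  thus ?thesis using q c by simp
qed

lemma min_poly_eq:
  assumes f: "is_min_int_poly \<tau> f"
  shows "min_poly \<tau> = map_poly of_int f"
  unfolding min_poly_def qeval_def[symmetric]
proof (rule the_equality)
  show "lead_coeff (map_poly rat_of_int f) = 1 \<and> irreducible (map_poly rat_of_int f) \<and>
        qeval \<tau> (map_poly rat_of_int f) = 0"
    using f is_min_int_poly_irreducible[OF f]
      lead_coeff_map_poly_of_int[of f] by (auto simp: is_min_int_poly_def)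
qed (use monic_irreducible_eq_min_int_poly[OF f] in blast)

lemma is_min_int_poly_exists:
  assumes "algebraic_int (\<tau> :: complex)" obtains f where "is_min_int_poly \<tau> f"
  using algebraic_int_minimal_int_poly[OF assms] unfolding is_min_int_poly_def by metis

text \<open>A multiple root of the minimal polynomial would have the same minimal polynomial, but be a
  root of its derivative.\<close>

lemma rsquarefree_min_int_poly:
  assumes f: "is_min_int_poly \<tau> f"
  shows "rsquarefree (map_poly of_int f :: complex poly)"
proof -
  let ?F = "map_poly of_int f :: complex poly"
  have pd: "pderiv ?F = map_poly of_int (pderiv f)"
    by (rule poly_eqI) (simp add: coeff_pderiv coeff_map_poly)
  have nz: "pderiv f \<noteq> 0" using is_min_int_poly_degree_pos[OF f] by (simp add: pderiv_eq_0_iff)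
  have "\<not> (poly ?F z = 0 \<and> poly (pderiv ?F) z = 0)" for z
  proof
    assume z: "poly ?F z = 0 \<and> poly (pderiv ?F) z = 0"
    have "algebraic_int z"
      unfolding algebraic_int_altdef_ipoly using z f by (auto simp: is_min_int_poly_def)
    then obtain g where g: "is_min_int_poly z g" by (rule is_min_int_poly_exists)
    have "map_poly rat_of_int f = map_poly of_int g"
    proof (rule monic_irreducible_eq_min_int_poly[OF g])
      show "lead_coeff (map_poly rat_of_int f) = 1"
        using f lead_coeff_map_poly_of_int[of f] by (auto simp: is_min_int_poly_def)
      show "irreducible (map_poly rat_of_int f)" by (rule is_min_int_poly_irreducible[OF f])
      show "qeval z (map_poly rat_of_int f) = 0" using z by (simp add: ieval_def)
    qed
    hence "degree f = degree g" by (metis degree_map_poly_of_int)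
    moreover have "degree g \<le> degree (pderiv f)"
      using g z nz unfolding pd by (auto simp: is_min_int_poly_def ieval_def)
    ultimately show False using is_min_int_poly_degree_pos[OF f] by (simp add: degree_pderiv)
  qed
  thus ?thesis by (simp add: rsquarefree_roots)
qed

text \<open>Vieta's formula for the constant term. \<open>alg_norm\<close> multiplies over the set
  of roots, so the absence of multiple roots is what makes the two products agree.\<close>

lemma cmod_alg_norm:
  assumes f: "is_min_int_poly \<tau> f"
  shows "cmod (alg_norm \<tau>) = \<bar>of_int (coeff f 0)\<bar>"
proof -
  let ?F = "map_poly of_int f :: complex poly"
  have lc: "lead_coeff ?F = 1" using f by (simp add: coeff_map_poly is_min_int_poly_def)
  have "?F = smult (lead_coeff ?F) (\<Prod>z|poly ?F z = 0. [:-z, 1:])"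
    using complex_poly_decompose_rsquarefree[OF rsquarefree_min_int_poly[OF f]] by simp
  hence "poly ?F 0 = poly (\<Prod>z|poly ?F z = 0. [:-z, 1:]) 0" unfolding lc by simp
  hence "cmod (poly ?F 0) = (\<Prod>z|poly ?F z = 0. cmod z)"
    by (simp add: poly_prod prod_norm[symmetric])
  moreover have "cmod (alg_norm \<tau>) = (\<Prod>z|poly ?F z = 0. cmod z)"
    by (simp add: alg_norm_def min_poly_eq[OF f] map_poly_of_rat_of_int prod_norm)
  ultimately show ?thesis by (simp add: poly_0_coeff_0 coeff_map_poly)
qed

text \<open>Otherwise dividing \<open>f\<close> by X would leave an annihilator of smaller
  degree.\<close>

lemma coeff_0_min_int_poly:
  assumes f: "is_min_int_poly \<tau> f" and "\<tau> \<noteq> 0"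
  shows "coeff f 0 \<noteq> 0"
proof
  assume 0: "coeff f 0 = 0"
  obtain a h where fh: "f = pCons a h" by (cases f)
  have "a = 0" using 0 fh by simp
  have "h \<noteq> 0" using is_min_int_poly_degree_pos[OF f] fh by auto
  moreover have "ieval \<tau> h = 0" using f fh assms(2) \<open>a = 0\<close> by (simp add: is_min_int_poly_def)
  ultimately show False using f fh by (force simp: is_min_int_poly_def)
qed

section \<open>Divisibility by powers of \<open>\<tau>\<close> and the number of digits\<close>

lemma int_adjoin_eq: "int_adjoin \<tau> = range (ieval \<tau>)"
  by (simp add: int_adjoin_def ieval_def)

lemma int_adjoin_closed:
  shows "x \<in> int_adjoin \<tau> \<Longrightarrow> y \<in> int_adjoin \<tau> \<Longrightarrow> x + y \<in> int_adjoin \<tau>"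
    and "x \<in> int_adjoin \<tau> \<Longrightarrow> y \<in> int_adjoin \<tau> \<Longrightarrow> x - y \<in> int_adjoin \<tau>"
    and "x \<in> int_adjoin \<tau> \<Longrightarrow> y \<in> int_adjoin \<tau> \<Longrightarrow> x * y \<in> int_adjoin \<tau>"
    and "of_int k \<in> int_adjoin \<tau>" and "of_nat n \<in> int_adjoin \<tau>" and "\<tau> \<in> int_adjoin \<tau>"
    and "0 \<in> int_adjoin \<tau>"
proof -
  show "of_int k \<in> int_adjoin \<tau>" for k
    unfolding int_adjoin_eq by (rule range_eqI[of _ _ "[:k:]"]) simp
  from this[of "int n"] this[of 0] show "of_nat n \<in> int_adjoin \<tau>" "0 \<in> int_adjoin \<tau>" by simp_all
  show "\<tau> \<in> int_adjoin \<tau>"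
    unfolding int_adjoin_eq by (rule range_eqI[of _ _ "[:0, 1:]"]) simp
qed (auto simp: int_adjoin_eq simp flip: ieval_simps ieval_diff)

lemma adjoin_dvd_diff:
  "adjoin_dvd \<tau> a x \<Longrightarrow> adjoin_dvd \<tau> a y \<Longrightarrow> adjoin_dvd \<tau> a (x - y)"
  unfolding adjoin_dvd_def using int_adjoin_closed(2) by (metis right_diff_distrib)

lemma adjoin_dvd_trans_power:
  assumes "adjoin_dvd \<tau> (\<tau> ^ Suc k) x" shows "adjoin_dvd \<tau> \<tau> x"
proof -
  have "\<tau> ^ k \<in> int_adjoin \<tau>"
  proof (induction k)
    case 0
    show ?case using int_adjoin_closed(5)[of 1] by simp
  qed (simp add: int_adjoin_closed)
  with assms int_adjoin_closed(3) show ?thesis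
    unfolding adjoin_dvd_def by (fastforce simp: mult.assoc)
qed

text \<open>This is the isomorphism of \<open>\<int>[\<tau>]\<close> modulo \<open>\<tau>\<close>
  with the integers modulo f(0): an annihilator is a multiple of \<open>f\<close>, so its constant
  term is a multiple of f(0). Conversely, f(\<open>\<tau>\<close>) = 0 exhibits f(0) as a multiple
  of \<open>\<tau>\<close>.\<close>

lemma adjoin_dvd_iff:
  assumes f: "is_min_int_poly \<tau> f"
  shows "adjoin_dvd \<tau> \<tau> (ieval \<tau> p) \<longleftrightarrow> coeff f 0 dvd coeff p 0"
proof
  assume "adjoin_dvd \<tau> \<tau> (ieval \<tau> p)"
  then obtain g where "ieval \<tau> p = \<tau> * ieval \<tau> g" by (auto simp: adjoin_dvd_def int_adjoin_eq)
  hence "ieval \<tau> (p - pCons 0 g) = 0" by simp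
  from ieval_eq_0_imp_dvd[OF f this] obtain h where "p - pCons 0 g = f * h" by blast
  hence "coeff (p - pCons 0 g) 0 = coeff f 0 * coeff h 0" by (simp add: coeff_mult)
  thus "coeff f 0 dvd coeff p 0" by simp
next
  assume "coeff f 0 dvd coeff p 0"
  then obtain k where k: "coeff p 0 = coeff f 0 * k" by blast
  obtain a f' where f': "f = pCons a f'" by (cases f)
  obtain b p' where p': "p = pCons b p'" by (cases p)
  have "of_int a = - \<tau> * ieval \<tau> f'"
    using f f' by (simp add: is_min_int_poly_def add_eq_0_iff2)
  hence "ieval \<tau> p = \<tau> * ieval \<tau> (p' - smult k f')"
    using k f' p' by (simp add: algebra_simps)
  thus "adjoin_dvd \<tau> \<tau> (ieval \<tau> p)"
    unfolding adjoin_dvd_def int_adjoin_eq by blast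
qed

lemma adjoin_residue_mod_tau:
  assumes f: "is_min_int_poly \<tau> f" and "\<tau> \<noteq> 0" and m: "m = nat \<bar>coeff f 0\<bar>" and z: "z \<in> int_adjoin \<tau>"
  shows "\<exists>!d. d < m \<and> adjoin_dvd \<tau> \<tau> (z - of_nat d)"
proof -
  have c0: "coeff f 0 \<noteq> 0" using coeff_0_min_int_poly[OF assms(1,2)] .
  obtain p where p: "z = ieval \<tau> p" using z by (auto simp: int_adjoin_eq)
  have "z - of_nat d = ieval \<tau> (p - [:int d:])" for d by (simp add: p)
  hence iff: "adjoin_dvd \<tau> \<tau> (z - of_nat d) \<longleftrightarrow> int m dvd coeff p 0 - int d" for d
    using adjoin_dvd_iff[OF f, of "p - [:int d:]"] by (simp add: m)
  have m0: "m > 0" using c0 m by simp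
  show ?thesis unfolding iff
  proof (rule ex1I[of _ "nat (coeff p 0 mod int m)"])
    show "nat (coeff p 0 mod int m) < m \<and> int m dvd coeff p 0 - int (nat (coeff p 0 mod int m))"
      using m0 by (simp add: nat_less_iff) 
    show "d = nat (coeff p 0 mod int m)" if "d < m \<and> int m dvd coeff p 0 - int d" for d
      using that by (metis mod_eq_dvd_iff mod_less nat_int of_nat_mod)
  qed
qed

text \<open>Horner form of the sums of d_i \<open>\<tau>\<close>^i over i < k with digits 0 <= d_i <
  m; they will represent the classes modulo \<open>\<tau> ^ k\<close>.\<close>

fun residues_tau :: "complex \<Rightarrow> nat \<Rightarrow> nat \<Rightarrow> complex set" where
  "residues_tau \<tau> m 0 = {0}"
| "residues_tau \<tau> m (Suc k) = (\<lambda>(d, r). of_nat d + \<tau> * r) ` ({..<m} \<times> residues_tau \<tau> m k)"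

text \<open>The lowest digit is determined modulo \<open>\<tau>\<close>; once the lowest digits
  agree, a factor \<open>\<tau>\<close> cancels.\<close>

lemma digit_pair_unique:
  assumes f: "is_min_int_poly \<tau> f" "\<tau> \<noteq> 0" "m = nat \<bar>coeff f 0\<bar>"
    and "d < m" "d' < m" "r \<in> int_adjoin \<tau>" "r' \<in> int_adjoin \<tau>"
    and "adjoin_dvd \<tau> (\<tau> ^ Suc k) ((of_nat d + \<tau> * r) - (of_nat d' + \<tau> * r'))"
  shows "d = d' \<and> adjoin_dvd \<tau> (\<tau> ^ k) (r - r')"
proof -
  have "adjoin_dvd \<tau> \<tau> ((of_nat d + \<tau> * r) - (of_nat d' + \<tau> * r'))"
    by (rule adjoin_dvd_trans_power) fact
  then obtain c where c: "c \<in> int_adjoin \<tau>" "(of_nat d + \<tau> * r) - (of_nat d' + \<tau> * r') = \<tau> * c"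
    by (auto simp: adjoin_dvd_def)
  have "of_nat d - of_nat d' = \<tau> * (c - r + r')" using c(2) by (simp add: algebra_simps)
  hence "adjoin_dvd \<tau> \<tau> (of_nat d - of_nat d')"
    using c(1) assms int_adjoin_closed unfolding adjoin_dvd_def by blast
  moreover have "adjoin_dvd \<tau> \<tau> (of_nat d - of_nat d)"
    unfolding adjoin_dvd_def using int_adjoin_closed(7)[of \<tau>] by auto
  ultimately have dd: "d = d'"
    using adjoin_residue_mod_tau[OF f int_adjoin_closed(5)[of d]] assms(4,5) by blast
  obtain c where c: "c \<in> int_adjoin \<tau>" "(of_nat d + \<tau> * r) - (of_nat d' + \<tau> * r') = \<tau> ^ Suc k * c"
    using assms(8) by (auto simp: adjoin_dvd_def)
  hence "\<tau> * (r - r') = \<tau> * (\<tau> ^ k * c)" using dd by (simp add: algebra_simps)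
  hence "r - r' = \<tau> ^ k * c" using \<open>\<tau> \<noteq> 0\<close> by simp
  with c dd show ?thesis by (auto simp: adjoin_dvd_def)
qed

lemma residues_tau:
  assumes f: "is_min_int_poly \<tau> f" "\<tau> \<noteq> 0" "m = nat \<bar>coeff f 0\<bar>"
  shows "finite (residues_tau \<tau> m k)" "residues_tau \<tau> m k \<subseteq> int_adjoin \<tau>"
    and "card (residues_tau \<tau> m k) = m ^ k"
    and "z \<in> int_adjoin \<tau> \<Longrightarrow> \<exists>!r. r \<in> residues_tau \<tau> m k \<and> adjoin_dvd \<tau> (\<tau> ^ k) (z - r)"
proof -
  let ?R = "residues_tau \<tau> m"
  have "finite (?R k) \<and> ?R k \<subseteq> int_adjoin \<tau> \<and> card (?R k) = m ^ k \<and>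
        (\<forall>z\<in>int_adjoin \<tau>. \<exists>!r. r \<in> ?R k \<and> adjoin_dvd \<tau> (\<tau> ^ k) (z - r))"
  proof (induction k)
    case 0
    show ?case using int_adjoin_closed(7)[of \<tau>] by (auto simp: adjoin_dvd_def)
  next
    case (Suc k)
    hence IH: "finite (?R k)" "?R k \<subseteq> int_adjoin \<tau>" "card (?R k) = m ^ k"
      and IHz: "\<And>z. z \<in> int_adjoin \<tau> \<Longrightarrow> \<exists>!r. r \<in> ?R k \<and> adjoin_dvd \<tau> (\<tau> ^ k) (z - r)"
      by auto
    have uniq: "d = d' \<and> r = r'" if "d < m" "d' < m" "r \<in> ?R k" "r' \<in> ?R k"
       "adjoin_dvd \<tau> (\<tau> ^ Suc k) ((of_nat d + \<tau> * r) - (of_nat d' + \<tau> * r'))" for d d' r r'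
    proof -
      have *: "d = d' \<and> adjoin_dvd \<tau> (\<tau> ^ k) (r - r')"
        using that IH(2) by (intro digit_pair_unique[OF f]) auto
      have "adjoin_dvd \<tau> (\<tau> ^ k) (r - r)"
        unfolding adjoin_dvd_def using int_adjoin_closed(7)[of \<tau>] by auto
      with * IHz[of r] that IH(2) show ?thesis by blast
    qed
    have 1: "adjoin_dvd \<tau> (\<tau> ^ Suc k) 0"
      unfolding adjoin_dvd_def using int_adjoin_closed(7)[of \<tau>] by auto
    have inj: "inj_on (\<lambda>(d, r). of_nat d + \<tau> * r) ({..<m} \<times> ?R k)"
      by (rule inj_onI) (use uniq 1 in \<open>auto\<close>)
    have sub: "?R (Suc k) \<subseteq> int_adjoin \<tau>"
      using IH(2) by (auto intro!: int_adjoin_closed)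
    have "\<exists>!r. r \<in> ?R (Suc k) \<and> adjoin_dvd \<tau> (\<tau> ^ Suc k) (z - r)" if z: "z \<in> int_adjoin \<tau>" for z
    proof -
      obtain d where d: "d < m" "adjoin_dvd \<tau> \<tau> (z - of_nat d)"
        using adjoin_residue_mod_tau[OF f z] by blast
      then obtain c where c: "c \<in> int_adjoin \<tau>" "z - of_nat d = \<tau> * c" by (auto simp: adjoin_dvd_def)
      obtain r where r: "r \<in> ?R k" "adjoin_dvd \<tau> (\<tau> ^ k) (c - r)" using IHz[OF c(1)] by blast
      then obtain e where e: "e \<in> int_adjoin \<tau>" "c - r = \<tau> ^ k * e" by (auto simp: adjoin_dvd_def)
      have "z - (of_nat d + \<tau> * r) = \<tau> * (c - r)" using c(2) by (simp add: algebra_simps)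
      hence "z - (of_nat d + \<tau> * r) = \<tau> ^ Suc k * e" using e(2) by simp
      hence ex: "adjoin_dvd \<tau> (\<tau> ^ Suc k) (z - (of_nat d + \<tau> * r))"
        using e by (auto simp: adjoin_dvd_def)
      show ?thesis
      proof (rule ex1I[of _ "of_nat d + \<tau> * r"])
        fix r' assume r': "r' \<in> ?R (Suc k) \<and> adjoin_dvd \<tau> (\<tau> ^ Suc k) (z - r')"
        then obtain d'' r'' where dr: "d'' < m" "r'' \<in> ?R k" "r' = of_nat d'' + \<tau> * r''" by auto
        have "adjoin_dvd \<tau> (\<tau> ^ Suc k) ((z - (of_nat d + \<tau> * r)) - (z - r'))"
          using ex r' adjoin_dvd_diff by blast
        hence "adjoin_dvd \<tau> (\<tau> ^ Suc k) ((of_nat d'' + \<tau> * r'') - (of_nat d + \<tau> * r))"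
          by (simp add: dr algebra_simps)
        from uniq[OF dr(1) d(1) dr(2) r(1) this] show "r' = of_nat d + \<tau> * r" by (simp add: dr)
      qed (use d r ex in auto)
    qed
    with sub show ?case using IH by (simp add: card_image[OF inj])
  qed
  thus "finite (?R k)" "?R k \<subseteq> int_adjoin \<tau>" "card (?R k) = m ^ k"
    "z \<in> int_adjoin \<tau> \<Longrightarrow> \<exists>!r. r \<in> ?R k \<and> adjoin_dvd \<tau> (\<tau> ^ k) (z - r)" by blast+
qed

text \<open>The nonzero digits and the representatives with nonzero lowest digit both pick one
  element from each class not divisible by \<open>\<tau>\<close>, so reduction modulo
  \<open>\<tau> ^ w\<close> is a bijection between them. The latter have m - 1 choices for the
  lowest digit and m for each of the others.\<close>

lemma card_reduced_residue_digit_set: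
  assumes f: "is_min_int_poly \<tau> f" "\<tau> \<noteq> 0" "m = nat \<bar>coeff f 0\<bar>"
    and D: "reduced_residue_digit_set \<tau> w D" and w: "w \<ge> 1"
  shows "finite D" "card (D - {0}) = (m - 1) * m ^ (w - 1)"
proof -
  define R where "R = residues_tau \<tau> m w"
  define R' where "R' = (\<lambda>(d, r). of_nat d + \<tau> * r) ` ({1..<m} \<times> residues_tau \<tau> m (w - 1))"
  obtain k where k: "w = Suc k" using w by (cases w) auto
  note R = residues_tau[OF f]
  have R'R: "R' \<subseteq> R" by (auto simp: R'_def R_def k)
  have dvd0: "adjoin_dvd \<tau> a 0" for a
    unfolding adjoin_dvd_def using int_adjoin_closed(7)[of \<tau>] by auto
  have inj: "inj_on (\<lambda>(d, r). of_nat d + \<tau> * r) ({1..<m} \<times> residues_tau \<tau> m (w - 1))"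
  proof (rule inj_onI, clarsimp)
    fix d r d' r' assume *: "d < m" "d' < m" "r \<in> residues_tau \<tau> m (w - Suc 0)"
      "r' \<in> residues_tau \<tau> m (w - Suc 0)" "of_nat d + \<tau> * r = of_nat d' + \<tau> * r'"
    have "adjoin_dvd \<tau> (\<tau> ^ Suc k) ((of_nat d + \<tau> * r) - (of_nat d' + \<tau> * r'))"
      using * dvd0 by simp
    from digit_pair_unique[OF f *(1,2) _ _ this] have "d = d'" using * R(2)[of "w - 1"] by auto
    thus "d = d' \<and> r = r'" using *(5) f(2) by simp
  qed
  have card_R': "card R' = (m - 1) * m ^ (w - 1)"
    unfolding R'_def card_image[OF inj] card_cartesian_product using R(3)[of "w - 1"] by simp
  have fin: "finite R'" unfolding R'_def using R(1)[of "w - 1"] by simp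
  have R'_iff: "r \<in> R' \<longleftrightarrow> r \<in> R \<and> \<not> adjoin_dvd \<tau> \<tau> r" for r
  proof -
    have *: "adjoin_dvd \<tau> \<tau> (of_nat d + \<tau> * s) \<longleftrightarrow> d = 0"
      if "d < m" "s \<in> residues_tau \<tau> m k" for d s
    proof
      assume "adjoin_dvd \<tau> \<tau> (of_nat d + \<tau> * s)"
      hence "adjoin_dvd \<tau> (\<tau> ^ Suc 0) ((of_nat d + \<tau> * s) - (of_nat 0 + \<tau> * 0))" by simp
      from digit_pair_unique[OF f _ _ _ _ this] show "d = 0"
        using that R(2)[of k] int_adjoin_closed(7)[of \<tau>] by auto
    qed (use that R(2)[of k] in \<open>auto simp: adjoin_dvd_def\<close>)
    show ?thesis
    proof
      assume "r \<in> R'" thus "r \<in> R \<and> \<not> adjoin_dvd \<tau> \<tau> r"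
        using R'R * by (auto simp: R'_def k)
    next
      assume r: "r \<in> R \<and> \<not> adjoin_dvd \<tau> \<tau> r"
      then obtain d s where ds: "d < m" "s \<in> residues_tau \<tau> m k" "r = of_nat d + \<tau> * s"
        by (auto simp: R_def k)
      moreover have "d \<noteq> 0" using r ds *[of d s] by auto
      ultimately show "r \<in> R'" by (auto simp: R'_def k intro!: image_eqI[of _ _ "(d, s)"])
    qed
  qed
  have D': "D \<subseteq> int_adjoin \<tau>" "\<And>d. d \<in> D - {0} \<Longrightarrow> \<not> adjoin_dvd \<tau> \<tau> d"
    "\<And>z. z \<in> int_adjoin \<tau> \<Longrightarrow> \<not> adjoin_dvd \<tau> \<tau> z \<Longrightarrow> \<exists>!d. d \<in> D - {0} \<and> adjoin_dvd \<tau> (\<tau> ^ w) (z - d)"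
    using D unfolding reduced_residue_digit_set_def by auto
  have Rz: "\<exists>!r. r \<in> R \<and> adjoin_dvd \<tau> (\<tau> ^ w) (z - r)" if "z \<in> int_adjoin \<tau>" for z
    using R(4)[OF that] unfolding R_def .
  have sym: "adjoin_dvd \<tau> a (x - y)" if "adjoin_dvd \<tau> a (y - x)" for a x y
    using adjoin_dvd_diff[OF dvd0 that] by simp
  \<comment> \<open>Divisibility by \<open>\<tau>\<close> depends only on the class modulo
    \<open>\<tau> ^ w\<close>, because w >= 1.\<close>
  have nd: "\<not> adjoin_dvd \<tau> \<tau> y" if "\<not> adjoin_dvd \<tau> \<tau> x" "adjoin_dvd \<tau> (\<tau> ^ w) (x - y)" for x y
  proof
    assume "adjoin_dvd \<tau> \<tau> y"
    moreover have "adjoin_dvd \<tau> \<tau> (y - x)"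
      by (rule adjoin_dvd_trans_power[of _ k]) (use sym[OF that(2)] k in simp)
    ultimately show False using adjoin_dvd_diff[of \<tau> \<tau> y "y - x"] that by simp
  qed
  define g where "g z = (THE r. r \<in> R \<and> adjoin_dvd \<tau> (\<tau> ^ w) (z - r))" for z
  have g: "g z \<in> R \<and> adjoin_dvd \<tau> (\<tau> ^ w) (z - g z)" if "z \<in> int_adjoin \<tau>" for z
    unfolding g_def by (rule theI') (rule Rz[OF that])
  have "bij_betw g (D - {0}) R'"
    unfolding bij_betw_def
  proof
    show "inj_on g (D - {0})"
    proof (rule inj_onI)
      fix x y assume xy: "x \<in> D - {0}" "y \<in> D - {0}" "g x = g y"
      have xyR: "x \<in> int_adjoin \<tau>" "y \<in> int_adjoin \<tau>" using xy(1,2) D'(1) by auto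
      have "adjoin_dvd \<tau> (\<tau> ^ w) ((x - g x) - (y - g y))"
        by (rule adjoin_dvd_diff[OF conjunct2[OF g[OF xyR(1)]] conjunct2[OF g[OF xyR(2)]]])
      hence "adjoin_dvd \<tau> (\<tau> ^ w) (x - y)" using xy by simp
      moreover have "adjoin_dvd \<tau> (\<tau> ^ w) (x - x)" using dvd0 by simp
      ultimately show "x = y" using D'(3)[OF xyR(1) D'(2)[OF xy(1)]] xy(1,2) by metis
    qed
    show "g ` (D - {0}) = R'"
    proof (intro equalityI subsetI)
      fix r assume "r \<in> g ` (D - {0})"
      then obtain x where x: "x \<in> D - {0}" "r = g x" by blast
      have xR: "x \<in> int_adjoin \<tau>" using x(1) D'(1) by auto
      have "\<not> adjoin_dvd \<tau> \<tau> r"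
        using nd[OF D'(2)[OF x(1)]] g[OF xR] unfolding x(2) by simp
      thus "r \<in> R'" using g[OF xR] unfolding R'_iff x(2) by simp
    next
      fix r assume r: "r \<in> R'"
      hence r': "r \<in> R" "\<not> adjoin_dvd \<tau> \<tau> r" "r \<in> int_adjoin \<tau>"
        using R'_iff[of r] R(2)[of w] by (auto simp: R_def)
      obtain d where d: "d \<in> D - {0}" "adjoin_dvd \<tau> (\<tau> ^ w) (r - d)"
        using D'(3)[OF r'(3,2)] by blast
      have dR: "d \<in> int_adjoin \<tau>" using d(1) D'(1) by auto
      have "g d = r" using Rz[OF dR] g[OF dR] sym[OF d(2)] r'(1) by metis
      thus "r \<in> g ` (D - {0})" using d by blast
    qed
  qed
  from bij_betw_same_card[OF this] bij_betw_finite[OF this] card_R' fin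
  show "card (D - {0}) = (m - 1) * m ^ (w - 1)" "finite D" by auto
qed

section \<open>Counts and moments\<close>

text \<open>Jordan's inequality: by concavity the sine lies above its chord.\<close>

lemma sin_ge_linear:
  fixes x :: real
  assumes "0 \<le> x" "x \<le> pi / 2"
  shows "2 / pi * x \<le> sin x"
proof -
  have "concave_on {0..pi/2} sin"
    by (rule f''_le0_imp_concave[where f' = cos and f'' = "\<lambda>x. - sin x"])
       (auto intro!: derivative_eq_intros sin_ge_zero)
  moreover have "2 / pi * x \<le> 1" using assms by (simp add: field_simps)
  ultimately have "(1 - 2 / pi * x) * sin 0 + (2 / pi * x) * sin (pi / 2) \<le>
      sin ((1 - 2 / pi * x) *\<^sub>R 0 + (2 / pi * x) *\<^sub>R (pi / 2))"
    using assms by (intro concave_onD) auto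
  thus ?thesis by simp
qed

text \<open>Half-angle form of Jordan's inequality. It keeps the zeros of \<open>q_poly\<close> off
  the unit circle, bounds the kernel of the Fourier inversion and gives the decay of the
  characteristic functions.\<close>

lemma one_minus_cos_ge:
  fixes t :: real
  assumes "\<bar>t\<bar> \<le> pi"
  shows "1 - cos t \<ge> 2 * t\<^sup>2 / pi\<^sup>2"
proof -
  have "2 / pi * (\<bar>t\<bar> / 2) \<le> sin (\<bar>t\<bar> / 2)"
    using assms by (intro sin_ge_linear) auto
  hence "(2 / pi * (\<bar>t\<bar> / 2))\<^sup>2 \<le> (sin (\<bar>t\<bar> / 2))\<^sup>2"
    by (intro power_mono) auto
  hence "2 * (t\<^sup>2 / pi\<^sup>2) \<le> 2 * (sin (\<bar>t\<bar> / 2))\<^sup>2"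
    by (simp add: power_mult_distrib power_divide)
  also have "\<dots> = 1 - cos t"
    using cos_double_sin[of "\<bar>t\<bar> / 2"] by (simp add: cos_abs_real)
  finally show ?thesis by simp
qed

text \<open>The imaginary part of the equation forces |arg u| >= pi / w, since for smaller nonzero
  arguments both sines have the same sign. Then 1 - cos (arg u) is at least 2 / w^2, and |M - u|
  exceeds M - |u| by too much for (M - 1) |u|^w to match if |u| is close to 1. The constant 9/8
  exceeds the 1 in \<open>rho\<close>, which leaves strict room between the two radii.\<close>

lemma root_dist_from_unit_circle:
  fixes u :: complex and M :: real and w :: nat
  assumes M: "M \<ge> 2" and w: "w \<ge> 2" and "u \<noteq> 1"
    and eq: "of_real M = u + of_real (M - 1) * u ^ w"
  shows "norm u \<ge> 1 + 9 / (8 * M * real w ^ 3)"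
proof (rule ccontr)
  assume neg: "\<not> ?thesis"
  define e where "e = 9 / (8 * M * real w ^ 3)"
  define r where "r = norm u"
  define t where "t = Arg u"
  have r_less: "r < 1 + e" using neg by (simp add: r_def e_def)
  have u: "u = of_real r * cis t"
    unfolding r_def t_def cis_conv_exp by (metis rcis_def rcis_cmod_Arg cis_conv_exp)
  have t: "-pi < t" "t \<le> pi" using Arg_bounded[of u] by (auto simp: t_def)
  have r0: "r \<ge> 0" by (simp add: r_def)
  have r1: "r \<ge> 1"
  proof (rule ccontr)
    assume "\<not> r \<ge> 1"
    hence rl: "r < 1" by simp
    have "M = norm (of_real M :: complex)" using M by simp
    also have "\<dots> \<le> norm u + norm (of_real (M - 1) * u ^ w)"
      unfolding eq by (rule norm_triangle_ineq)
    also have "\<dots> = r + (M - 1) * r ^ w" using M by (simp add: r_def norm_mult norm_power del: of_real_diff)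
    also have "\<dots> \<le> r + (M - 1) * 1"
      using rl r0 M by (intro add_left_mono mult_left_mono power_le_one) auto
    finally show False using rl by simp
  qed
  have uw: "u ^ w = of_real (r ^ w) * cis (real w * t)"
    unfolding u power_mult_distrib Complex.DeMoivre by simp
  have reim: "Re u = r * cos t" "Im u = r * sin t" by (subst u, simp)+
  have im: "r * sin t + (M - 1) * r ^ w * sin (real w * t) = 0"
    using arg_cong[OF eq, of Im] unfolding uw by (simp add: reim)
  have "\<bar>t\<bar> \<ge> pi / w"
  proof (rule ccontr)
    assume "\<not> ?thesis"
    hence small: "\<bar>t\<bar> * w < pi" using w by (simp add: field_simps)
    have "t = 0"
    proof (rule ccontr)
      assume nz: "t \<noteq> 0"
      have abs: "\<bar>t\<bar> > 0" "\<bar>t\<bar> < pi" using nz small w t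
        by (auto intro: le_less_trans[OF _ small] simp: mult_le_cancel_left1)
      have "r * sin \<bar>t\<bar> + (M - 1) * r ^ w * sin (real w * \<bar>t\<bar>) > 0"
        using abs small r1 M w
        by (intro add_pos_pos mult_pos_pos sin_gt_zero) (auto simp: mult.commute)
      moreover have "r * sin \<bar>t\<bar> + (M - 1) * r ^ w * sin (real w * \<bar>t\<bar>) = 0"
        using im by (cases "t \<ge> 0") auto
      ultimately show False by simp
    qed
    \<comment> \<open>On the positive axis M = r + (M - 1) r^w with r >= 1 has only the excluded
      solution r = 1.\<close>
    hence ur: "u = of_real r" using u by simp
    hence "complex_of_real M = of_real (r + (M - 1) * r ^ w)" using eq by simp
    hence Mr: "M = r + (M - 1) * r ^ w" by (simp only: of_real_eq_iff)
    have "(M - 1) * r ^ w \<ge> (M - 1) * 1" using r1 M by (intro mult_left_mono) auto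
    hence "r = 1" using Mr r1 by simp
    thus False using ur \<open>u \<noteq> 1\<close> by simp
  qed
  hence "(pi / w)\<^sup>2 \<le> \<bar>t\<bar>\<^sup>2" using w by (intro power_mono) auto
  hence "2 * (pi / w)\<^sup>2 / pi\<^sup>2 \<le> 2 * t\<^sup>2 / pi\<^sup>2"
    by (intro divide_right_mono) auto
  also have "\<dots> \<le> 1 - cos t" using t by (intro one_minus_cos_ge) auto
  finally have cos_le: "2 / w\<^sup>2 \<le> 1 - cos t" by (simp add: power_divide)
  have w3: "real w ^ 3 \<ge> 8" using power_mono[of 2 "real w" 3] w by simp
  have w2: "real w ^ 2 \<ge> 4" using power_mono[of 2 "real w" 2] w by simp
  have "M * real w ^ 3 \<ge> 2 * 8" using M w3 by (intro mult_mono) auto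
  hence e0: "e > 0" "e \<le> 1" using M w by (auto simp: e_def field_simps)
  \<comment> \<open>Law of cosines for |M - u|^2, compared with |(M - 1) u^w|^2.\<close>
  have "norm (of_real M - u) = norm (of_real (M - 1) * u ^ w)" by (subst eq) simp
  hence nM: "(norm (of_real M - u))\<^sup>2 = (M - 1)\<^sup>2 * r ^ (2 * w)"
    using M by (simp add: norm_mult norm_power r_def power_mult_distrib power_mult mult.commute[of 2] del: of_real_diff)
  have "(norm (of_real M - u))\<^sup>2 = (M - r * cos t)\<^sup>2 + (r * sin t)\<^sup>2"
    unfolding cmod_power2 by (simp add: reim)
  also have "\<dots> = M\<^sup>2 - 2 * M * r * cos t + r\<^sup>2 * ((sin t)\<^sup>2 + (cos t)\<^sup>2)"
    by algebra
  also have "\<dots> = (M - r)\<^sup>2 + 2 * M * r * (1 - cos t)"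
    by (simp add: power2_eq_square algebra_simps)
  finally have main: "(M - 1)\<^sup>2 * r ^ (2 * w) = (M - r)\<^sup>2 + 2 * M * r * (1 - cos t)" using nM by simp
  have lower1: "(M - r)\<^sup>2 \<ge> (M - 1)\<^sup>2 - 2 * (M - 1) * e"
  proof -
    have "(M - 1 - e)\<^sup>2 \<le> (M - r)\<^sup>2" using r_less e0 M by (intro power_mono) auto
    moreover have "(M - 1 - e)\<^sup>2 = (M - 1)\<^sup>2 - 2 * (M - 1) * e + e\<^sup>2"
      by (simp add: power2_eq_square algebra_simps)
    ultimately show ?thesis using zero_le_power2[of e] by linarith
  qed
  have lower2: "2 * M * r * (1 - cos t) \<ge> 4 * M / w\<^sup>2"
  proof -
    have "2 * M * 1 * (2 / w\<^sup>2) \<le> 2 * M * r * (1 - cos t)"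
      using M r1 cos_le by (intro mult_mono) auto
    thus ?thesis by simp
  qed
  \<comment> \<open>Chosen as 2 w e, so that r^(2w) <= (1 + e)^(2w) <= exp x. As M w^2 >= 8, x is at
    most 9/32, whence the factor 41/32 = 1 + 9/32 below.\<close>
  define x where "x = 9 / (4 * M * w\<^sup>2)"
  have xe: "x = 2 * w * e" using w M by (simp add: x_def e_def field_simps power3_eq_cube power2_eq_square)
  have Mw: "M * w\<^sup>2 \<ge> 2 * 4" using M w2 by (intro mult_mono) auto
  have x: "0 < x" "x \<le> 9 / 32" using M w Mw by (auto simp: x_def field_simps)
  have "r ^ (2 * w) \<le> (1 + e) ^ (2 * w)" using r_less r0 by (intro power_mono) auto
  also have "\<dots> \<le> exp e ^ (2 * w)" using e0 by (intro power_mono exp_ge_add_one_self) auto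
  also have "\<dots> = exp x" by (simp add: xe exp_of_nat_mult[symmetric])
  also have "\<dots> \<le> 1 + x + x\<^sup>2" using x by (intro exp_bound) auto
  also have "x\<^sup>2 \<le> 9 / 32 * x" using x by (simp add: power2_eq_square)
  finally have "r ^ (2 * w) \<le> 1 + 41 / 32 * x" by simp
  hence "(M - 1)\<^sup>2 * r ^ (2 * w) \<le> (M - 1)\<^sup>2 * (1 + 41 / 32 * x)" by (intro mult_left_mono) auto
  hence A: "4 * M / w\<^sup>2 - 2 * (M - 1) * e \<le> (M - 1)\<^sup>2 * (41 / 32) * x"
    using main lower1 lower2 by (simp only: distrib_left mult_1_right mult.assoc)
  have "(M - 1)\<^sup>2 \<le> M * M" using M by (simp add: power2_eq_square mult_mono)
  hence "(M - 1)\<^sup>2 * ((41 / 32) * x) \<le> M * M * ((41 / 32) * x)" using x by (intro mult_right_mono) auto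
  also have "\<dots> = (369 / 128) * M / w\<^sup>2" using M by (simp add: x_def field_simps)
  finally have B: "(M - 1)\<^sup>2 * (41 / 32) * x \<le> (369 / 128) * M / w\<^sup>2" by simp
  have "2 * (M - 1) * e \<le> 2 * M * e" using e0 by simp
  also have "\<dots> = 9 / (4 * real w ^ 3)" using M by (simp add: e_def)
  also have "\<dots> \<le> 9 / (4 * (2 * w\<^sup>2))"
    using w by (intro divide_left_mono) (auto simp: power3_eq_cube power2_eq_square mult_mono)
  also have "\<dots> \<le> 9 / 16 * M / w\<^sup>2" using M w by (simp add: field_simps)
  finally have C: "2 * (M - 1) * e \<le> 9 / 16 * M / w\<^sup>2" .
  \<comment> \<open>After cancelling M / w^2 this says 4 <= 369/128 + 9/16 = 441/128.\<close>
  have "4 * M / w\<^sup>2 \<le> (369 / 128) * M / w\<^sup>2 + 9 / 16 * M / w\<^sup>2" using A B C by linarith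
  hence "4 * M \<le> (369 / 128) * M + 9 / 16 * M" using w by (simp add: field_simps)
  thus False using M by simp
qed

text \<open>Recursion on the leading digit: either it is zero, or it is one of the nonzero digits, of total
  weight \<open>x\<close>, and the next \<open>w - 1\<close> digits vanish. Truncated subtraction covers words of length at
  most \<open>w\<close>.\<close>

fun naf_gf :: "nat \<Rightarrow> 'a::comm_ring_1 \<Rightarrow> nat \<Rightarrow> 'a" where
  "naf_gf w x 0 = 1"
| "naf_gf w x (Suc n) = naf_gf w x n + x * naf_gf w x (n - (w - 1))"

lemma poly_naf_gf: "poly (naf_gf w p n) y = naf_gf w (poly p y) n"
  by (induction w p n rule: naf_gf.induct) simp_all

text \<open>Generic over the field: the real version gives the power series, the complex one the
  zeros. For w >= 1 the constant coefficient is 1.\<close>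

definition q_poly :: "nat \<Rightarrow> 'a::field \<Rightarrow> 'a poly" where
  "q_poly w M = [:1 / M:] + smult ((M - 1) / M) (\<Sum>i<w. monom 1 i)"

lemma poly_q_poly: "poly (q_poly w M) z = 1 / M + (M - 1) / M * (\<Sum>i<w. z ^ i)"
  by (simp add: q_poly_def poly_sum poly_monom)

lemma q_poly_mult_one_minus:
  fixes M z :: "'a::field"
  assumes "M \<noteq> 0"
  shows "(1 - z) * poly (q_poly w M) z = (M - z - (M - 1) * z ^ w) / M"
proof -
  have "(1 - z) * poly (q_poly w M) z = (1 - z) / M + (M - 1) / M * ((1 - z) * (\<Sum>i<w. z ^ i))"
    unfolding poly_q_poly distrib_left by simp
  also have "(1 - z) * (\<Sum>i<w. z ^ i) = 1 - z ^ w" by (rule one_diff_power_eq[symmetric])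
  also have "(1 - z) / M + (M - 1) / M * (1 - z ^ w) = (M - z - (M - 1) * z ^ w) / M"
    by (simp only: add_divide_distrib[symmetric] times_divide_eq_left)
       (simp add: algebra_simps)
  finally show ?thesis .
qed

lemma q_poly_nonzero:
  fixes M :: real and z :: complex
  assumes M: "M = 1 \<or> M \<ge> 2" and w: "w \<ge> 2"
    and z: "norm z < 1 + 9 / (8 * M * real w ^ 3)"
  shows "poly (q_poly w (of_real M)) z \<noteq> 0"
proof
  assume 0: "poly (q_poly w (of_real M)) z = 0"
  have M0: "M > 0" using M by auto
  show False
  proof (cases "M = 1")
    case True
    thus False using 0 by (simp add: poly_q_poly)
  next
    case False
    hence M2: "M \<ge> 2" using M by simp
    \<comment> \<open>The factor 1 - z of \<open>q_poly_mult_one_minus\<close> vanishes here and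
      says nothing about \<open>q_poly\<close>, whose value at 1 is a positive real number.\<close>
    have "z \<noteq> 1"
    proof
      assume "z = 1"
      hence "complex_of_real (1 / M + (M - 1) / M * w) = 0" using 0 by (simp add: poly_q_poly)
      hence "1 / M + (M - 1) / M * w = 0" by (simp only: of_real_eq_0_iff)
      moreover have "1 / M + (M - 1) / M * w > 0" using M2 by (intro add_pos_nonneg) auto
      ultimately show False by simp
    qed
    have "of_real M - z - (of_real M - 1) * z ^ w = 0"
      using q_poly_mult_one_minus[of "of_real M :: complex" z w] 0 M0 by simp
    hence "of_real M = z + of_real (M - 1) * z ^ w" by (simp add: algebra_simps)
    from root_dist_from_unit_circle[OF M2 w \<open>z \<noteq> 1\<close> this] z show False by simp
  qed
qed

section \<open>Power series regular beyond the unit disc\<close>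

definition Q_fps :: "nat \<Rightarrow> real \<Rightarrow> real fps" where
  "Q_fps w M = inverse (fps_of_poly (q_poly w M))"

lemma coeff_q_poly_0: "w \<ge> 1 \<Longrightarrow> M \<noteq> 0 \<Longrightarrow> coeff (q_poly w (M::'a::field)) 0 = 1"
  by (simp add: q_poly_def coeff_sum coeff_monom field_simps)

lemma Q_fps_mult:
  assumes "w \<ge> 1" "M \<noteq> 0" shows "fps_of_poly (q_poly w M) * Q_fps w M = 1"
  unfolding Q_fps_def using coeff_q_poly_0[OF assms] by (simp add: inverse_mult_eq_1')

text \<open>The radius depends only on the absolute values of the coefficients, so the real series
  is read as a complex one, the inverse of a polynomial without zeros in the disc.\<close>

lemma fps_conv_radius_Q_fps:
  assumes M: "M = 1 \<or> M \<ge> 2" and w: "w \<ge> 2"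
  shows "fps_conv_radius (Q_fps w M) \<ge> ereal (1 + 9 / (8 * M * real w ^ 3))"
proof -
  define R where "R = ereal (1 + 9 / (8 * M * real w ^ 3))"
  let ?q = "fps_of_poly (q_poly w (complex_of_real M))"
  define C where "C = Abs_fps (\<lambda>n. complex_of_real (fps_nth (Q_fps w M) n))"
  have M0: "M \<noteq> 0" using M by auto
  have "?q * C = 1"
  proof (rule fps_ext)
    fix n
    have "coeff (q_poly w (complex_of_real M)) i = complex_of_real (coeff (q_poly w M) i)" for i
      by (simp add: q_poly_def coeff_sum coeff_pCons split: nat.splits)
    hence "fps_nth (?q * C) n = complex_of_real (fps_nth (fps_of_poly (q_poly w M) * Q_fps w M) n)"
      by (simp add: fps_mult_nth C_def)
    also have "\<dots> = fps_nth 1 n" using w M0 by (subst Q_fps_mult) auto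
    finally show "fps_nth (?q * C) n = fps_nth 1 n" .
  qed
  hence C: "C = inverse ?q" by (simp add: fps_inverse_unique)
  have "min R (fps_conv_radius ?q) \<le> fps_conv_radius (inverse ?q)"
    by (rule fps_conv_radius_inverse) (use q_poly_nonzero[OF M w] in \<open>auto simp: R_def\<close>)
  hence "R \<le> fps_conv_radius C" unfolding C by simp
  also have "fps_conv_radius C = fps_conv_radius (Q_fps w M)"
    unfolding fps_conv_radius_def by (subst (1 2) conv_radius_norm[symmetric]) (simp add: C_def)
  finally show ?thesis unfolding R_def .
qed

text \<open>Convergence at \<open>r\<close> itself bounds the terms, hence the strict inequality
  with the radius.\<close>

lemma fps_nth_bigo_if_conv_radius:
  fixes h :: "real fps"
  assumes "ereal r < fps_conv_radius h" "r > 0"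
  shows "fps_nth h \<in> O(\<lambda>n. inverse r ^ n)"
proof -
  have "summable (\<lambda>n. fps_nth h n * r ^ n)"
    using assms by (intro summable_fps) auto
  hence "Bseq (\<lambda>n. fps_nth h n * r ^ n)"
    by (intro convergent_imp_Bseq convergentI[OF summable_LIMSEQ_zero])
  then obtain K where K: "\<And>n. norm (fps_nth h n * r ^ n) \<le> K" unfolding Bseq_def by blast
  show ?thesis
  proof (rule bigoI[of _ K], rule always_eventually, rule allI)
    fix n
    show "norm (fps_nth h n) \<le> K * norm (inverse r ^ n)"
      using K[of n] assms(2) by (simp add: abs_mult power_inverse field_simps)
  qed
qed

definition L_fps :: "real fps" where "L_fps = Abs_fps (\<lambda>_. 1)"

lemma L_fps_inverse: "(1 - fps_X) * L_fps = 1"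
  using inverse_mult_eq_1[of L_fps] fps_inverse_gp'[where ?'a = real] by (simp add: L_fps_def)

lemma L_fps_nth:
  "fps_nth L_fps n = 1" "fps_nth (L_fps ^ 2) n = real n + 1"
  "fps_nth (L_fps ^ 3) n = (real n + 1) * (real n + 2) / 2"
proof -
  show L: "fps_nth L_fps n = 1" for n by (simp add: L_fps_def)
  have step: "fps_nth (L_fps * f) n = (\<Sum>i=0..n. fps_nth f i)" for f n
    by (subst mult.commute) (simp add: fps_mult_nth L)
  show L2: "fps_nth (L_fps ^ 2) n = real n + 1" for n
    unfolding power2_eq_square by (simp add: step L)
  have "(\<Sum>i=0..n. real i + 1) = (real n + 1) * (real n + 2) / 2"
    by (induction n) (simp_all add: field_simps)
  thus "fps_nth (L_fps ^ 3) n = (real n + 1) * (real n + 2) / 2"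
    using step[of "L_fps ^ 2" n] unfolding L2
    by (simp only: power3_eq_cube power2_eq_square mult.assoc)
qed

section \<open>Generating series of the count and the factorial moments\<close>

definition t_fps :: "nat \<Rightarrow> real \<Rightarrow> real fps" where
  "t_fps w M = L_fps * Q_fps w M"

text \<open>With u = M z the factor is 1 - z - N z^w, N = (M - 1) M^(w - 1), the denominator that
  belongs to the recursion of \<open>naf_gf\<close>; the rescaling moves its dominant zero to u =
  1.\<close>

lemma t_fps_mult:
  assumes "w \<ge> 1" "M \<noteq> 0"
  shows "t_fps w M * (1 - fps_const (1 / M) * fps_X - fps_const ((M - 1) / M) * fps_X ^ w) = 1"
proof -
  have geo: "(1 - fps_X) * (\<Sum>i<w. fps_X ^ i) = (1 - fps_X ^ w :: real fps)"
    by (rule one_diff_power_eq[symmetric])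
  have "(1 - fps_X) * fps_of_poly (q_poly w M) =
      fps_const (1 / M) * (1 - fps_X) + fps_const ((M - 1) / M) * ((1 - fps_X) * (\<Sum>i<w. fps_X ^ i))"
    unfolding q_poly_def fps_of_poly_add fps_of_poly_const fps_of_poly_smult fps_of_poly_sum
         fps_of_poly_monom' by (simp only: distrib_left mult_ac)
  also have "\<dots> = fps_const (1 / M) * (1 - fps_X) + fps_const ((M - 1) / M) * (1 - fps_X ^ w)"
    by (simp only: geo)
  also have "\<dots> = fps_const (1 / M + (M - 1) / M) -
      fps_const (1 / M) * fps_X - fps_const ((M - 1) / M) * fps_X ^ w"
    by (simp add: algebra_simps flip: fps_const_add)
  also have "1 / M + (M - 1) / M = 1" using assms by (simp add: field_simps)
  finally have "1 - fps_const (1 / M) * fps_X - fps_const ((M - 1) / M) * fps_X ^ w =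
      (1 - fps_X) * fps_of_poly (q_poly w M)" by simp
  hence "t_fps w M * (1 - fps_const (1 / M) * fps_X - fps_const ((M - 1) / M) * fps_X ^ w) =
      ((1 - fps_X) * L_fps) * (fps_of_poly (q_poly w M) * Q_fps w M)"
    by (simp add: t_fps_def mult_ac)
  thus ?thesis by (simp add: L_fps_inverse Q_fps_mult[OF assms])
qed

text \<open>Truncated subtraction absorbs the initial values: \<open>Y (n - (w - 1)) = Y 0\<close> for \<open>n < w\<close>.\<close>

lemma recurrence_eq_fps_nth:
  fixes M :: real and Y Z :: "nat \<Rightarrow> real"
  assumes w: "w \<ge> 1" and M: "M \<noteq> 0"
    and rec: "\<And>n. Y (Suc n) = Y n + (M - 1) * M ^ (w - 1) * Y (n - (w - 1)) + Z (n - (w - 1))"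
    and F: "F * (1 - fps_const (1 / M) * fps_X - fps_const ((M - 1) / M) * fps_X ^ w) = H"
    and init: "\<And>n. n < w \<Longrightarrow> M ^ n * fps_nth F n = Y 0"
    and H: "\<And>n. M ^ (n + w) * fps_nth H (n + w) = Z (n - (w - 1))"
  shows "M ^ n * fps_nth F n = Y (n - (w - 1))"
proof (induction n rule: less_induct)
  case (less n)
  show ?case
  proof (cases "n < w")
    case True
    thus ?thesis using init by simp
  next
    case False
    then obtain j where j: "n = j + w" by (metis add.commute le_Suc_ex not_less)
    obtain v where v: "w = Suc v" using w by (cases w) auto
    have "F = H + fps_const (1 / M) * (fps_X * F) + fps_const ((M - 1) / M) * (fps_X ^ w * F)"
      unfolding F[symmetric] by (simp add: algebra_simps)
    hence "fps_nth F n = fps_nth (H + fps_const (1 / M) * (fps_X * F) +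
        fps_const ((M - 1) / M) * (fps_X ^ w * F)) n" by simp
    also have "\<dots> = fps_nth H n + 1 / M * fps_nth F (n - 1) + (M - 1) / M * fps_nth F j"
      using w by (simp add: j fps_X_power_mult_nth)
    finally have "M ^ n * fps_nth F n = M ^ n * fps_nth H n + M ^ n / M * fps_nth F (n - 1) +
        (M - 1) * (M ^ n / M) * fps_nth F j"
      by (simp add: algebra_simps)
    also have "M ^ n / M = M ^ (n - 1)" using M by (simp add: j v)
    also have "M ^ (n - 1) * fps_nth F (n - 1) = Y j" using less[of "n - 1"] by (simp add: j v)
    also have "(M - 1) * M ^ (n - 1) * fps_nth F j = (M - 1) * M ^ (w - 1) * (M ^ j * fps_nth F j)"
      by (simp add: j v power_add)
    also have "M ^ j * fps_nth F j = Y (j - (w - 1))" using less[of j] w by (simp add: j)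
    also have "M ^ n * fps_nth H n = Z (j - (w - 1))" using H by (simp add: j)
    finally show ?thesis using rec[of j] by (simp add: j v)
  qed
qed

lemma t_fps_init:
  assumes w: "w \<ge> 1" and M: "M \<noteq> 0" and n: "n < w"
  shows "M ^ n * fps_nth (t_fps w M) n = 1"
  using n
proof (induction n)
  case 0
  have "fps_nth (t_fps w M * (1 - fps_const (1 / M) * fps_X - fps_const ((M - 1) / M) * fps_X ^ w)) 0 = 1"
    using t_fps_mult[OF w M] by simp
  thus ?case using w by (simp add: power_0_left)
next
  case (Suc n)
  let ?t = "t_fps w M"
  have "?t = 1 + fps_const (1 / M) * (fps_X * ?t) + fps_const ((M - 1) / M) * (fps_X ^ w * ?t)"
    using t_fps_mult[OF w M] by (simp add: algebra_simps)
  hence "fps_nth ?t (Suc n) = fps_nth (1 + fps_const (1 / M) * (fps_X * ?t) +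
      fps_const ((M - 1) / M) * (fps_X ^ w * ?t)) (Suc n)" by simp
  also have "\<dots> = 1 / M * fps_nth ?t n" using Suc.prems by (simp add: fps_X_power_mult_nth)
  finally show ?case using Suc M by simp
qed

text \<open>Differentiating the recursion at y = 1 reproduces it with an inhomogeneous term, namely
  the previous derivative, doubled the second time by Leibniz's rule. Each derivative thus
  contributes another factor u^w t / M^w.\<close>

lemma naf_gf_moments:
  fixes M :: real
  assumes w: "w \<ge> 1" and M: "M \<noteq> 0"
  defines "N \<equiv> (M - 1) * M ^ (w - 1)"
  defines "P \<equiv> naf_gf w [:N - 1, 1:]"
  defines "t \<equiv> t_fps w M"
  shows "poly (P n) 1 = M ^ (n + w - 1) * fps_nth t (n + w - 1)"
    and "n \<ge> 1 \<Longrightarrow> poly (pderiv (P n)) 1 = M ^ (n + w - 1) * (fps_nth (t ^ 2) (n - 1) / M ^ w)"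
    and "n \<ge> w + 1 \<Longrightarrow> poly (pderiv (pderiv (P n))) 1 =
           M ^ (n + w - 1) * (2 * fps_nth (t ^ 3) (n - 1 - w) / M ^ (2 * w))"
proof -
  let ?D = "1 - fps_const (1 / M) * fps_X - fps_const ((M - 1) / M) * fps_X ^ w"
  define U where "U = fps_const (1 / M ^ w) * fps_X ^ w * t ^ 2"
  define W where "W = fps_const (2 / M ^ w) * fps_X ^ w * (U * t)"
  have t: "t * ?D = 1" unfolding t_def by (rule t_fps_mult[OF w M])
  have A: "M ^ n * fps_nth t n = poly (P (n - (w - 1))) 1" for n
  proof (rule recurrence_eq_fps_nth[OF w M _ t, where Z = "\<lambda>_. 0" and Y = "\<lambda>n. poly (P n) 1"])
    show "M ^ n * fps_nth t n = poly (P 0) 1" if "n < w" for n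
      using t_fps_init[OF w M that] by (simp add: t_def P_def)
    show "poly (P (Suc n)) 1 = poly (P n) 1 + (M - 1) * M ^ (w - 1) * poly (P (n - (w - 1))) 1 + 0" for n
      by (simp add: P_def N_def algebra_simps)
  qed (use w in auto)
  \<comment> \<open>The factor \<open>fps_X ^ w\<close> supplies the initial value 0 of the
    derivative, since \<open>P 0\<close> is constant.\<close>
  have U_nth: "fps_nth U m = (if m < w then 0 else fps_nth (t ^ 2) (m - w) / M ^ w)" for m
    by (simp add: U_def fps_X_power_mult_nth mult.assoc)
  have B: "M ^ n * fps_nth U n = poly (pderiv (P (n - (w - 1)))) 1" for n
  proof (rule recurrence_eq_fps_nth[OF w M, where Z = "\<lambda>n. poly (P n) 1" and
          Y = "\<lambda>n. poly (pderiv (P n)) 1" and H = "fps_const (1 / M ^ w) * (fps_X ^ w * t)"])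
    have "U * ?D = fps_const (1 / M ^ w) * fps_X ^ w * t * (t * ?D)"
      by (simp add: U_def power2_eq_square mult_ac)
    thus "U * ?D = fps_const (1 / M ^ w) * (fps_X ^ w * t)" by (simp add: t mult.assoc)
    show "M ^ (n + w) * fps_nth (fps_const (1 / M ^ w) * (fps_X ^ w * t)) (n + w) =
        poly (P (n - (w - 1))) 1" for n
      using A[of n] M by (simp add: fps_X_power_mult_nth power_add)
    show "M ^ n * fps_nth U n = poly (pderiv (P 0)) 1" if "n < w" for n
      using that by (simp add: U_nth P_def)
    show "poly (pderiv (P (Suc n))) 1 = poly (pderiv (P n)) 1 +
        (M - 1) * M ^ (w - 1) * poly (pderiv (P (n - (w - 1)))) 1 + poly (P (n - (w - 1))) 1" for n
      unfolding N_def[symmetric]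
      by (simp add: P_def pderiv_add pderiv_mult pderiv_pCons pderiv_smult algebra_simps)
  qed
  have C: "M ^ n * fps_nth W n = poly (pderiv (pderiv (P (n - (w - 1))))) 1" for n
  proof (rule recurrence_eq_fps_nth[OF w M, where Z = "\<lambda>n. 2 * poly (pderiv (P n)) 1" and
          Y = "\<lambda>n. poly (pderiv (pderiv (P n))) 1" and H = "fps_const (2 / M ^ w) * (fps_X ^ w * U)"])
    have "W * ?D = fps_const (2 / M ^ w) * fps_X ^ w * U * (t * ?D)"
      by (simp only: W_def mult_ac)
    thus "W * ?D = fps_const (2 / M ^ w) * (fps_X ^ w * U)" by (simp add: t mult.assoc)
    show "M ^ (n + w) * fps_nth (fps_const (2 / M ^ w) * (fps_X ^ w * U)) (n + w) =
        2 * poly (pderiv (P (n - (w - 1)))) 1" for n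
      using B[of n] M by (simp add: fps_X_power_mult_nth power_add)
    show "M ^ n * fps_nth W n = poly (pderiv (pderiv (P 0))) 1" if "n < w" for n
      using that by (simp add: W_def P_def fps_X_power_mult_nth mult.assoc)
    show "poly (pderiv (pderiv (P (Suc n)))) 1 = poly (pderiv (pderiv (P n))) 1 +
        (M - 1) * M ^ (w - 1) * poly (pderiv (pderiv (P (n - (w - 1))))) 1 +
        2 * poly (pderiv (P (n - (w - 1)))) 1" for n
      unfolding N_def[symmetric]
      by (simp add: P_def pderiv_add pderiv_mult pderiv_pCons pderiv_smult algebra_simps)
  qed
  \<comment> \<open>Evaluation at n + w - 1 undoes the truncated shift by w - 1.\<close>
  have idx: "n + w - 1 - (w - 1) = n" using w by simp
  show "poly (P n) 1 = M ^ (n + w - 1) * fps_nth t (n + w - 1)"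
    using A[of "n + w - 1"] by (simp only: idx)
  show "poly (pderiv (P n)) 1 = M ^ (n + w - 1) * (fps_nth (t ^ 2) (n - 1) / M ^ w)" if "n \<ge> 1"
  proof -
    have "n + w - 1 - w = n - 1" "\<not> n + w - 1 < w" using that w by auto
    thus ?thesis using B[of "n + w - 1"] unfolding idx U_nth by simp
  qed
  \<comment> \<open>For n <= w truncated subtraction would return the constant coefficient of
    \<open>t ^ 3\<close>, whereas the second derivative is 0.\<close>
  show "poly (pderiv (pderiv (P n))) 1 =
      M ^ (n + w - 1) * (2 * fps_nth (t ^ 3) (n - 1 - w) / M ^ (2 * w))" if n: "n \<ge> w + 1"
  proof -
    have "W = fps_const (2 / M ^ (2 * w)) * (fps_X ^ (2 * w) * t ^ 3)"
    proof -
      have "W = (fps_const (2 / M ^ w) * fps_const (1 / M ^ w)) * ((fps_X ^ w * fps_X ^ w) * (t * t * t))"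
        by (simp only: W_def U_def power2_eq_square mult_ac)
      thus ?thesis by (simp add: power3_eq_cube mult_2 power_add)
    qed
    moreover have "n + w - 1 - 2 * w = n - 1 - w" "\<not> n + w - 1 < 2 * w" using n w by auto
    ultimately have "fps_nth W (n + w - 1) = 2 / M ^ (2 * w) * fps_nth (t ^ 3) (n - 1 - w)"
      by (simp add: fps_X_power_mult_nth)
    thus ?thesis using C[of "n + w - 1"] unfolding idx by simp
  qed
qed

section \<open>Polar parts at u = 1\<close>

text \<open>Iterated partial sums act as divided differences at x = 1: each right-hand side is the
  value of the preceding sum at 1 minus that sum, and the values at 1 are binomial
  coefficients.\<close>

lemma one_minus_mult_geometric_sums:
  fixes x :: "'a::comm_ring_1"
  assumes g: "\<And>k. g k = (\<Sum>i<k. x ^ i)" and g1: "\<And>k. g1 k = (\<Sum>i<k. g i)"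
    and g2: "\<And>k. g2 k = (\<Sum>i<k. g1 i)" and g3: "\<And>k. g3 k = (\<Sum>i<k. g2 i)"
  shows "(1 - x) * g1 k = of_nat k - g k"
    and "(1 - x) * g2 k = of_nat (k choose 2) - g1 k"
    and "(1 - x) * g3 k = of_nat (k choose 3) - g2 k"
proof -
  have 0: "(1 - x) * g k = 1 - x ^ k" for k unfolding g by (rule one_diff_power_eq[symmetric])
  have suc: "g (Suc k) = g k + x ^ k" "g1 (Suc k) = g1 k + g k" "g2 (Suc k) = g2 k + g1 k"
    "g3 (Suc k) = g3 k + g2 k" and z: "g 0 = 0" "g1 0 = 0" "g2 0 = 0" "g3 0 = 0" for k
    by (simp_all add: g g1 g2 g3)
  show 1: "(1 - x) * g1 k = of_nat k - g k" for k
    by (induction k) (simp_all add: suc z distrib_left 0)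
  show 2: "(1 - x) * g2 k = of_nat (k choose 2) - g1 k" for k
    by (induction k) (simp_all add: suc z distrib_left 1 numeral_2_eq_2)
  show "(1 - x) * g3 k = of_nat (k choose 3) - g2 k" for k
  proof (induction k)
    case (Suc k)
    have "Suc k choose 3 = (k choose 2) + (k choose 3)" by (simp add: numeral_3_eq_3 numeral_2_eq_2)
    with Suc show ?case by (simp add: suc z distrib_left 2)
  qed (simp add: z binomial_eq_0)
qed

text \<open>Here \<open>L = 1 / (1 - u)\<close>, and all other quantities are regular at \<open>u = 1\<close>.\<close>

lemma polar_parts:
  fixes L Q A s s2 s3 S1 S2 :: "'a::idom"
  assumes e1: "L * Q = A * L + A * s * Q"
    and e2: "L * s = S1 * L - s2" and e3: "L * s2 = S2 * L - s3"
  defines "h2 \<equiv> - 2 * A^3 * s2 + 2 * A^3 * s^2 * Q + A^2 * s^2 * Q^2"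
  defines "r1 \<equiv> A^2 * S1 * s * Q - A * s2 * Q"
  defines "r2 \<equiv> A * S1 * r1 + A^2 * s3 - A^2 * s * s2 * Q"
  defines "x1 \<equiv> - A * S1 * s2 - A * s * s2 + A * s^3 * Q"
  defines "x2 \<equiv> A^2 * S1^2 * s * Q - A * S1 * s2 * Q - A * s * s2 * Q + A * s^3 * Q^2"
  defines "y \<equiv> 2 * A^3 * s3 + 2 * A^3 * x1 + A^2 * x2"
  defines "h3 \<equiv> A^2 * r2 + 2 * A^3 * S1 * r1 + A * y + A * s * Q * h2"
  shows "(L * Q)^2 = A^2 * L^2 + 2 * A^3 * S1 * L + h2"
    and "(L * Q)^3 = A^3 * L^3 + 3 * A^4 * S1 * L^2 + (6 * A^5 * S1^2 - 3 * A^4 * S2) * L + h3"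
proof -
  show t2: "(L * Q)^2 = A^2 * L^2 + 2 * A^3 * S1 * L + h2"
    unfolding h2_def using e1 e2 by algebra
  \<comment> \<open>The cube is the expansion of the square times \<open>L * Q\<close>:
    \<open>K1\<close> and \<open>K2\<close> treat its polar terms, \<open>Lh\<close> its remainder
    \<open>h2\<close>.\<close>
  have K1: "L * (L * Q) = A * L^2 + A^2 * S1 * L + r1"
    unfolding r1_def using e1 e2 by algebra
  have "s2 * (L * Q) = A * (S2 * L - s3) + A * s * s2 * Q" using e1 e3 by algebra
  hence K2: "L^2 * (L * Q) = A * L^3 + A^2 * S1 * L^2 + (A^3 * S1^2 - A^2 * S2) * L + r2"
    unfolding r2_def using e1 e2 K1 by algebra
  have sL: "s^2 * L = S1 * (S1 * L - s2) - s * s2" using e2 by algebra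
  have X1: "s^2 * (L * Q) = A * S1^2 * L + x1" unfolding x1_def using sL e1 by algebra
  have X2: "L * s^2 * Q^2 = A^2 * S1^2 * L + x2" unfolding x2_def using sL e1 by algebra
  \<comment> \<open>\<open>L * h2\<close> has a simple pole at u = 1 whose coefficient is the value
    of \<open>h2\<close> there.\<close>
  have Lh: "L * h2 = (- 2 * A^3 * S2 + 3 * A^4 * S1^2) * L + y"
    unfolding h2_def y_def using X1 X2 e3 by algebra
  have "h2 * (L * Q) = A * (L * h2) + A * s * Q * h2" using e1 by algebra
  thus "(L * Q)^3 = A^3 * L^3 + 3 * A^4 * S1 * L^2 + (6 * A^5 * S1^2 - 3 * A^4 * S2) * L + h3"
    unfolding h3_def using t2 K1 K2 Lh by algebra
qed

lemma fps_conv_radius_power_ge: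
  fixes F :: "'a::{banach, real_normed_div_algebra, comm_ring_1} fps"
  shows "fps_conv_radius F \<ge> r \<Longrightarrow> fps_conv_radius (F ^ n) \<ge> r"
  by (induction n) (auto intro: fps_conv_radius_mult_ge)

lemma fps_conv_radius_sum_ge:
  fixes F :: "'b \<Rightarrow> 'a::{banach, real_normed_div_algebra} fps"
  shows "(\<And>i. i \<in> I \<Longrightarrow> fps_conv_radius (F i) \<ge> r) \<Longrightarrow> fps_conv_radius (sum F I) \<ge> r"
  by (induction I rule: infinite_finite_induct) (auto intro: fps_conv_radius_add_ge)

text \<open>\<open>a\<close>, \<open>S1\<close> and \<open>S2\<close> are 1 / q(1), q'(1) and q''(1)
  / 2. The explicit terms are thus the coefficients of the polar parts of t, t^2 and t^3 at u =
  1.\<close>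

lemma t_fps_expansion:
  fixes M :: real
  assumes M: "M = 1 \<or> M \<ge> 2" and w: "w \<ge> 2"
  defines "a \<equiv> M / ((M - 1) * real w + 1)"
  defines "S1 \<equiv> (M - 1) / M * (real w * (real w - 1) / 2)"
  defines "S2 \<equiv> (M - 1) / M * (real w * (real w - 1) * (real w - 2) / 6)"
  defines "R \<equiv> ereal (1 + 9 / (8 * M * real w ^ 3))"
  obtains h1 h2 h3 where
    "fps_conv_radius h1 \<ge> R" "fps_conv_radius h2 \<ge> R" "fps_conv_radius h3 \<ge> R"
    "\<And>n. fps_nth (t_fps w M) n = a + fps_nth h1 n"
    "\<And>n. fps_nth (t_fps w M ^ 2) n = a^2 * (real n + 1) + 2 * a^3 * S1 + fps_nth h2 n"
    "\<And>n. fps_nth (t_fps w M ^ 3) n = a^3 * ((real n + 1) * (real n + 2) / 2) +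
        3 * a^4 * S1 * (real n + 1) + (6 * a^5 * S1^2 - 3 * a^4 * S2) + fps_nth h3 n"
proof -
  define c where "c = (M - 1) / M"
  define g where "g k = (\<Sum>i<k. fps_X ^ i :: real fps)" for k
  define g1 where "g1 k = (\<Sum>i<k. g i)" for k
  define g2 where "g2 k = (\<Sum>i<k. g1 i)" for k
  define g3 where "g3 k = (\<Sum>i<k. g2 i)" for k
  note geo = one_minus_mult_geometric_sums[OF g_def g1_def g2_def g3_def]
  \<comment> \<open>Divided differences of q at 1: (1 - u) s = q(1) - q(u), (1 - u) s2 = s(1) - s
    and (1 - u) s3 = s2(1) - s2, with s(1) = S1 and s2(1) = S2. All three are polynomials.\<close>
  define s where "s = fps_const c * g1 w"
  define s2 where "s2 = fps_const c * g2 w"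
  define s3 where "s3 = fps_const c * g3 w"
  define q where "q = fps_of_poly (q_poly w M)"
  define Q where "Q = Q_fps w M"
  define L where "L = L_fps"
  define A where "A = fps_const a"
  have M0: "M > 0" using M by auto
  have K0: "(M - 1) * real w + 1 > 0" using M by (auto intro: add_nonneg_pos)
  have q: "q = fps_const (1 / M) + fps_const c * g w"
    by (simp add: q_def q_poly_def c_def g_def fps_of_poly_add fps_of_poly_const fps_of_poly_smult
         fps_of_poly_sum fps_of_poly_monom')
  have LX: "(1 - fps_X) * L = 1" unfolding L_def by (rule L_fps_inverse)
  have qQ: "q * Q = 1" unfolding q_def Q_def using w M0 by (intro Q_fps_mult) auto
  have inv_a: "1 / M + c * real w = inverse a"
    using M0 K0 by (simp add: a_def c_def field_simps)
  have "(1 - fps_X) * s = fps_const c * ((1 - fps_X) * g1 w)" by (simp add: s_def mult_ac)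
  also have "\<dots> = fps_const (1 / M) + fps_const c * of_nat w - q"
    unfolding geo q by (simp add: algebra_simps)
  also have "fps_const (1 / M) + fps_const c * of_nat w = fps_const (inverse a)"
    unfolding inv_a[symmetric] by (simp add: fps_of_nat flip: fps_const_mult fps_const_add)
  finally have "L * ((1 - fps_X) * s) * Q = L * (fps_const (inverse a) - q) * Q" by simp
  hence sQ: "s * Q = fps_const (inverse a) * (L * Q) - L"
    using LX qQ by algebra
  have Aa: "A * fps_const (inverse a) = 1"
    using M0 K0 by (simp add: A_def a_def)
  have e1: "L * Q = A * L + A * s * Q" using sQ Aa by algebra
  have ch2: "c * real (w choose 2) = S1"
    by (simp add: c_def S1_def binomial_gbinomial gbinomial_prod_rev numeral_2_eq_2 algebra_simps)
  have ch3: "c * real (w choose 3) = S2"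
    by (simp add: c_def S2_def binomial_gbinomial gbinomial_prod_rev numeral_3_eq_3 fact_numeral algebra_simps)
  have "(1 - fps_X) * s2 = fps_const c * ((1 - fps_X) * g2 w)" by (simp add: s2_def mult_ac)
  also have "\<dots> = fps_const c * of_nat (w choose 2) - s"
    unfolding geo s_def by (simp add: algebra_simps)
  also have "fps_const c * of_nat (w choose 2) = fps_const S1"
    unfolding ch2[symmetric] by (simp add: fps_of_nat[symmetric])
  finally have e2: "L * s = fps_const S1 * L - s2" using LX by algebra
  have "(1 - fps_X) * s3 = fps_const c * ((1 - fps_X) * g3 w)" by (simp add: s3_def mult_ac)
  also have "\<dots> = fps_const c * of_nat (w choose 3) - s2"
    unfolding geo s2_def by (simp add: algebra_simps)
  also have "fps_const c * of_nat (w choose 3) = fps_const S2"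
    unfolding ch3[symmetric] by (simp add: fps_of_nat[symmetric])
  finally have e3: "L * s2 = fps_const S2 * L - s3" using LX by algebra
  have rad: "fps_conv_radius (g k) \<ge> R" "fps_conv_radius (g1 k) \<ge> R"
    "fps_conv_radius (g2 k) \<ge> R" "fps_conv_radius (g3 k) \<ge> R" for k
    unfolding g3_def g2_def g1_def g_def by (intro fps_conv_radius_sum_ge; simp)+
  have radQ: "fps_conv_radius Q \<ge> R" unfolding Q_def R_def by (rule fps_conv_radius_Q_fps[OF M w])
  have rads: "fps_conv_radius s \<ge> R" "fps_conv_radius s2 \<ge> R" "fps_conv_radius s3 \<ge> R"
    unfolding s_def s2_def s3_def by (intro fps_conv_radius_mult_ge rad; simp)+
  have radc: "fps_conv_radius A \<ge> R" "fps_conv_radius (fps_const S1) \<ge> R"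
    "fps_conv_radius (- 2 :: real fps) \<ge> R" "fps_conv_radius (2 :: real fps) \<ge> R"
    by (simp_all add: A_def)
  have radm: "fps_conv_radius (- F) \<ge> R" if "fps_conv_radius F \<ge> R" for F :: "real fps"
    using that by simp
  note P = polar_parts[OF e1 e2 e3]
  note rr = fps_conv_radius_add_ge fps_conv_radius_diff_ge fps_conv_radius_mult_ge
    fps_conv_radius_power_ge radm radQ rads radc
  have t: "t_fps w M = L * Q" by (simp add: t_fps_def L_def Q_def)
  have A_pow: "A ^ k = fps_const (a ^ k)" for k by (simp add: A_def fps_const_power)
  \<comment> \<open>The witnesses are A s Q and the remainders \<open>h2\<close>, \<open>h3\<close>
    of \<open>polar_parts\<close> written out. Being built from polynomials and \<open>Q\<close>,
    they have radius at least R.\<close>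
  show ?thesis
  proof (rule that)
    show "fps_conv_radius (A * s * Q) \<ge> R" by (intro rr)
    show "fps_nth (t_fps w M) n = a + fps_nth (A * s * Q) n" for n
      unfolding t e1 by (simp add: A_def L_def L_fps_nth mult.assoc)
    show "fps_nth (t_fps w M ^ 2) n = a^2 * (real n + 1) + 2 * a^3 * S1 + fps_nth
       (- 2 * A ^ 3 * s2 + 2 * A ^ 3 * s\<^sup>2 * Q + A\<^sup>2 * s\<^sup>2 * Q\<^sup>2) n" for n
      unfolding t P(1) fps_add_nth A_pow
      by (simp add: L_def L_fps_nth mult.assoc numeral_fps_const)
    show "fps_nth (t_fps w M ^ 3) n = a^3 * ((real n + 1) * (real n + 2) / 2) +
        3 * a^4 * S1 * (real n + 1) + (6 * a^5 * S1^2 - 3 * a^4 * S2) + fps_nth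
       (A\<^sup>2 * (A * fps_const S1 * (A\<^sup>2 * fps_const S1 * s * Q - A * s2 * Q) + A\<^sup>2 * s3 - A\<^sup>2 * s * s2 * Q) +
    2 * A ^ 3 * fps_const S1 * (A\<^sup>2 * fps_const S1 * s * Q - A * s2 * Q) +
    A * (2 * A ^ 3 * s3 + 2 * A ^ 3 * (- A * fps_const S1 * s2 - A * s * s2 + A * s ^ 3 * Q) +
     A\<^sup>2 * (A\<^sup>2 * (fps_const S1)\<^sup>2 * s * Q - A * fps_const S1 * s2 * Q - A * s * s2 * Q + A * s ^ 3 * Q\<^sup>2)) +
    A * s * Q * (- 2 * A ^ 3 * s2 + 2 * A ^ 3 * s\<^sup>2 * Q + A\<^sup>2 * s\<^sup>2 * Q\<^sup>2)) n" for n
      unfolding t P(2) fps_add_nth A_pow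
      by (simp add: L_def L_fps_nth mult.assoc numeral_fps_const fps_const_power)
  qed (intro rr)+
qed

section \<open>Asymptotics of count, mean and variance\<close>

text \<open>f / g - p equals ((f - p a) - p (g - a)) / g wherever g is nonzero, and 1 / g is bounded
  because g tends to a.\<close>

lemma ratio_bigo:
  fixes f g p :: "nat \<Rightarrow> real"
  assumes f: "(\<lambda>n. f n - p n * a) \<in> O(\<lambda>n. real n ^ k * r ^ n)"
    and g: "(\<lambda>n. g n - a) \<in> O(\<lambda>n. r ^ n)" and p: "p \<in> O(\<lambda>n. real n ^ k)"
    and r: "0 < r" "r < 1" and a: "a \<noteq> 0"
  shows "(\<lambda>n. f n / g n - p n) \<in> O(\<lambda>n. real n ^ k * r ^ n)"
proof -
  have "(\<lambda>n. r ^ n) \<longlonglongrightarrow> 0" using r by (intro LIMSEQ_power_zero) auto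
  hence "(\<lambda>n. r ^ n) \<in> o(\<lambda>_. 1)" by (intro smalloI_tendsto) auto
  from smalloD_tendsto[OF landau_o.big_small_trans[OF g this]]
  have "(\<lambda>n. g n - a) \<longlonglongrightarrow> 0" by simp
  hence lim: "g \<longlonglongrightarrow> a" by (simp add: LIM_zero_iff)
  have ev: "\<forall>\<^sub>F n in sequentially. g n \<noteq> 0" using tendsto_imp_eventually_ne[OF lim a] .
  have "(\<lambda>n. inverse (g n)) \<longlonglongrightarrow> inverse a" using lim a by (rule tendsto_inverse)
  hence inv: "(\<lambda>n. inverse (g n)) \<in> O(\<lambda>_. 1)"
    by (intro bigoI_tendsto[of _ _ "inverse a"]) auto
  have "(\<lambda>n. p n * (g n - a)) \<in> O(\<lambda>n. real n ^ k * r ^ n)"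
    by (rule landau_o.big.mult[OF p g])
  with f have "(\<lambda>n. (f n - p n * a) - p n * (g n - a)) \<in> O(\<lambda>n. real n ^ k * r ^ n)"
    by (rule sum_in_bigo)
  from landau_o.big.mult[OF this inv]
  have "(\<lambda>n. ((f n - p n * a) - p n * (g n - a)) * inverse (g n)) \<in> O(\<lambda>n. real n ^ k * r ^ n)" by simp
  thus ?thesis
  proof (rule landau_o.big.in_cong[THEN iffD1, rotated])
    show "\<forall>\<^sub>F n in sequentially. (f n - p n * a - p n * (g n - a)) * inverse (g n) = f n / g n - p n"
      using ev by eventually_elim (simp add: field_simps)
  qed
qed

text \<open>\<open>p2\<close> and \<open>p3\<close> are the main terms of the mean and of the second
  factorial moment; the n^2 terms of \<open>p3\<close> and \<open>p2^2\<close> cancel. With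
  \<open>m\<close> in place of M^(w - 1) no symbolic exponent is left, and the claim becomes an
  identity of rational functions.\<close>

lemma variance_identity:
  fixes M w n m :: real
  assumes "M \<noteq> 0" "m \<noteq> 0" "K \<noteq> 0" and K: "K = (M - 1) * w + 1"
  defines "a \<equiv> M / K"
  defines "S1 \<equiv> (M - 1) / M * (w * (w - 1) / 2)"
  defines "S2 \<equiv> (M - 1) / M * (w * (w - 1) * (w - 2) / 6)"
  defines "p2 \<equiv> (a * n + 2 * a^2 * S1) / (M * m)"
  defines "p3 \<equiv> 2 * (a^2 * ((n - w) * (n - w + 1) / 2) + 3 * a^3 * S1 * (n - w)
                 + (6 * a^4 * S1^2 - 3 * a^3 * S2)) / (M^2 * m^2)"
  shows "p3 + p2 - p2^2 = (m * K\<^sup>2 - ((M - 1) * w\<^sup>2 + 2 * w - 1)) / (m^2 * K ^ 3) * n +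
       (w - 1) * w * (- (w - 1)\<^sup>2 - M\<^sup>2 * w\<^sup>2 + (M - 1) * m * K\<^sup>2 + 2 * M * (w\<^sup>2 - w + 1)) / (m^2 * K ^ 4)"
proof -
  define X where "X = m * K\<^sup>2 - ((M - 1) * w\<^sup>2 + 2 * w - 1)"
  define Y where "Y = (w - 1) * w * (- (w - 1)\<^sup>2 - M\<^sup>2 * w\<^sup>2 + (M - 1) * m * K\<^sup>2 + 2 * M * (w\<^sup>2 - w + 1))"
  have p2: "p2 = n / (m * K) + (M - 1) * w * (w - 1) / (m * K^2)"
    using assms(1-3) unfolding p2_def a_def S1_def
    by (simp add: field_simps power2_eq_square)
  have p3: "p3 = ((n - w) * (n - w + 1) * K^2 + 3 * (M - 1) * w * (w - 1) * (n - w) * K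
      + 3 * (M - 1)^2 * w^2 * (w - 1)^2 - (M - 1) * w * (w - 1) * (w - 2) * K) / (m^2 * K^4)"
    using assms(1-3) unfolding p3_def a_def S1_def S2_def
    by (simp add: field_simps power2_eq_square power3_eq_cube power4_eq_xxxx)
  have "(p3 + p2 - p2^2) * (m^2 * K^4) = (n - w) * (n - w + 1) * K^2 + 3 * (M - 1) * w * (w - 1) * (n - w) * K
      + 3 * (M - 1)^2 * w^2 * (w - 1)^2 - (M - 1) * w * (w - 1) * (w - 2) * K
      + n * m * K^3 + (M - 1) * w * (w - 1) * m * K^2 - (n * K + (M - 1) * w * (w - 1))^2"
    using assms(1-3) unfolding p2 p3
    by (simp add: field_simps power2_eq_square power3_eq_cube power4_eq_xxxx)
  also have "\<dots> = (m * K\<^sup>2 - ((M - 1) * w\<^sup>2 + 2 * w - 1)) * K * n +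
     (w - 1) * w * (- (w - 1)\<^sup>2 - M\<^sup>2 * w\<^sup>2 + (M - 1) * m * K\<^sup>2 + 2 * M * (w\<^sup>2 - w + 1))"
    unfolding K by algebra
  finally have *: "(p3 + p2 - p2^2) * (m^2 * K^4) = X * K * n + Y" unfolding X_def Y_def .
  have "p3 + p2 - p2^2 = (X * K * n + Y) / (m^2 * K^4)"
    using * assms(2,3) by (simp add: eq_divide_eq)
  also have "\<dots> = X / (m^2 * K^3) * n + Y / (m^2 * K^4)"
    using assms(2,3) by (simp add: add_divide_distrib power4_eq_xxxx power3_eq_cube)
  finally show ?thesis unfolding X_def Y_def .
qed

lemma rho_bounds:
  assumes "M > 0" "w > 0"
  shows "0 < rho M w" "rho M w < 1"
proof -
  have "1 / (M * real w ^ 3) > 0" using assms by simp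
  thus "0 < rho M w" "rho M w < 1"
    unfolding rho_def by (auto intro!: inverse_less_1_iff[THEN iffD2] add_pos_pos)
qed

text \<open>The factor M^(n + w - 1) cancels in \<open>E\<close> and \<open>G\<close> for large n,
  leaving coefficients of t^2 and t^3 over coefficients of t, which tend to \<open>a\<close>.
  \<open>G + E - E^2\<close> is the variance in factorial moments.\<close>

lemma naf_moment_asymptotics:
  fixes M :: real
  assumes M: "M = 1 \<or> M \<ge> 2" and w: "w \<ge> 2"
  defines "P \<equiv> naf_gf w [:(M - 1) * M ^ (w - 1) - 1, 1:]"
  defines "E \<equiv> \<lambda>n. poly (pderiv (P n)) 1 / poly (P n) 1"
  defines "G \<equiv> \<lambda>n. poly (pderiv (pderiv (P n))) 1 / poly (P n) 1"
  shows "(\<lambda>n. poly (P n) 1 - 1 / ((M - 1) * real w + 1) * M ^ (n + w)) \<in> O(\<lambda>n. (rho M w * M) ^ n)" (is ?count)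
    and "(\<lambda>n. E n - (e_coeff M w * real n + (M - 1) * (real w - 1) * real w
                  / (M ^ (w - 1) * ((M - 1) * real w + 1)\<^sup>2))) \<in> O(\<lambda>n. real n * rho M w ^ n)" (is ?mean)
    and "(\<lambda>n. G n + E n - (E n)\<^sup>2 - (v_coeff M w * real n
                + (real w - 1) * real w
                  * (- (real w - 1)\<^sup>2 - M\<^sup>2 * (real w)\<^sup>2
                     + (M - 1) * M ^ (w - 1) * ((M - 1) * real w + 1)\<^sup>2
                     + 2 * M * ((real w)\<^sup>2 - real w + 1))
                  / (M ^ (2 * w - 2) * ((M - 1) * real w + 1) ^ 4)))
          \<in> O(\<lambda>n. (real n)\<^sup>2 * rho M w ^ n)" (is ?variance)
proof -
  define K where "K = (M - 1) * real w + 1"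
  define a where "a = M / K"
  define S1 where "S1 = (M - 1) / M * (real w * (real w - 1) / 2)"
  define S2 where "S2 = (M - 1) / M * (real w * (real w - 1) * (real w - 2) / 6)"
  define m where "m = M ^ (w - 1)"
  define t where "t = t_fps w M"
  define r where "r = rho M w"
  define R where "R = ereal (1 + 9 / (8 * M * real w ^ 3))"
  have M0: "M > 0" using M by auto
  have K0: "K > 0" unfolding K_def using M by (auto intro: add_nonneg_pos)
  have a0: "a \<noteq> 0" "a > 0" using M0 K0 by (auto simp: a_def)
  have m0: "m > 0" using M0 by (simp add: m_def)
  have Mw: "M ^ w = M * m" using w by (simp add: m_def power_eq_if)
  have Mw2: "M ^ (2 * w) = M\<^sup>2 * m\<^sup>2" using Mw by (simp add: mult_2 power_add power2_eq_square)
  have Mw3: "M ^ (2 * w - 2) = m\<^sup>2" proof -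
    have "2 * w - 2 = (w - 1) * 2" by simp
    thus ?thesis by (simp only: m_def power_mult)
  qed
  have r: "0 < r" "r < 1" unfolding r_def using rho_bounds[OF M0, of w] w by auto
  \<comment> \<open>Here 1 < 9/8 is used: rho itself becomes an admissible rate.\<close>
  have rR: "ereal (inverse r) < R"
    using M0 w by (simp add: r_def rho_def R_def field_simps)
  have bigo: "fps_nth h \<in> O(\<lambda>n. r ^ n)" if "fps_conv_radius h \<ge> R" for h
    using fps_nth_bigo_if_conv_radius[OF less_le_trans[OF rR that]] r by simp
  obtain h1 h2 h3 where rad: "fps_conv_radius h1 \<ge> R" "fps_conv_radius h2 \<ge> R" "fps_conv_radius h3 \<ge> R"
    and t1: "\<And>n. fps_nth t n = a + fps_nth h1 n"
    and t2: "\<And>n. fps_nth (t ^ 2) n = a^2 * (real n + 1) + 2 * a^3 * S1 + fps_nth h2 n"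
    and t3: "\<And>n. fps_nth (t ^ 3) n = a^3 * ((real n + 1) * (real n + 2) / 2) +
        3 * a^4 * S1 * (real n + 1) + (6 * a^5 * S1^2 - 3 * a^4 * S2) + fps_nth h3 n"
    using t_fps_expansion[OF M w] unfolding R_def t_def a_def S1_def S2_def K_def by blast
  have w1: "w \<ge> 1" using w by simp
  note mom = naf_gf_moments[OF w1 M0[THEN less_imp_neq, symmetric], folded P_def t_def]
  define g where "g n = fps_nth t (n + w - 1)" for n
  have g: "(\<lambda>n. g n - a) \<in> O(\<lambda>n. r ^ n)"
  proof -
    have "fps_nth (fps_shift (w - 1) h1) \<in> O(\<lambda>n. r ^ n)" by (rule bigo) (simp add: rad)
    also have "fps_nth (fps_shift (w - 1) h1) = (\<lambda>n. g n - a)"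
      using w by (auto simp: g_def t1 fun_eq_iff)
    finally show ?thesis .
  qed
  \<comment> \<open>Index shifts are expressed by a factor \<open>fps_X ^ k\<close>, which keeps the
    radius at least R.\<close>
  have shift: "fps_nth (fps_X ^ k * h) \<in> O(\<lambda>n. r ^ n)" if "fps_conv_radius h \<ge> R" for k h
    by (rule bigo) (auto intro!: fps_conv_radius_mult_ge that)
  have absorb: "(\<lambda>n. c * f n) \<in> O(\<lambda>n. real n ^ k * r ^ n)" if "f \<in> O(\<lambda>n. r ^ n)" for f c k
  proof -
    have one: "(\<lambda>n. c) \<in> O(\<lambda>n. real n ^ k)"
      by (cases "k = 0") (auto intro!: bigoI[of _ "\<bar>c\<bar>"] eventually_mono[OF eventually_ge_at_top[of 1]] simp: mult_le_cancel_left1)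
    show ?thesis using landau_o.big.mult[OF one that] by simp
  qed

  show ?count
  proof -
    have "poly (P n) 1 - 1 / ((M - 1) * real w + 1) * M ^ (n + w) = m * (M ^ n * (g n - a))" for n
    proof -
      have "M ^ (n + w - 1) = M ^ n * m" using w by (simp add: m_def power_add[symmetric])
      thus ?thesis using K0 unfolding mom(1) g_def K_def[symmetric]
        by (simp add: a_def power_add Mw field_simps)
    qed
    moreover have "(\<lambda>n. m * (M ^ n * (g n - a))) \<in> O(\<lambda>n. 1 * (M ^ n * r ^ n))"
      by (intro landau_o.big.mult g) auto
    ultimately show ?thesis by (simp add: r_def power_mult_distrib mult_ac)
  qed

  define p2 where "p2 n = (a * real n + 2 * a^2 * S1) / (M * m)" for n
  \<comment> \<open>The coefficient index n - 1 - w of \<open>t ^ 3\<close> makes this a polynomial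
    in n - w. The difference is taken in the reals so that \<open>p3\<close> is a polynomial for all
    n.\<close>
  define p3 where "p3 n = 2 * (a^2 * ((real n - real w) * (real n - real w + 1) / 2)
      + 3 * a^3 * S1 * (real n - real w) + (6 * a^4 * S1^2 - 3 * a^3 * S2)) / (M^2 * m^2)" for n
  define f2 where "f2 n = fps_nth (t ^ 2) (n - 1) / M ^ w" for n
  define f3 where "f3 n = 2 * fps_nth (t ^ 3) (n - 1 - w) / M ^ (2 * w)" for n
  have p2: "p2 \<in> O(\<lambda>n. real n ^ 1)" unfolding p2_def using M0 m0 by real_asymp
  have p3: "p3 \<in> O(\<lambda>n. real n ^ 2)" unfolding p3_def using M0 m0 by real_asymp
  have "(\<lambda>n. 1 / M ^ w * fps_nth (fps_X ^ 1 * h2) n) \<in> O(\<lambda>n. real n ^ 1 * r ^ n)"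
    by (intro absorb shift rad)
  also have "?this \<longleftrightarrow> (\<lambda>n. f2 n - p2 n * a) \<in> O(\<lambda>n. real n ^ 1 * r ^ n)"
  proof (rule landau_o.big.in_cong, rule eventually_mono[OF eventually_ge_at_top[of 1]])
    fix n :: nat assume n: "n \<ge> 1"
    hence "real (n - 1) + 1 = real n" by simp
    hence "f2 n = (a^2 * real n + 2 * a^3 * S1 + fps_nth h2 (n - 1)) / (M * m)"
      by (simp only: f2_def t2 Mw)
    thus "1 / M ^ w * fps_nth (fps_X ^ 1 * h2) n = f2 n - p2 n * a"
      using n M0 m0 by (simp add: p2_def Mw field_simps power2_eq_square power3_eq_cube)
  qed
  finally have f2: "(\<lambda>n. f2 n / g n - p2 n) \<in> O(\<lambda>n. real n ^ 1 * r ^ n)"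
    by (rule ratio_bigo[OF _ g p2 r a0(1)])
  have "(\<lambda>n. 2 / M ^ (2 * w) * fps_nth (fps_X ^ (w + 1) * h3) n) \<in> O(\<lambda>n. real n ^ 2 * r ^ n)"
    by (intro absorb shift rad)
  also have "?this \<longleftrightarrow> (\<lambda>n. f3 n - p3 n * a) \<in> O(\<lambda>n. real n ^ 2 * r ^ n)"
  proof (rule landau_o.big.in_cong, rule eventually_mono[OF eventually_ge_at_top[of "w + 1"]])
    fix n :: nat assume n: "n \<ge> w + 1"
    have k: "real (n - 1 - w) + 1 = real n - real w" "real (n - 1 - w) + 2 = real n - real w + 1"
      using n by (auto simp: of_nat_diff)
    have "n - (w + 1) = n - 1 - w" by simp
    hence "fps_nth (fps_X ^ (w + 1) * h3) n = fps_nth h3 (n - 1 - w)"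
      using n unfolding fps_X_power_mult_nth by simp
    moreover have "p3 n * a = 2 * (a^3 * ((real n - real w) * (real n - real w + 1) / 2)
      + 3 * a^4 * S1 * (real n - real w) + (6 * a^5 * S1^2 - 3 * a^4 * S2)) / (M^2 * m^2)"
      unfolding p3_def times_divide_eq_left[symmetric] by (simp add: algebra_simps eval_nat_numeral)
    ultimately show "2 / M ^ (2 * w) * fps_nth (fps_X ^ (w + 1) * h3) n = f3 n - p3 n * a"
      by (simp only: f3_def t3 k Mw2) (simp add: diff_divide_distrib[symmetric] algebra_simps)
  qed
  finally have f3: "(\<lambda>n. f3 n / g n - p3 n) \<in> O(\<lambda>n. real n ^ 2 * r ^ n)"
    by (rule ratio_bigo[OF _ g p3 r a0(1)])
  have EG: "\<forall>\<^sub>F n in sequentially. E n = f2 n / g n \<and> G n = f3 n / g n"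
  proof (rule eventually_mono[OF eventually_ge_at_top[of "w + 1"]])
    fix n :: nat assume n: "n \<ge> w + 1"
    thus "E n = f2 n / g n \<and> G n = f3 n / g n"
      using mom(2)[of n] mom(3)[of n] M0 unfolding E_def G_def mom(1) f2_def f3_def g_def by simp
  qed
  have E: "(\<lambda>n. E n - p2 n) \<in> O(\<lambda>n. real n ^ 1 * r ^ n)"
    using f2 by (rule landau_o.big.in_cong[THEN iffD1, rotated]) (use EG in eventually_elim, simp)
  have G: "(\<lambda>n. G n - p3 n) \<in> O(\<lambda>n. real n ^ 2 * r ^ n)"
    using f3 by (rule landau_o.big.in_cong[THEN iffD1, rotated]) (use EG in eventually_elim, simp)
  have p2_eq: "p2 n = e_coeff M w * real n + (M - 1) * (real w - 1) * real w
                  / (M ^ (w - 1) * ((M - 1) * real w + 1)\<^sup>2)" for n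
    unfolding e_coeff_def K_def[symmetric] m_def[symmetric] p2_def a_def S1_def
    using M0 m0 K0 by (simp add: field_simps power2_eq_square)
  show ?mean
    using E unfolding p2_eq r_def by simp
  have p3_eq: "v_coeff M w * real n + (real w - 1) * real w
                  * (- (real w - 1)\<^sup>2 - M\<^sup>2 * (real w)\<^sup>2
                     + (M - 1) * M ^ (w - 1) * ((M - 1) * real w + 1)\<^sup>2
                     + 2 * M * ((real w)\<^sup>2 - real w + 1))
                  / (M ^ (2 * w - 2) * ((M - 1) * real w + 1) ^ 4) = p3 n + p2 n - (p2 n)\<^sup>2" for n
    using variance_identity[of M m K "real w" "real n"] M0 m0 K0
    unfolding v_coeff_def K_def[symmetric] m_def[symmetric] Mw3 p2_def p3_def a_def S1_def S2_def
    by (simp add: K_def)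
  have rn: "(\<lambda>n. r ^ n) \<in> O(\<lambda>_. 1)"
    using r by (intro bigoI[of _ 1] always_eventually) (auto simp: power_le_one)
  \<comment> \<open>As E + p2 is O(n), replacing E^2 by p2^2 costs one more factor n than replacing
    E by p2.\<close>
  have "(\<lambda>n. E n - p2 n) \<in> O(\<lambda>n. real n)"
    by (rule landau_o.big_trans[OF E]) (use landau_o.big.mult[OF landau_o.big_refl rn] in simp)
  hence "(\<lambda>n. (E n - p2 n) + p2 n + p2 n) \<in> O(\<lambda>n. real n)"
    using p2 by (intro sum_in_bigo(1)) auto
  hence "(\<lambda>n. (E n - p2 n) * (E n + p2 n)) \<in> O(\<lambda>n. real n ^ 1 * r ^ n * real n)"
    by (intro landau_o.big.mult E) simp
  hence X: "(\<lambda>n. (E n - p2 n) * (E n + p2 n)) \<in> O(\<lambda>n. real n ^ 2 * r ^ n)"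
    by (simp add: power2_eq_square mult_ac)
  have Y: "(\<lambda>n. E n - p2 n) \<in> O(\<lambda>n. real n ^ 2 * r ^ n)"
  proof (rule landau_o.big_trans[OF E])
    show "(\<lambda>n. real n ^ 1 * r ^ n) \<in> O(\<lambda>n. real n ^ 2 * r ^ n)"
      by (intro landau_o.big.mult_right) real_asymp
  qed
  have "(\<lambda>n. ((G n - p3 n) + (E n - p2 n)) - (E n - p2 n) * (E n + p2 n)) \<in> O(\<lambda>n. real n ^ 2 * r ^ n)"
    by (rule sum_in_bigo(2)[OF sum_in_bigo(1)[OF G Y] X])
  thus ?variance
    unfolding p3_eq r_def by (simp add: power2_eq_square algebra_simps)
qed

section \<open>The generating function of digit occurrences\<close>

text \<open>The pairwise form lets one digit be added or removed without recounting the
  blocks.\<close>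

lemma is_wNAF_iff:
  assumes "w \<ge> 1"
  shows "is_wNAF D w \<eta> \<longleftrightarrow>
    (\<forall>j. \<eta> j \<in> D) \<and> (\<forall>i j. \<eta> i \<noteq> 0 \<longrightarrow> \<eta> j \<noteq> 0 \<longrightarrow> i < j \<longrightarrow> i + int w \<le> j)"
proof -
  have "(\<forall>i. card {j \<in> {i..<i + int w}. \<eta> j \<noteq> 0} \<le> 1) \<longleftrightarrow>
        (\<forall>i j. \<eta> i \<noteq> 0 \<longrightarrow> \<eta> j \<noteq> 0 \<longrightarrow> i < j \<longrightarrow> i + int w \<le> j)"
  proof (intro iffI allI impI)
    fix i j assume *: "\<forall>i. card {j \<in> {i..<i + int w}. \<eta> j \<noteq> 0} \<le> 1" "\<eta> i \<noteq> 0" "\<eta> j \<noteq> 0" "i < j"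
    show "i + int w \<le> j"
    proof (rule ccontr)
      assume "\<not> i + int w \<le> j"
      hence "{i, j} \<subseteq> {j \<in> {i..<i + int w}. \<eta> j \<noteq> 0}" using * by auto
      moreover have "finite {j \<in> {i..<i + int w}. \<eta> j \<noteq> 0}" by (rule finite_subset[of _ "{i..<i + int w}"]) auto
      ultimately have "card {i, j} \<le> card {j \<in> {i..<i + int w}. \<eta> j \<noteq> 0}" by (intro card_mono)
      also have "\<dots> \<le> 1" using *(1) by blast
      finally show False using *(4) by simp
    qed
  next
    fix i assume *: "\<forall>i j. \<eta> i \<noteq> 0 \<longrightarrow> \<eta> j \<noteq> 0 \<longrightarrow> i < j \<longrightarrow> i + int w \<le> j"
    have "x = y" if "x \<in> {j \<in> {i..<i + int w}. \<eta> j \<noteq> 0}" "y \<in> {j \<in> {i..<i + int w}. \<eta> j \<noteq> 0}" for x y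
      using *[rule_format, of x y] *[rule_format, of y x] that by (cases x y rule: linorder_cases) auto
    moreover have "finite {j \<in> {i..<i + int w}. \<eta> j \<noteq> 0}"
      by (rule finite_subset[of _ "{i..<i + int w}"]) auto
    ultimately have "card {j \<in> {i..<i + int w}. \<eta> j \<noteq> 0} \<le> Suc 0"
      by (subst card_le_Suc0_iff_eq) blast+
    thus "card {j \<in> {i..<i + int w}. \<eta> j \<noteq> 0} \<le> 1" by simp
  qed
  thus ?thesis unfolding is_wNAF_def by simp
qed

lemma wNAFs_0: "0 \<in> D \<Longrightarrow> wNAFs D w 0 = {\<lambda>_. 0}"
  by (auto simp: wNAFs_def is_wNAF_def fun_eq_iff) (metis linorder_not_less)

lemma wNAFs_Suc:
  assumes w: "w \<ge> 1" and D: "0 \<in> D"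
  shows "wNAFs D w (Suc n) = wNAFs D w n \<union>
    (\<lambda>(d, \<xi>). \<xi>(int n := d)) ` ((D - {0}) \<times> wNAFs D w (n - (w - 1)))"
proof (intro equalityI subsetI)
  fix \<eta> assume \<eta>: "\<eta> \<in> wNAFs D w (Suc n)"
  hence \<eta>D: "\<And>j. \<eta> j \<in> D" and sep: "\<And>i j. \<eta> i \<noteq> 0 \<Longrightarrow> \<eta> j \<noteq> 0 \<Longrightarrow> i < j \<Longrightarrow> i + int w \<le> j"
    and supp: "\<And>j. j < 0 \<or> j \<ge> int (Suc n) \<Longrightarrow> \<eta> j = 0"
    unfolding wNAFs_def is_wNAF_iff[OF w] by auto
  show "\<eta> \<in> wNAFs D w n \<union> (\<lambda>(d, \<xi>). \<xi>(int n := d)) ` ((D - {0}) \<times> wNAFs D w (n - (w - 1)))"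
  proof (cases "\<eta> (int n) = 0")
    case True
    have "\<eta> j = 0" if "j < 0 \<or> j \<ge> int n" for j
      using supp[of j] True that by (cases "j = int n") auto
    thus ?thesis using \<eta> by (simp add: wNAFs_def)
  next
    case False
    define \<xi> where "\<xi> = \<eta>(int n := 0)"
    have "\<xi> j = 0" if "j < 0 \<or> j \<ge> int (n - (w - 1))" for j
    proof (rule ccontr)
      assume nz: "\<xi> j \<noteq> 0"
      hence j: "j \<noteq> int n" "\<eta> j \<noteq> 0" by (auto simp: \<xi>_def split: if_splits)
      hence "0 \<le> j" "j < int n" using supp[of j] by force+
      with sep[OF j(2) False] have "j + int w \<le> int n" "0 \<le> j" by auto
      with that w show False by auto
    qed
    moreover have "is_wNAF D w \<xi>"
      unfolding is_wNAF_iff[OF w] using \<eta>D D sep by (auto simp: \<xi>_def)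
    ultimately have "\<xi> \<in> wNAFs D w (n - (w - 1))" by (simp add: wNAFs_def)
    moreover have "\<eta> = \<xi>(int n := \<eta> (int n))" by (simp add: \<xi>_def)
    ultimately show ?thesis using False \<eta>D[of "int n"]
      by (intro UnI2 image_eqI[of _ _ "(\<eta> (int n), \<xi>)"]) auto
  qed
next
  fix \<eta> assume "\<eta> \<in> wNAFs D w n \<union> (\<lambda>(d, \<xi>). \<xi>(int n := d)) ` ((D - {0}) \<times> wNAFs D w (n - (w - 1)))"
  thus "\<eta> \<in> wNAFs D w (Suc n)"
  proof
    assume "\<eta> \<in> wNAFs D w n"
    thus ?thesis by (auto simp: wNAFs_def)
  next
    assume "\<eta> \<in> (\<lambda>(d, \<xi>). \<xi>(int n := d)) ` ((D - {0}) \<times> wNAFs D w (n - (w - 1)))"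
    then obtain d \<xi> where d: "d \<in> D" "d \<noteq> 0" and \<xi>: "\<xi> \<in> wNAFs D w (n - (w - 1))" and \<eta>: "\<eta> = \<xi>(int n := d)"
      by auto
    from \<xi> have \<xi>D: "\<And>j. \<xi> j \<in> D" and sep: "\<And>i j. \<xi> i \<noteq> 0 \<Longrightarrow> \<xi> j \<noteq> 0 \<Longrightarrow> i < j \<Longrightarrow> i + int w \<le> j"
      and supp: "\<And>j. j < 0 \<or> j \<ge> int (n - (w - 1)) \<Longrightarrow> \<xi> j = 0"
      unfolding wNAFs_def is_wNAF_iff[OF w] by auto
    have small: "j + int w \<le> int n" if "\<xi> j \<noteq> 0" for j
      using supp[of j] that w by force
    have "i + int w \<le> j" if "\<eta> i \<noteq> 0" "\<eta> j \<noteq> 0" "i < j" for i j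
      using that sep[of i j] small[of i] small[of j] by (auto simp: \<eta> split: if_splits)
    moreover have "\<eta> j = 0" if "j < 0 \<or> j \<ge> int (Suc n)" for j
      using that supp[of j] w by (auto simp: \<eta>)
    moreover have "\<eta> j \<in> D" for j using \<xi>D d by (simp add: \<eta>)
    ultimately show ?thesis
      unfolding wNAFs_def is_wNAF_iff[OF w] by blast
  qed
qed

lemma wNAFs_outside: "\<xi> \<in> wNAFs D w n \<Longrightarrow> j \<ge> int n \<Longrightarrow> \<xi> j = 0"
  by (simp add: wNAFs_def)

lemma finite_wNAFs:
  assumes "w \<ge> 1" "0 \<in> D" "finite D"
  shows "finite (wNAFs D w n)"
  by (induction n rule: less_induct, case_tac x) (use assms in \<open>auto simp: wNAFs_0 wNAFs_Suc\<close>)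

text \<open>A weight multiplicative over the digits turns the splitting of the leading digit into
  the recursion of \<open>naf_gf\<close>. Weight 1 gives the count; the indeterminate at one digit,
  and 1 elsewhere, marks its occurrences.\<close>

lemma wNAFs_weight_sum:
  fixes f :: "complex \<Rightarrow> 'a::comm_ring_1"
  assumes w: "w \<ge> 1" and D: "0 \<in> D" "finite D" and f0: "f 0 = 1"
  shows "(\<Sum>\<xi>\<in>wNAFs D w n. \<Prod>j\<in>{0..<int n}. f (\<xi> j)) = naf_gf w (\<Sum>d\<in>D - {0}. f d) n"
proof (induction n rule: less_induct)
  case (less n)
  show ?case
  proof (cases n)
    case 0
    thus ?thesis using D by (simp add: wNAFs_0)
  next
    case (Suc k)
    let ?k = "k - (w - 1)"
    let ?S = "wNAFs D w"
    let ?ins = "\<lambda>(d, \<xi>). \<xi>(int k := d)"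
    \<comment> \<open>Positions above the support contribute \<open>f 0 = 1\<close>, so the weight
      does not depend on the nominal length.\<close>
    have ext: "(\<Prod>j\<in>{0..<int n'}. f (\<xi> j)) = (\<Prod>j\<in>{0..<int m}. f (\<xi> j))" if "\<xi> \<in> ?S m" "m \<le> n'" for \<xi> m n'
      using that wNAFs_outside[OF that(1)] f0 by (intro prod.mono_neutral_right) auto
    have disj: "?S k \<inter> ?ins ` ((D - {0}) \<times> ?S ?k) = {}"
      using wNAFs_outside[of _ D w k "int k"] by fastforce
    have inj: "inj_on ?ins ((D - {0}) \<times> ?S ?k)"
    proof (rule inj_onI)
      fix p p' assume "p \<in> (D - {0}) \<times> ?S ?k" "p' \<in> (D - {0}) \<times> ?S ?k" "?ins p = ?ins p'"
      then obtain d \<xi> d' \<xi>' where p: "p = (d, \<xi>)" "p' = (d', \<xi>')"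
        and *: "\<xi> \<in> ?S ?k" "\<xi>' \<in> ?S ?k" "\<xi>(int k := d) = \<xi>'(int k := d')"
        by (cases p; cases p') auto
      have "d = d'" using fun_cong[OF *(3), of "int k"] by simp
      moreover have "\<xi> j = \<xi>' j" for j
      proof (cases "j = int k")
        case True
        thus ?thesis using wNAFs_outside[OF *(1), of j] wNAFs_outside[OF *(2), of j] by simp
      qed (use fun_cong[OF *(3), of j] in simp)
      ultimately show "p = p'" by (auto simp: p)
    qed
    have ins_wt: "(\<Prod>j\<in>{0..<int (Suc k)}. f ((\<xi>(int k := d)) j)) = f d * (\<Prod>j\<in>{0..<int ?k}. f (\<xi> j))"
      if "\<xi> \<in> ?S ?k" for d \<xi>
    proof -
      have "{0..<int (Suc k)} = insert (int k) {0..<int k}" by auto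
      hence "(\<Prod>j\<in>{0..<int (Suc k)}. f ((\<xi>(int k := d)) j)) = f d * (\<Prod>j\<in>{0..<int k}. f (\<xi> j))"
        by simp
      thus ?thesis using ext[OF that, of k] by simp
    qed
    have "(\<Sum>\<xi>\<in>?S (Suc k). \<Prod>j\<in>{0..<int (Suc k)}. f (\<xi> j)) =
        (\<Sum>\<xi>\<in>?S k. \<Prod>j\<in>{0..<int (Suc k)}. f (\<xi> j)) +
        (\<Sum>\<xi>\<in>?ins ` ((D - {0}) \<times> ?S ?k). \<Prod>j\<in>{0..<int (Suc k)}. f (\<xi> j))"
      unfolding wNAFs_Suc[OF w D(1)] using disj finite_wNAFs[OF w D] D
      by (intro sum.union_disjoint) auto
    also have "(\<Sum>\<xi>\<in>?S k. \<Prod>j\<in>{0..<int (Suc k)}. f (\<xi> j)) = (\<Sum>\<xi>\<in>?S k. \<Prod>j\<in>{0..<int k}. f (\<xi> j))"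
      by (intro sum.cong refl ext) auto
    also have "\<dots> = naf_gf w (\<Sum>d\<in>D - {0}. f d) k" using less[of k] Suc by simp
    also have "(\<Sum>\<xi>\<in>?ins ` ((D - {0}) \<times> ?S ?k). \<Prod>j\<in>{0..<int (Suc k)}. f (\<xi> j)) =
        (\<Sum>(d, \<xi>)\<in>(D - {0}) \<times> ?S ?k. f d * (\<Prod>j\<in>{0..<int ?k}. f (\<xi> j)))"
      unfolding sum.reindex[OF inj] by (intro sum.cong refl) (auto simp del: of_nat_Suc fun_upd_apply simp: ins_wt)
    also have "\<dots> = (\<Sum>d\<in>D - {0}. f d) * (\<Sum>\<xi>\<in>?S ?k. \<Prod>j\<in>{0..<int ?k}. f (\<xi> j))"
      by (simp add: sum_product sum.cartesian_product)
    also have "(\<Sum>\<xi>\<in>?S ?k. \<Prod>j\<in>{0..<int ?k}. f (\<xi> j)) = naf_gf w (\<Sum>d\<in>D - {0}. f d) ?k"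
      using less[of ?k] Suc by simp
    finally show ?thesis using Suc by simp
  qed
qed

lemma wNAF_count_eq:
  assumes "w \<ge> 1" "0 \<in> D" "finite D"
  shows "real (wNAF_count D w n) = naf_gf w (real (card (D - {0}))) n"
  using wNAFs_weight_sum[OF assms, of "\<lambda>_. 1 :: real"] by (simp add: wNAF_count_def)

lemma wNAFs_occurrence_gf:
  assumes w: "w \<ge> 1" and D: "0 \<in> D" "finite D" and \<eta>: "\<eta> \<in> D - {0}"
  shows "(\<Sum>\<xi>\<in>wNAFs D w n. [:0, 1 :: real:] ^ card {j \<in> {0..<int n}. \<xi> j = \<eta>}) =
    naf_gf w [:real (card (D - {0})) - 1, 1:] n"
proof -
  let ?f = "\<lambda>d. if d = \<eta> then [:0, 1 :: real:] else 1"
  have "(\<Prod>j\<in>{0..<int n}. ?f (\<xi> j)) = [:0, 1:] ^ card {j \<in> {0..<int n}. \<xi> j = \<eta>}" for \<xi> :: "int \<Rightarrow> complex"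
    by (subst prod.If_cases) (auto simp: Int_def)
  moreover have "(\<Sum>d\<in>D - {0}. ?f d) = [:real (card (D - {0})) - 1, 1:]"
  proof -
    have "card (D - {0}) \<ge> 1" using \<eta> D card_gt_0_iff[of "D - {0}"] by fastforce
    have "(\<Sum>d\<in>D - {0}. ?f d) = [:0, 1:] + (\<Sum>d\<in>D - {0} - {\<eta>}. 1)"
      using \<eta> D by (subst sum.remove[of _ \<eta>]) (auto intro!: sum.cong)
    also have "(\<Sum>d\<in>D - {0} - {\<eta>}. 1) = [:real (card (D - {0} - {\<eta>})):]"
      by (simp add: of_nat_poly)
    also have "card (D - {0} - {\<eta>}) = card (D - {0}) - 1" using \<eta> D by simp
    finally show ?thesis using \<open>card (D - {0}) \<ge> 1\<close> by (simp add: of_nat_diff)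
  qed
  moreover have "?f 0 = 1" using \<eta> by auto
  ultimately show ?thesis using wNAFs_weight_sum[OF w D, of ?f n] by simp
qed

section \<open>Real zeros and the factorisation into Bernoulli factors\<close>

text \<open>Arguments are real numbers and not values of \<open>Arg\<close>, so they can grow past
  pi along the recursion. Rotated by -\<open>\<beta>\<close> the sum has positive imaginary part,
  rotated by -\<open>\<gamma>\<close> a negative one, which confines its argument to the interval
  between.\<close>

lemma polar_add:
  assumes "r > 0" "s > 0" "\<beta> \<le> \<gamma>" "\<gamma> < \<beta> + pi"
  obtains R \<delta> where "R > 0" "\<beta> \<le> \<delta>" "\<delta> \<le> \<gamma>"
    "of_real r * cis \<beta> + of_real s * cis \<gamma> = of_real R * cis \<delta>"
proof (cases "\<beta> = \<gamma>")
  case True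
  thus ?thesis using assms that[of "r + s" \<beta>] by (simp add: algebra_simps)
next
  case False
  define \<phi> where "\<phi> = \<gamma> - \<beta>"
  have \<phi>: "0 < \<phi>" "\<phi> < pi" using assms False by (auto simp: \<phi>_def)
  have sin\<phi>: "sin \<phi> > 0" using \<phi> by (rule sin_gt_zero)
  define z where "z = of_real r + of_real s * cis \<phi>"
  define t where "t = Arg z"
  have Imz: "Im z = s * sin \<phi>" by (simp add: z_def)
  have z0: "z \<noteq> 0" using Imz sin\<phi> assms by auto
  have z: "z = of_real (cmod z) * cis t" by (metis t_def rcis_cmod_Arg rcis_def)
  have t: "-pi < t" "t \<le> pi" using Arg_bounded[of z] by (auto simp: t_def)
  have "Im z = cmod z * sin t" by (subst z) simp
  hence sint: "sin t > 0" using Imz sin\<phi> assms z0 by (metis mult_pos_pos zero_less_mult_pos zero_less_norm_iff)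
  have t0: "t > 0"
  proof (rule ccontr)
    assume "\<not> t > 0"
    hence "sin (- t) \<ge> 0" using t by (intro sin_ge_zero) auto
    thus False using sint by simp
  qed
  have "t \<le> \<phi>"
  proof (rule ccontr)
    assume "\<not> t \<le> \<phi>"
    hence "sin (t - \<phi>) > 0" using t \<phi> by (intro sin_gt_zero) auto
    moreover have "z * cis (- \<phi>) = of_real r * cis (- \<phi>) + of_real s"
      by (simp add: z_def algebra_simps cis_mult)
    moreover have "z * cis (- \<phi>) = of_real (cmod z) * cis (t - \<phi>)"
      by (subst z) (simp add: mult.assoc cis_mult)
    ultimately have "of_real (cmod z) * cis (t - \<phi>) = of_real r * cis (- \<phi>) + of_real s" by simp
    from arg_cong[OF this, of Im] have "cmod z * sin (t - \<phi>) = - r * sin \<phi>" by simp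
    moreover have "cmod z * sin (t - \<phi>) > 0" using \<open>sin (t - \<phi>) > 0\<close> z0 by simp
    moreover have "r * sin \<phi> > 0" using assms sin\<phi> by simp
    ultimately show False by simp
  qed
  have "of_real r * cis \<beta> + of_real s * cis \<gamma> = z * cis \<beta>"
    by (simp add: z_def \<phi>_def algebra_simps cis_mult)
  also have "\<dots> = of_real (cmod z) * cis (\<beta> + t)"
    by (subst z) (simp add: mult.assoc cis_mult add.commute)
  finally show ?thesis
    using t0 \<open>t \<le> \<phi>\<close> z0 by (intro that[of "cmod z" "\<beta> + t"]) (auto simp: \<phi>_def)
qed

text \<open>The arguments of consecutive terms, lifted to the real line, increase, but by at most \<open>arg x\<close>
  over \<open>w\<close> steps; so the two summands in the recurrence never cancel.\<close>

lemma naf_gf_nonzero_upper_half_plane: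
  assumes "Im x > 0"
  shows "naf_gf w x n \<noteq> 0"
proof -
  define \<alpha> where "\<alpha> = Arg x"
  have x: "x = of_real (cmod x) * cis \<alpha>" by (metis \<alpha>_def rcis_cmod_Arg rcis_def)
  have x0: "cmod x > 0" using assms by auto
  have "Im x = cmod x * sin \<alpha>" by (subst x) simp
  hence "sin \<alpha> > 0" using assms x0 by (metis zero_less_mult_pos)
  have \<alpha>: "0 < \<alpha>" "\<alpha> < pi"
  proof -
    show "0 < \<alpha>"
    proof (rule ccontr)
      assume "\<not> 0 < \<alpha>"
      hence "sin (- \<alpha>) \<ge> 0" using Arg_bounded[of x] by (intro sin_ge_zero) (auto simp: \<alpha>_def)
      thus False using \<open>sin \<alpha> > 0\<close> by simp
    qed
    show "\<alpha> < pi" using Arg_bounded[of x] \<open>sin \<alpha> > 0\<close> by (cases "\<alpha> = pi") (auto simp: \<alpha>_def)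
  qed
  have "\<exists>t r. \<forall>k\<le>n. r k > 0 \<and> naf_gf w x k = of_real (r k) * cis (t k) \<and>
      (\<forall>l. k = Suc l \<longrightarrow> t l \<le> t k \<and> t k \<le> t (l - (w - 1)) + \<alpha>)"
  proof (induction n)
    case 0
    show ?case by (intro exI[of _ "\<lambda>_. 0"] exI[of _ "\<lambda>_. 1"]) simp
  next
    case (Suc n)
    then obtain t r where r0: "\<And>k. k \<le> n \<Longrightarrow> r k > 0"
      and eq: "\<And>k. k \<le> n \<Longrightarrow> naf_gf w x k = of_real (r k) * cis (t k)"
      and stp: "\<And>l. Suc l \<le> n \<Longrightarrow> t l \<le> t (Suc l) \<and> t (Suc l) \<le> t (l - (w - 1)) + \<alpha>"
      by blast
    have mono: "t i \<le> t j" if "i \<le> j" "j \<le> n" for i j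
      using that
    proof (induction j rule: dec_induct)
      case (step j)
      thus ?case using stp[of j] by force
    qed simp
    let ?m = "n - (w - 1)"
    \<comment> \<open>The second summand of the recursion has argument
      \<open>t ?m + \<alpha>\<close>. That it is at least \<open>t n\<close> is the invariant; that
      it is below \<open>t n + pi\<close> follows from monotonicity of \<open>t\<close> and
      \<open>\<alpha> < pi\<close>.\<close>
    have "t n \<le> t ?m + \<alpha>"
    proof (cases n)
      case 0
      thus ?thesis using \<alpha> by simp
    next
      case (Suc l)
      have "t n \<le> t (l - (w - 1)) + \<alpha>" using stp[of l] Suc by simp
      also have "t (l - (w - 1)) \<le> t ?m" using Suc by (intro mono) auto
      finally show ?thesis by simp
    qed
    moreover have "t ?m + \<alpha> < t n + pi" using mono[of ?m n] \<alpha> by simp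
    moreover have "r n > 0" "cmod x * r ?m > 0" using r0[of n] r0[of ?m] x0 by auto
    ultimately obtain R \<delta> where R: "R > 0" "t n \<le> \<delta>" "\<delta> \<le> t ?m + \<alpha>"
      "of_real (r n) * cis (t n) + of_real (cmod x * r ?m) * cis (t ?m + \<alpha>) = of_real R * cis \<delta>"
      using polar_add by blast
    have "naf_gf w x (Suc n) = of_real (r n) * cis (t n) + x * (of_real (r ?m) * cis (t ?m))"
      using eq[of n] eq[of ?m] by simp
    also have "x * (of_real (r ?m) * cis (t ?m)) = of_real (cmod x * r ?m) * cis (t ?m + \<alpha>)"
      by (subst x) (simp add: cis_mult[symmetric])
    finally have gf: "naf_gf w x (Suc n) = of_real R * cis \<delta>" using R(4) by simp
    show ?case
    proof (rule exI[of _ "t(Suc n := \<delta>)"], rule exI[of _ "r(Suc n := R)"], intro allI impI)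
      fix k assume k: "k \<le> Suc n"
      show "(r(Suc n := R)) k > 0 \<and> naf_gf w x k = of_real ((r(Suc n := R)) k) * cis ((t(Suc n := \<delta>)) k) \<and>
        (\<forall>l. k = Suc l \<longrightarrow> (t(Suc n := \<delta>)) l \<le> (t(Suc n := \<delta>)) k \<and>
           (t(Suc n := \<delta>)) k \<le> (t(Suc n := \<delta>)) (l - (w - 1)) + \<alpha>)"
      proof (cases "k = Suc n")
        case True
        thus ?thesis using R gf by auto
      next
        case False
        thus ?thesis using k r0[of k] eq[of k] stp by (auto simp del: naf_gf.simps)
      qed
    qed
  qed
  then obtain t r where "r n > 0" "naf_gf w x n = of_real (r n) * cis (t n)" by blast
  thus ?thesis by (simp add: cis_neq_zero)
qed

lemma cnj_naf_gf: "cnj (naf_gf w x n) = naf_gf w (cnj x) n"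
  by (induction w x n rule: naf_gf.induct) simp_all

lemma naf_gf_nonzero_if_nonreal:
  assumes "Im x \<noteq> 0"
  shows "naf_gf w x n \<noteq> 0"
proof (cases "Im x > 0")
  case False
  hence "naf_gf w (cnj x) n \<noteq> 0" using assms by (intro naf_gf_nonzero_upper_half_plane) auto
  thus ?thesis by (metis cnj_naf_gf complex_cnj_zero)
qed (rule naf_gf_nonzero_upper_half_plane)

lemma naf_gf_ge_1: "x \<ge> (0 :: real) \<Longrightarrow> naf_gf w x n \<ge> 1"
proof (induction w x n rule: naf_gf.induct)
  case (2 w x n)
  have "x * naf_gf w x (n - (w - 1)) \<ge> 0" using "2.IH"(2)[OF "2.prems"] "2.prems" by (intro mult_nonneg_nonneg) auto
  thus ?case using "2.IH"(1)[OF "2.prems"] unfolding naf_gf.simps by linarith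
qed simp

lemma map_poly_naf_gf:
  "poly (map_poly complex_of_real (naf_gf w p n)) z = naf_gf w (poly (map_poly of_real p) z) n"
  by (induction w p n rule: naf_gf.induct) (simp_all add: poly_map_poly_add poly_map_poly_mult)

text \<open>A zero z of the polynomial makes \<open>naf_gf\<close> vanish at c + z, so z is real; it
  is negative because \<open>naf_gf\<close> is at least 1 at nonnegative arguments. A factor y + a
  with a > 0 is 1 + a times 1 - p + p y, p = 1 / (1 + a), the generating polynomial of a Bernoulli
  variable.\<close>

lemma naf_gf_bernoulli_product:
  assumes c: "c \<ge> (0 :: real)"
  obtains p :: "nat \<Rightarrow> real" and d where "\<And>i. i < d \<Longrightarrow> 0 < p i \<and> p i < 1"
    "naf_gf w [:c, 1:] n = smult (naf_gf w (c + 1) n) (\<Prod>i<d. [:1 - p i, p i:])"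
proof -
  define P where "P = naf_gf w [:c, 1:] n"
  define Q where "Q = map_poly complex_of_real P"
  have Q: "poly Q z = naf_gf w (of_real c + z) n" for z
    unfolding Q_def P_def map_poly_naf_gf by (simp add: map_poly_pCons)
  have PQ: "poly Q (of_real x) = of_real (poly P x)" for x
    unfolding Q_def by (induction P) (simp_all add: map_poly_pCons)
  have P1: "poly P 1 \<ge> 1" unfolding P_def poly_naf_gf using c by (simp add: naf_gf_ge_1)
  obtain root where root: "smult (lead_coeff Q) (\<Prod>i<degree Q. [:- root i, 1:]) = Q"
    by (rule complex_poly_decompose')
  have Q_prod: "poly Q z = lead_coeff Q * (\<Prod>i<degree Q. z - root i)" for z
    by (subst root[symmetric], simp add: poly_prod)
  define a where "a i = - Re (root i)" for i
  have a: "root i = of_real (- a i)" "a i > 0" if i: "i < degree Q" for i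
  proof -
    have "(\<Prod>k<degree Q. root i - root k) = 0" using i by (intro prod_zero) auto
    hence rt: "poly Q (root i) = 0" using Q_prod[of "root i"] by simp
    have "Im (of_real c + root i) = 0" using rt naf_gf_nonzero_if_nonreal unfolding Q by blast
    thus re: "root i = of_real (- a i)" by (simp add: a_def complex_eq_iff)
    show "a i > 0"
    proof (rule ccontr)
      assume "\<not> a i > 0"
      hence "naf_gf w (c - a i) n \<ge> 1" using c by (intro naf_gf_ge_1) auto
      moreover have "poly P (- a i) = 0" using rt PQ[of "- a i"] re by simp
      ultimately show False by (simp add: P_def poly_naf_gf)
    qed
  qed
  have lc: "lead_coeff Q = of_real (lead_coeff P)"
    unfolding Q_def by (simp add: coeff_map_poly degree_map_poly)
  have P_prod: "poly P x = lead_coeff P * (\<Prod>i<degree Q. x + a i)" for x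
  proof -
    have "complex_of_real (poly P x) = of_real (lead_coeff P) * (\<Prod>i<degree Q. of_real x - root i)"
      using Q_prod[of "of_real x"] lc by (simp add: PQ)
    also have "(\<Prod>i<degree Q. complex_of_real x - root i) = (\<Prod>i<degree Q. of_real (x + a i))"
      by (intro prod.cong) (auto simp: a)
    finally have "complex_of_real (poly P x) = of_real (lead_coeff P * (\<Prod>i<degree Q. x + a i))" by simp
    thus ?thesis by (simp only: of_real_eq_iff)
  qed
  define p where "p i = 1 / (1 + a i)" for i
  have p: "0 < p i \<and> p i < 1" "x + a i = (1 + a i) * (1 - p i + x * p i)" if "i < degree Q" for i x
  proof -
    have *: "(1 + a i) * p i = 1" using a(2)[OF that] by (simp add: p_def)
    show "0 < p i \<and> p i < 1" using a(2)[OF that] by (auto simp: p_def field_simps)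
    have "(1 + a i) * (1 - p i + x * p i) = (1 + a i) - (1 + a i) * p i + x * ((1 + a i) * p i)"
      by (simp add: algebra_simps)
    thus "x + a i = (1 + a i) * (1 - p i + x * p i)" unfolding * by simp
  qed
  have eq: "poly P x = poly P 1 * (\<Prod>i<degree Q. 1 - p i + x * p i)" for x
  proof -
    have "(\<Prod>i<degree Q. x + a i) = (\<Prod>i<degree Q. (1 + a i) * (1 - p i + x * p i))"
      by (intro prod.cong refl p(2)) auto
    also have "\<dots> = (\<Prod>i<degree Q. 1 + a i) * (\<Prod>i<degree Q. 1 - p i + x * p i)"
      by (rule prod.distrib)
    finally show ?thesis using P_prod[of x] P_prod[of 1] by (simp only: mult.assoc)
  qed
  have rhs: "poly (smult c (\<Prod>i<degree Q. [:1 - p i, p i:])) x = c * (\<Prod>i<degree Q. 1 - p i + x * p i)" for c x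
    by (simp add: poly_prod)
  have "poly P = poly (smult (poly P 1) (\<Prod>i<degree Q. [:1 - p i, p i:]))"
    by (rule ext) (simp only: rhs eq[symmetric])
  hence "P = smult (poly P 1) (\<Prod>i<degree Q. [:1 - p i, p i:])" by (simp only: poly_eq_poly_eq_iff)
  moreover have "poly P 1 = naf_gf w (c + 1) n" by (simp add: P_def poly_naf_gf)
  ultimately have "P = smult (naf_gf w (c + 1) n) (\<Prod>i<degree Q. [:1 - p i, p i:])" by metis
  with p(1) that show ?thesis unfolding P_def by blast
qed

text \<open>The left side of the third equation is the variance in factorial moments. Since every
  factor has value 1 at 1, multiplication adds means and variances.\<close>

lemma bernoulli_product_moments:
  fixes p :: "nat \<Rightarrow> real"
  defines "F \<equiv> \<lambda>d. \<Prod>i<d. [:1 - p i, p i:]"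
  shows "poly (F d) 1 = 1" "poly (pderiv (F d)) 1 = (\<Sum>i<d. p i)"
    "poly (pderiv (pderiv (F d))) 1 + poly (pderiv (F d)) 1 - (poly (pderiv (F d)) 1)\<^sup>2 =
       (\<Sum>i<d. p i * (1 - p i))"
proof -
  have 0: "poly (F d) 1 = 1" for d by (simp add: F_def poly_prod)
  have Suc: "F (Suc d) = F d * [:1 - p d, p d:]" for d by (simp add: F_def)
  have 1: "poly (pderiv (F d)) 1 = (\<Sum>i<d. p i)" for d
  proof (induction d)
    case (Suc d)
    thus ?case unfolding \<open>\<And>d. F (Suc d) = _ d\<close> pderiv_mult by (simp add: 0 pderiv_pCons algebra_simps)
  qed (simp add: F_def)
  have 2: "poly (pderiv (pderiv (F d))) 1 + poly (pderiv (F d)) 1 - (poly (pderiv (F d)) 1)\<^sup>2 =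
       (\<Sum>i<d. p i * (1 - p i))" for d
  proof (induction d)
    case (Suc d)
    thus ?case unfolding \<open>\<And>d. F (Suc d) = _ d\<close> pderiv_mult pderiv_add
      by (simp add: 0 1 pderiv_pCons pderiv_mult power2_eq_square algebra_simps)
  qed (simp add: F_def)
  show "poly (F d) 1 = 1" "poly (pderiv (F d)) 1 = (\<Sum>i<d. p i)"
    "poly (pderiv (pderiv (F d))) 1 + poly (pderiv (F d)) 1 - (poly (pderiv (F d)) 1)\<^sup>2 =
       (\<Sum>i<d. p i * (1 - p i))" by (rule 0 1 2)+
qed

section \<open>Normal approximation of sums of Bernoulli variables\<close>

lemma gaussian_integral:
  fixes b :: real
  assumes b: "b > 0"
  shows "integrable lborel (\<lambda>t. exp (- b * t\<^sup>2))" "(\<integral>t. exp (- b * t\<^sup>2) \<partial>lborel) = sqrt (pi / b)"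
proof -
  define \<sigma> where "\<sigma> = 1 / sqrt (2 * b)"
  have \<sigma>: "\<sigma> > 0" "\<sigma>\<^sup>2 = 1 / (2 * b)" using b by (auto simp: \<sigma>_def power_divide)
  have eq: "exp (- b * t\<^sup>2) = sqrt (pi / b) * normal_density 0 \<sigma> t" for t
    using b by (simp add: normal_density_def \<sigma>(2) real_sqrt_divide)
  show "integrable lborel (\<lambda>t. exp (- b * t\<^sup>2))" unfolding eq using \<sigma> by simp
  show "(\<integral>t. exp (- b * t\<^sup>2) \<partial>lborel) = sqrt (pi / b)" unfolding eq using \<sigma> by simp
qed

lemma gaussian_integral_interval_le:
  fixes b :: real
  assumes b: "b > 0"
  shows "(\<lambda>t. exp (- b * t\<^sup>2)) integrable_on {l..u}"
    and "integral {l..u} (\<lambda>t. exp (- b * t\<^sup>2)) \<le> sqrt (pi / b)"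
proof -
  note G = gaussian_integral[OF b]
  show i: "(\<lambda>t. exp (- b * t\<^sup>2)) integrable_on {l..u}"
    by (intro integrable_continuous_real continuous_intros)
  have "((\<lambda>t. exp (- b * t\<^sup>2)) has_integral (\<integral>t. exp (- b * t\<^sup>2) \<partial>lborel)) UNIV"
    by (rule has_integral_integral_lborel) (use G(1) in \<open>simp_all\<close>)
  hence "(\<lambda>t. exp (- b * t\<^sup>2)) integrable_on UNIV"
    "integral UNIV (\<lambda>t. exp (- b * t\<^sup>2)) = sqrt (pi / b)"
    unfolding has_integral_iff G(2) by auto
  moreover from this(1) have "integral {l..u} (\<lambda>t. exp (- b * t\<^sup>2)) \<le> integral UNIV (\<lambda>t. exp (- b * t\<^sup>2))"
    by (intro integral_subset_le i) auto
  ultimately show "integral {l..u} (\<lambda>t. exp (- b * t\<^sup>2)) \<le> sqrt (pi / b)" by simp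
qed

text \<open>The characteristic function of the standard normal law after replacing t by
  \<open>sqrt V * t\<close>.\<close>

lemma gaussian_fourier:
  fixes V x :: real
  assumes V: "V > 0"
  shows "integrable lborel (\<lambda>t. cis (x * t) * of_real (exp (- V * t\<^sup>2 / 2)))"
    and "(\<integral>t. cis (x * t) * of_real (exp (- V * t\<^sup>2 / 2)) \<partial>lborel) =
       of_real (sqrt (2 * pi / V) * exp (- x\<^sup>2 / (2 * V)))"
proof -
  have meas: "(\<lambda>t. cis (x * t) * of_real (exp (- V * t\<^sup>2 / 2))) \<in> borel_measurable lborel"
    unfolding cis_conv_exp by measurable
  have "integrable lborel (\<lambda>t. exp (- (V / 2) * t\<^sup>2))" using V by (intro gaussian_integral) auto
  thus "integrable lborel (\<lambda>t. cis (x * t) * of_real (exp (- V * t\<^sup>2 / 2)))"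
    by (rule Bochner_Integration.integrable_bound) (use meas in \<open>auto simp: norm_mult\<close>)
  define s where "s = x / sqrt V"
  have s2: "s\<^sup>2 = x\<^sup>2 / V" using V by (simp add: s_def power_divide)
  have "complex_of_real (exp (- (s\<^sup>2) / 2)) = char std_normal_distribution s"
    by (simp add: char_std_normal_distribution)
  also have "\<dots> = (\<integral>t. std_normal_density t *\<^sub>R iexp (s * t) \<partial>lborel)"
    unfolding char_def by (subst integral_density) auto
  also have "\<dots> = \<bar>sqrt V\<bar> *\<^sub>R (\<integral>t. std_normal_density (0 + sqrt V * t) *\<^sub>R iexp (s * (0 + sqrt V * t)) \<partial>lborel)"
    using V by (intro lborel_integral_real_affine) auto
  also have "(\<lambda>t. std_normal_density (0 + sqrt V * t) *\<^sub>R iexp (s * (0 + sqrt V * t))) =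
     (\<lambda>t. (1 / sqrt (2 * pi)) *\<^sub>R (cis (x * t) * of_real (exp (- V * t\<^sup>2 / 2))))"
    using V by (auto simp: std_normal_density_def s_def cis_conv_exp scaleR_conv_of_real power_mult_distrib)
  finally have "complex_of_real (exp (- (s\<^sup>2) / 2)) =
      (sqrt V / sqrt (2 * pi)) *\<^sub>R (\<integral>t. cis (x * t) * of_real (exp (- V * t\<^sup>2 / 2)) \<partial>lborel)"
    using V by simp
  hence "(sqrt (2 * pi) / sqrt V) *\<^sub>R complex_of_real (exp (- (s\<^sup>2) / 2)) =
     (\<integral>t. cis (x * t) * of_real (exp (- V * t\<^sup>2 / 2)) \<partial>lborel)"
    using V by simp
  thus "(\<integral>t. cis (x * t) * of_real (exp (- V * t\<^sup>2 / 2)) \<partial>lborel) =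
       of_real (sqrt (2 * pi / V) * exp (- x\<^sup>2 / (2 * V)))"
    by (simp add: s2 real_sqrt_divide scaleR_conv_of_real mult.commute)
qed

text \<open>Beyond pi, half of the exponent is bounded by its value at pi and the other half is
  integrated over the line; exp (-y) <= 1 / y makes the tail O(V^(-3/2)). Summed over at most n
  indices with V of order n, this is O(n^(-1/2)).\<close>

lemma gaussian_fourier_truncated:
  fixes V x :: real
  assumes V: "V > 0"
  shows "norm (integral {-pi..pi} (\<lambda>t. cis (x * t) * of_real (exp (- V * t\<^sup>2 / 2))) -
       of_real (sqrt (2 * pi / V) * exp (- x\<^sup>2 / (2 * V)))) \<le> 4 / (V * pi\<^sup>2) * sqrt (4 * pi / V)"
proof -
  define h where "h t = cis (x * t) * complex_of_real (exp (- V * t\<^sup>2 / 2))" for t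
  note G = gaussian_fourier[OF V, of x, folded h_def]
  have cont: "continuous_on A h" for A
    unfolding h_def cis_conv_exp by (intro continuous_intros) auto
  have si: "set_integrable lborel {-pi..pi} h"
    by (rule borel_integrable_atLeastAtMost') (rule cont)
  have si': "set_integrable lborel (- {-pi..pi}) h"
    using G(1) unfolding set_integrable_def
    by (intro integrable_mult_indicator[where 'b = complex]) auto
  have "(LBINT t:{-pi..pi} \<union> - {-pi..pi}. h t) = (LBINT t:{-pi..pi}. h t) + (LBINT t:- {-pi..pi}. h t)"
    by (intro set_integral_Un si si') auto
  hence split: "(\<integral>t. h t \<partial>lborel) = integral {-pi..pi} h + (LBINT t:- {-pi..pi}. h t)"
    using set_borel_integral_eq_integral(2)[OF si] by (simp add: set_lebesgue_integral_def)
  have ie: "integrable lborel (\<lambda>t. exp (- (V / 4) * t\<^sup>2))" using V by (intro gaussian_integral) auto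
  have bound: "norm (indicator (- {-pi..pi}) t *\<^sub>R h t) \<le> exp (- V * pi\<^sup>2 / 4) * exp (- (V / 4) * t\<^sup>2)" for t
  proof (cases "t \<in> - {-pi..pi}")
    case True
    hence "\<bar>t\<bar> \<ge> pi" by auto
    hence "t\<^sup>2 \<ge> pi\<^sup>2" using power_mono[of pi "\<bar>t\<bar>" 2] by simp
    hence "V * t\<^sup>2 \<ge> V * pi\<^sup>2" using V by simp
    hence "- V * t\<^sup>2 / 2 \<le> - V * pi\<^sup>2 / 4 + - (V / 4) * t\<^sup>2" by simp
    hence "exp (- V * t\<^sup>2 / 2) \<le> exp (- V * pi\<^sup>2 / 4 + - (V / 4) * t\<^sup>2)" by simp
    hence "exp (- V * t\<^sup>2 / 2) \<le> exp (- V * pi\<^sup>2 / 4) * exp (- (V / 4) * t\<^sup>2)" by (simp only: exp_add)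
    thus ?thesis using True by (simp add: h_def norm_mult)
  qed simp
  have "norm (LBINT t:- {-pi..pi}. h t) \<le> (\<integral>t. exp (- V * pi\<^sup>2 / 4) * exp (- (V / 4) * t\<^sup>2) \<partial>lborel)"
    unfolding set_lebesgue_integral_def using si' ie bound
    by (intro Bochner_Integration.integral_norm_bound_integral) (auto simp: set_integrable_def)
  also have "\<dots> = exp (- V * pi\<^sup>2 / 4) * sqrt (4 * pi / V)"
    using gaussian_integral(2)[of "V / 4"] V by (simp add: mult.commute)
  also have "\<dots> \<le> 4 / (V * pi\<^sup>2) * sqrt (4 * pi / V)"
  proof (intro mult_right_mono)
    have "V * pi\<^sup>2 / 4 \<le> exp (V * pi\<^sup>2 / 4)" using exp_ge_add_one_self[of "V * pi\<^sup>2 / 4"] by linarith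
    moreover have "V * pi\<^sup>2 / 4 > 0" using V by simp
    ultimately have "inverse (exp (V * pi\<^sup>2 / 4)) \<le> inverse (V * pi\<^sup>2 / 4)" by (intro le_imp_inverse_le)
    thus "exp (- V * pi\<^sup>2 / 4) \<le> 4 / (V * pi\<^sup>2)" 
      by (simp add: exp_minus)
  qed (use V in simp)
  finally have "norm (LBINT t:- {-pi..pi}. h t) \<le> 4 / (V * pi\<^sup>2) * sqrt (4 * pi / V)" .
  moreover have "integral {-pi..pi} h - of_real (sqrt (2 * pi / V) * exp (- x\<^sup>2 / (2 * V))) =
      - (LBINT t:- {-pi..pi}. h t)"
    using split unfolding G(2) by simp
  ultimately show ?thesis unfolding h_def[symmetric] by simp
qed

section \<open>Fourier inversion for integer-valued variables\<close>

lemma has_integral_cis_int: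
  "((\<lambda>t. cis (of_int m * t)) has_integral (if m = 0 then of_real (2 * pi) else 0)) {-pi..pi}"
proof (cases "m = 0")
  case True
  thus ?thesis using has_integral_const_real[of "1 :: complex" "-pi" pi] by (simp add: scaleR_conv_of_real)
next
  case False
  let ?f = "\<lambda>z. exp (\<i> * of_int m * z) / (\<i> * of_int m)"
  have "((\<lambda>t. exp (\<i> * of_int m * of_real t)) has_integral ?f (of_real pi) - ?f (of_real (- pi))) {-pi..pi}"
  proof (rule fundamental_theorem_of_calculus)
    fix t assume "t \<in> {-pi..pi}"
    have "(?f has_field_derivative exp (\<i> * of_int m * of_real t)) (at (of_real t))"
      using False by (auto intro!: derivative_eq_intros)
    thus "((\<lambda>t. ?f (of_real t)) has_vector_derivative exp (\<i> * of_int m * of_real t)) (at t within {-pi..pi})"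
      by (rule has_vector_derivative_real_field)
  qed auto
  moreover have "exp (\<i> * of_int m * of_real t) = cis (of_int m * t)" for t
    by (simp add: cis_conv_exp mult_ac)
  moreover have "cis (of_int m * pi) = cis (of_int m * (- pi))"
    by (simp add: complex_eq_iff mult.commute)
  ultimately show ?thesis using False by (simp only: if_False diff_self)
qed

text \<open>By orthogonality the factor cis (- j t) isolates the j-th coefficient. For a probability
  generating polynomial the coefficient sum is the distribution function at k.\<close>

lemma poly_cis_partial_sums:
  fixes F :: "real poly"
  shows "((\<lambda>t. poly (map_poly of_real F) (cis t) * (\<Sum>j\<le>k. cis (- (real j * t)))) has_integral
     of_real (2 * pi * (\<Sum>j\<le>k. coeff F j))) {-pi..pi}"
proof -
  have deg: "degree (map_poly complex_of_real F) = degree F" by (rule degree_map_poly) auto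
  have "poly (map_poly of_real F) (cis t) * (\<Sum>j\<le>k. cis (- (real j * t))) =
    (\<Sum>j\<le>k. \<Sum>l\<le>degree F. of_real (coeff F l) * cis (of_int (int l - int j) * t))" for t
  proof -
    have "poly (map_poly of_real F) (cis t) = (\<Sum>l\<le>degree F. of_real (coeff F l) * cis (real l * t))"
      unfolding poly_altdef deg by (simp add: coeff_map_poly Complex.DeMoivre)
    moreover have "cis (real l * t) * cis (- (real j * t)) = cis (of_int (int l - int j) * t)" for l j
      by (simp add: cis_mult algebra_simps)
    ultimately show ?thesis
      by (subst sum.swap) (simp add: sum_product mult.assoc)
  qed
  moreover have "((\<lambda>t. \<Sum>j\<le>k. \<Sum>l\<le>degree F. of_real (coeff F l) * cis (of_int (int l - int j) * t)) has_integral
     (\<Sum>j\<le>k. \<Sum>l\<le>degree F. of_real (coeff F l) * (if int l - int j = 0 then of_real (2 * pi) else 0))) {-pi..pi}"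
    by (intro has_integral_sum finite_atMost has_integral_mult_right has_integral_cis_int)
  moreover have "(\<Sum>l\<le>degree F. complex_of_real (coeff F l) * (if int l - int j = 0 then of_real (2 * pi) else 0)) =
      of_real (2 * pi * coeff F j)" for j
  proof -
    have "(\<Sum>l\<le>degree F. complex_of_real (coeff F l) * (if int l - int j = 0 then of_real (2 * pi) else 0)) =
      (\<Sum>l\<le>degree F. if l = j then of_real (2 * pi * coeff F j) else 0)"
      by (intro sum.cong) auto
    also have "\<dots> = of_real (2 * pi * coeff F j)"
      by (cases "j \<le> degree F") (auto simp: coeff_eq_0)
    finally show ?thesis .
  qed
  ultimately show ?thesis by (simp add: sum_distrib_left)
qed

text \<open>A geometric sum with |1 - cis (-t)|^2 = 2 (1 - cos t). The bound is uniform in k, and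
  its singularity is absorbed by the |t|^3 of
  \<open>centred_bernoulli_char_prod_approx\<close>.\<close>

lemma dirichlet_kernel_bound:
  assumes t: "t \<noteq> 0" "\<bar>t\<bar> \<le> pi"
  shows "norm (\<Sum>j\<le>k. cis (- (real j * t))) \<le> pi / \<bar>t\<bar>"
proof -
  define z where "z = cis (- t)"
  have "4 * t\<^sup>2 / pi\<^sup>2 \<le> 2 * (1 - cos t)" using one_minus_cos_ge[OF t(2)] by simp
  also have "\<dots> = (1 - cos t)\<^sup>2 + (sin t)\<^sup>2"
    using sin_cos_squared_add[of t] by (simp add: power2_eq_square algebra_simps)
  also have "\<dots> = (norm (1 - z))\<^sup>2" by (simp add: z_def cmod_power2)
  finally have "(2 * \<bar>t\<bar> / pi)\<^sup>2 \<le> (norm (1 - z))\<^sup>2" by (simp add: power_divide power_mult_distrib)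
  hence low: "2 * \<bar>t\<bar> / pi \<le> norm (1 - z)" by (rule power2_le_imp_le) simp
  have pos: "2 * \<bar>t\<bar> / pi > 0" using t by simp
  hence z1: "z \<noteq> 1" using low by auto
  have "(\<Sum>j\<le>k. cis (- (real j * t))) = (\<Sum>j\<le>k. z ^ j)"
    by (simp add: z_def Complex.DeMoivre)
  also have "\<dots> = (1 - z ^ Suc k) / (1 - z)" using z1 by (simp add: sum_gp0)
  finally have "norm (\<Sum>j\<le>k. cis (- (real j * t))) = norm (1 - z ^ Suc k) / norm (1 - z)"
    by (simp only: norm_divide)
  also have "norm (1 - z ^ Suc k) \<le> norm (1 :: complex) + norm (z ^ Suc k)" by (rule norm_triangle_ineq4)
  also have "norm (z ^ Suc k) = 1" by (simp only: norm_power z_def norm_cis power_one)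
  also have "(norm (1::complex) + 1) / norm (1 - z) \<le> 2 / (2 * \<bar>t\<bar> / pi)"
    unfolding norm_one one_add_one using low pos
    by (intro divide_left_mono mult_pos_pos) (auto intro: less_le_trans[OF pos])
  finally show ?thesis by (simp add: divide_right_mono)
qed

section \<open>Characteristic functions of sums of Bernoulli variables\<close>

text \<open>The characteristic function of B - p for a Bernoulli variable B with parameter p.
  Centring makes its expansion at 0 agree with that of a Gaussian to second order.\<close>

definition centred_bernoulli_char :: "real \<Rightarrow> real \<Rightarrow> complex" where
  "centred_bernoulli_char p t = of_real (1 - p) * cis (- (p * t)) + of_real p * cis ((1 - p) * t)"

lemma centred_bernoulli_char_eq: "centred_bernoulli_char p t = (of_real (1 - p) + of_real p * cis t) * cis (- (p * t))"
  by (simp add: centred_bernoulli_char_def algebra_simps cis_mult)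

text \<open>The squared modulus is 1 - 2 p (1 - p) (1 - cos t), and 1 - cos t has a quadratic lower
  bound on all of [-pi, pi].\<close>

lemma norm_centred_bernoulli_char_le:
  assumes p: "0 \<le> p" "p \<le> 1" and t: "\<bar>t\<bar> \<le> pi"
  shows "norm (centred_bernoulli_char p t) \<le> exp (- (2 / pi\<^sup>2) * (p * (1 - p)) * t\<^sup>2)"
proof -
  have "(norm (centred_bernoulli_char p t))\<^sup>2 = (1 - p + p * cos t)\<^sup>2 + (p * sin t)\<^sup>2"
    unfolding centred_bernoulli_char_eq norm_mult norm_cis by (simp add: cmod_power2)
  also have "\<dots> = (1 - p)\<^sup>2 + 2 * (1 - p) * p * cos t + p\<^sup>2 * ((sin t)\<^sup>2 + (cos t)\<^sup>2)"
    by algebra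
  also have "\<dots> = 1 - 2 * (p * (1 - p)) * (1 - cos t)" by (simp add: power2_eq_square algebra_simps)
  also have "\<dots> \<le> exp (- (2 * (p * (1 - p)) * (1 - cos t)))"
    using exp_ge_add_one_self[of "- (2 * (p * (1 - p)) * (1 - cos t))"] by simp
  also have "\<dots> \<le> exp (- (2 * (p * (1 - p)) * (2 * t\<^sup>2 / pi\<^sup>2)))"
    unfolding exp_le_cancel_iff neg_le_iff_le using p one_minus_cos_ge[OF t] by (intro mult_left_mono) auto
  also have "\<dots> = (exp (- (2 / pi\<^sup>2) * (p * (1 - p)) * t\<^sup>2))\<^sup>2"
    unfolding exp_double[symmetric] by (simp add: mult_ac)
  finally show ?thesis by (rule power2_le_imp_le) simp
qed

text \<open>Taylor expansion to second order on both sides. The error keeps the factor p (1 - p), so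
  that summation over the variables yields their variance and not their number.\<close>

lemma centred_bernoulli_char_approx:
  assumes p: "0 \<le> p" "p \<le> 1" and t: "\<bar>t\<bar> \<le> pi"
  shows "norm (centred_bernoulli_char p t - of_real (exp (- (p * (1 - p)) * t\<^sup>2 / 2))) \<le> p * (1 - p) * \<bar>t\<bar> ^ 3"
proof -
  define q where "q = 1 - p"
  define v where "v = p * q"
  have q: "0 \<le> q" "q \<le> 1" using p by (auto simp: q_def)
  have v: "0 \<le> v" "v \<le> 1 / 4"
  proof -
    show "0 \<le> v" using p q by (simp add: v_def)
    have "(p - 1 / 2)\<^sup>2 \<ge> 0" by simp
    thus "v \<le> 1 / 4" by (simp add: v_def q_def power2_eq_square algebra_simps)
  qed
  have approx: "norm (cis x - (1 + \<i> * of_real x - of_real (x\<^sup>2 / 2))) \<le> \<bar>x\<bar> ^ 3 / 6" for x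
  proof -
    have "norm (iexp x - (\<Sum>k\<le>2. (\<i> * x) ^ k / fact k)) \<le> \<bar>x\<bar> ^ Suc 2 / fact (Suc 2)"
      by (rule iexp_approx1)
    moreover have "(\<Sum>k\<le>2. (\<i> * complex_of_real x) ^ k / fact k) = 1 + \<i> * of_real x - of_real (x\<^sup>2 / 2)"
      by (simp add: numeral_2_eq_2) (simp add: complex_eq_iff)
    moreover have "fact (Suc 2) = (6 :: real)" by (simp add: numeral_2_eq_2)
    ultimately show ?thesis by (simp add: cis_conv_exp numeral_3_eq_3 numeral_2_eq_2)
  qed
  have "centred_bernoulli_char p t - of_real (1 - v * t\<^sup>2 / 2) =
     of_real q * (cis (- (p * t)) - (1 + \<i> * of_real (- (p * t)) - of_real ((- (p * t))\<^sup>2 / 2))) +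
     of_real p * (cis (q * t) - (1 + \<i> * of_real (q * t) - of_real ((q * t)\<^sup>2 / 2)))"
    (is "?l = of_real q * ?A + of_real p * ?B")
  proof -
    have "q + p = 1" "v * t\<^sup>2 = q * (p * t)\<^sup>2 + p * (q * t)\<^sup>2"
      by (simp_all add: q_def v_def power2_eq_square algebra_simps)
    thus ?thesis unfolding centred_bernoulli_char_def q_def[symmetric]
      by (simp add: complex_eq_iff algebra_simps add_divide_distrib[symmetric])
  qed
  hence "norm ?l \<le> q * norm ?A + p * norm ?B"
    using p q norm_triangle_ineq[of "of_real q * ?A" "of_real p * ?B"] by (simp add: norm_mult)
  also have "\<dots> \<le> q * (\<bar>- (p * t)\<bar> ^ 3 / 6) + p * (\<bar>q * t\<bar> ^ 3 / 6)"
    using p q by (intro add_mono mult_left_mono approx)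
  also have "\<dots> = v * \<bar>t\<bar> ^ 3 / 6 * (p\<^sup>2 + q\<^sup>2)"
    using p q by (simp add: v_def abs_mult power_mult_distrib power2_eq_square power3_eq_cube algebra_simps add_divide_distrib)
  also have "\<dots> \<le> v * \<bar>t\<bar> ^ 3 / 6 * 1"
  proof (intro mult_left_mono)
    have "p\<^sup>2 + q\<^sup>2 = 1 - 2 * v" by (simp add: v_def q_def power2_eq_square algebra_simps)
    thus "p\<^sup>2 + q\<^sup>2 \<le> 1" using v by simp
  qed (use v in auto)
  finally have 1: "norm ?l \<le> v * \<bar>t\<bar> ^ 3 / 6" by simp
  define x where "x = v * t\<^sup>2 / 2"
  have x: "x \<ge> 0" using v by (simp add: x_def)
  have "\<bar>exp (- x) - (1 - x)\<bar> \<le> x\<^sup>2"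
  proof -
    have "exp (- x) \<le> 1 / (1 + x)"
      using exp_ge_add_one_self[of x] x by (simp add: exp_minus field_simps)
    also have "1 / (1 + x) \<le> 1 - x + x\<^sup>2"
    proof -
      have "(1 - x + x\<^sup>2) * (1 + x) = 1 + x ^ 3" by (simp add: power2_eq_square power3_eq_cube algebra_simps)
      thus ?thesis using x by (simp add: divide_le_eq)
    qed
    finally show ?thesis using exp_ge_add_one_self[of "- x"] by (simp add: abs_if)
  qed
  also have "x\<^sup>2 = v * \<bar>t\<bar> ^ 3 * (v * \<bar>t\<bar> / 4)"
    by (simp add: x_def power2_eq_square power3_eq_cube abs_mult[symmetric])
  \<comment> \<open>Uses v <= 1/4 and |t| <= pi < 4.\<close>
  also have "\<dots> \<le> v * \<bar>t\<bar> ^ 3 * (1 / 4 * 4 / 4)"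
    using v t pi_less_4 by (intro mult_left_mono divide_right_mono mult_mono) auto
  finally have 2: "\<bar>exp (- x) - (1 - x)\<bar> \<le> v * \<bar>t\<bar> ^ 3 / 4" by simp
  have "norm (complex_of_real (1 - x) - of_real (exp (- x))) = \<bar>exp (- x) - (1 - x)\<bar>"
    by (simp only: of_real_diff[symmetric] norm_of_real abs_minus_commute)
  hence "norm ((centred_bernoulli_char p t - of_real (1 - x)) + (of_real (1 - x) - of_real (exp (- x)))) \<le>
      v * \<bar>t\<bar> ^ 3 / 6 + v * \<bar>t\<bar> ^ 3 / 4"
    using 1 2 by (intro order.trans[OF norm_triangle_ineq] add_mono) (auto simp: x_def)
  also have "\<dots> \<le> v * \<bar>t\<bar> ^ 3" using v by (simp add: field_simps)
  finally show ?thesis by (simp add: x_def v_def q_def)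
qed

text \<open>The factors on both sides are multiplied by exp (c v_i t^2) with c = 2 / pi^2, which
  leaves their moduli at most 1. Products of such numbers differ by at most the sum of the
  differences of the factors, and undoing the scaling restores a Gaussian decay that a direct
  comparison would lose.\<close>

lemma centred_bernoulli_char_prod_approx:
  fixes p :: "nat \<Rightarrow> real"
  assumes p: "\<And>i. i < d \<Longrightarrow> 0 \<le> p i \<and> p i \<le> 1" and t: "\<bar>t\<bar> \<le> pi"
  defines "V \<equiv> \<Sum>i<d. p i * (1 - p i)"
  shows "norm ((\<Prod>i<d. centred_bernoulli_char (p i) t) - of_real (exp (- V * t\<^sup>2 / 2)))
    \<le> 2 * V * \<bar>t\<bar> ^ 3 * exp (- (2 / pi\<^sup>2) * V * t\<^sup>2)"
proof -
  define v where "v i = p i * (1 - p i)" for i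
  define c where "c = 2 / pi\<^sup>2"
  have c: "c > 0" "c \<le> 1 / 2"
  proof -
    have "pi\<^sup>2 \<ge> 2\<^sup>2" using pi_ge_two by (intro power_mono) auto
    thus "c > 0" "c \<le> 1 / 2" by (auto simp: c_def field_simps)
  qed
  have v: "0 \<le> v i" "v i \<le> 1 / 4" if "i < d" for i
  proof -
    show "0 \<le> v i" using p[OF that] by (simp add: v_def)
    have "(p i - 1 / 2)\<^sup>2 \<ge> 0" by simp
    thus "v i \<le> 1 / 4" by (simp add: v_def power2_eq_square algebra_simps)
  qed
  have V: "V = sum v {..<d}" by (simp add: V_def v_def)
  define z where "z i = of_real (exp (c * v i * t\<^sup>2)) * centred_bernoulli_char (p i) t" for i
  define u where "u i = complex_of_real (exp (c * v i * t\<^sup>2)) * of_real (exp (- v i * t\<^sup>2 / 2))" for i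
  have z1: "norm (z i) \<le> 1" if "i < d" for i
  proof -
    have "norm (z i) \<le> exp (c * v i * t\<^sup>2) * exp (- c * v i * t\<^sup>2)"
      using norm_centred_bernoulli_char_le[of "p i" t] p[OF that] t
      by (simp add: z_def norm_mult v_def c_def)
    thus ?thesis by (simp add: exp_add[symmetric])
  qed
  have u1: "norm (u i) \<le> 1" if "i < d" for i
  proof -
    have "c * (v i * t\<^sup>2) \<le> 1 / 2 * (v i * t\<^sup>2)" using c v(1)[OF that] by (intro mult_right_mono) auto
    hence "exp (c * v i * t\<^sup>2 + - v i * t\<^sup>2 / 2) \<le> 1" by simp
    hence "exp (c * v i * t\<^sup>2) * exp (- v i * t\<^sup>2 / 2) \<le> 1" by (simp only: exp_add)
    thus ?thesis by (simp add: u_def norm_mult)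
  qed
  have diff: "norm (z i - u i) \<le> 2 * (v i * \<bar>t\<bar> ^ 3)" if "i < d" for i
  proof -
    \<comment> \<open>As v_i <= 1/4, the exponent c v_i t^2 is at most 1/2, so the scaling costs at
      most a factor 2.\<close>
    have t2: "t\<^sup>2 \<le> pi\<^sup>2" using t power_mono[of "\<bar>t\<bar>" pi 2] by simp
    have "c * v i * t\<^sup>2 \<le> c * (1 / 4) * pi\<^sup>2" using c v[OF that] t2 by (intro mult_mono) auto
    also have "\<dots> = 1 / 2" by (simp add: c_def)
    finally have "exp (c * v i * t\<^sup>2) \<le> exp (1 / 2)" by simp
    also have "\<dots> \<le> 2" using exp_half_le2 by simp
    finally have e: "exp (c * v i * t\<^sup>2) \<le> 2" .
    have "z i - u i = of_real (exp (c * v i * t\<^sup>2)) * (centred_bernoulli_char (p i) t - of_real (exp (- v i * t\<^sup>2 / 2)))"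
      by (simp add: z_def u_def algebra_simps)
    hence "norm (z i - u i) = exp (c * v i * t\<^sup>2) * norm (centred_bernoulli_char (p i) t - of_real (exp (- v i * t\<^sup>2 / 2)))"
      by (simp add: norm_mult)
    also have "\<dots> \<le> 2 * (v i * \<bar>t\<bar> ^ 3)"
      using centred_bernoulli_char_approx[of "p i" t] p[OF that] t e unfolding v_def by (intro mult_mono) auto
    finally show ?thesis .
  qed
  have "norm ((\<Prod>i<d. z i) - (\<Prod>i<d. u i)) \<le> (\<Sum>i<d. norm (z i - u i))"
    by (rule norm_prod_diff) (use z1 u1 in auto)
  also have "\<dots> \<le> (\<Sum>i<d. 2 * (v i * \<bar>t\<bar> ^ 3))" by (intro sum_mono diff) auto
  also have "\<dots> = 2 * V * \<bar>t\<bar> ^ 3" by (simp add: V sum_distrib_left sum_distrib_right mult.assoc)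
  finally have main: "norm ((\<Prod>i<d. z i) - (\<Prod>i<d. u i)) \<le> 2 * V * \<bar>t\<bar> ^ 3" .
  have E: "(\<Prod>i<d. complex_of_real (exp (c * v i * t\<^sup>2))) = of_real (exp (c * V * t\<^sup>2))"
    by (simp add: V exp_sum sum_distrib_left sum_distrib_right of_real_prod[symmetric] del: of_real_prod)
  have E2: "(\<Prod>i<d. complex_of_real (exp (- v i * t\<^sup>2 / 2))) = of_real (exp (- V * t\<^sup>2 / 2))"
    by (simp add: V exp_sum sum_distrib_right sum_divide_distrib sum_negf[symmetric] of_real_prod[symmetric] del: of_real_prod sum_negf)
  have "(\<Prod>i<d. z i) - (\<Prod>i<d. u i) = of_real (exp (c * V * t\<^sup>2)) *
      ((\<Prod>i<d. centred_bernoulli_char (p i) t) - of_real (exp (- V * t\<^sup>2 / 2)))"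
    unfolding z_def u_def prod.distrib E E2 by (simp add: algebra_simps)
  hence "exp (c * V * t\<^sup>2) * norm ((\<Prod>i<d. centred_bernoulli_char (p i) t) - of_real (exp (- V * t\<^sup>2 / 2))) \<le> 2 * V * \<bar>t\<bar> ^ 3"
    using main by (simp add: norm_mult)
  hence "exp (- c * V * t\<^sup>2) * (exp (c * V * t\<^sup>2) * norm ((\<Prod>i<d. centred_bernoulli_char (p i) t) - of_real (exp (- V * t\<^sup>2 / 2))))
     \<le> exp (- c * V * t\<^sup>2) * (2 * V * \<bar>t\<bar> ^ 3)"
    by (intro mult_left_mono) auto
  thus ?thesis unfolding c_def[symmetric] mult.assoc[symmetric] exp_add[symmetric] by (simp add: mult_ac)
qed

section \<open>The normal distribution function\<close>

lemma std_normal_Phi_eq_LBINT: "std_normal_Phi x = (LBINT t:{..x}. std_normal_density t)"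
  unfolding std_normal_Phi_def std_normal_density_def set_integral_mult_right ..

lemma set_integrable_std_normal: "A \<in> sets lborel \<Longrightarrow> set_integrable lborel A std_normal_density"
  unfolding set_integrable_def by (intro integrable_mult_indicator) auto

lemma std_normal_Phi_has_integral: "(std_normal_density has_integral std_normal_Phi x) {..x}"
  unfolding std_normal_Phi_eq_LBINT
  using set_borel_integral_eq_integral[OF set_integrable_std_normal[of "{..x}"]]
  by (simp add: has_integral_iff)

lemma continuous_on_std_normal_density: "continuous_on A std_normal_density"
  unfolding std_normal_density_def by (intro continuous_intros) auto

lemma std_normal_Phi_eq_integral:
  assumes "a \<le> b"
  shows "std_normal_Phi b = std_normal_Phi a + integral {a..b} std_normal_density"
proof -
  have "(std_normal_density has_integral integral {a..b} std_normal_density) {a..b}"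
    by (intro integrable_integral integrable_continuous_real continuous_on_std_normal_density)
  with std_normal_Phi_has_integral[of a]
  have "(std_normal_density has_integral std_normal_Phi a + integral {a..b} std_normal_density) ({..a} \<union> {a..b})"
    by (rule has_integral_Un) (use assms in \<open>auto intro: negligible_subset[of "{a}"]\<close>)
  moreover have "{..a} \<union> {a..b} = {..b}" using assms by auto
  ultimately show ?thesis using std_normal_Phi_has_integral[of b] by (simp add: has_integral_unique)
qed

lemma std_normal_Phi_deriv: "(std_normal_Phi has_real_derivative std_normal_density x) (at x)"
proof -
  have "((\<lambda>y. integral {x - 1..y} std_normal_density) has_real_derivative std_normal_density x) (at x within {x - 1..x + 1})"
    by (rule integral_has_real_derivative) (auto intro: continuous_on_std_normal_density)
  hence "((\<lambda>y. std_normal_Phi (x - 1) + integral {x - 1..y} std_normal_density) has_real_derivative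
      std_normal_density x) (at x within {x - 1..x + 1})"
    by (auto intro!: derivative_eq_intros)
  hence "(std_normal_Phi has_real_derivative std_normal_density x) (at x within {x - 1..x + 1})"
    by (rule has_field_derivative_transform_within[where d = 1])
       (auto simp: std_normal_Phi_eq_integral[symmetric])
  thus ?thesis by (simp add: at_within_Icc_at)
qed

lemma std_normal_Phi_mono: "a \<le> b \<Longrightarrow> std_normal_Phi a \<le> std_normal_Phi b"
  using std_normal_Phi_eq_integral[of a b]
    integral_nonneg[of std_normal_density "{a..b}"]
  by (auto intro: integrable_continuous_real continuous_on_std_normal_density)

text \<open>Chebyshev's inequality with second moment 1.\<close>

lemma std_normal_tail:
  assumes A: "A \<in> sets lborel" and x: "x > 0" "\<And>t. t \<in> A \<Longrightarrow> \<bar>t\<bar> \<ge> x"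
  shows "(LBINT t:A. std_normal_density t) \<le> 1 / x\<^sup>2"
proof -
  have mom: "has_bochner_integral lborel (\<lambda>t. std_normal_density t * t ^ (2 * 1)) (fact (2 * 1) / (2 ^ 1 * fact 1))"
    by (rule std_normal_moment_even)
  have "(LBINT t:A. std_normal_density t) \<le> (\<integral>t. (std_normal_density t * t ^ (2 * 1)) / x\<^sup>2 \<partial>lborel)"
    unfolding set_lebesgue_integral_def
  proof (rule integral_mono)
    show "integrable lborel (\<lambda>t. indicator A t *\<^sub>R std_normal_density t)"
      using set_integrable_std_normal[OF A] by (simp add: set_integrable_def)
    show "integrable lborel (\<lambda>t. (std_normal_density t * t ^ (2 * 1)) / x\<^sup>2)"
      using mom by (auto simp: has_bochner_integral_iff)
    fix t
    show "indicator A t *\<^sub>R std_normal_density t \<le> (std_normal_density t * t ^ (2 * 1)) / x\<^sup>2"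
    proof (cases "t \<in> A")
      case True
      hence "x\<^sup>2 \<le> t\<^sup>2" using x power_mono[of x "\<bar>t\<bar>" 2] by simp
      hence "std_normal_density t * x\<^sup>2 \<le> std_normal_density t * t\<^sup>2" by (intro mult_left_mono) auto
      thus ?thesis using True x by (simp add: pos_le_divide_eq power2_eq_square)
    qed simp
  qed
  also have "\<dots> = 1 / x\<^sup>2" using mom by (simp add: has_bochner_integral_iff)
  finally show ?thesis .
qed

lemma std_normal_Phi_nonneg: "std_normal_Phi x \<ge> 0"
  unfolding std_normal_Phi_eq_LBINT set_lebesgue_integral_def by (intro integral_nonneg_AE) auto

lemma std_normal_Phi_compl: "1 - std_normal_Phi x = (LBINT t:{x<..}. std_normal_density t)"
proof -
  have "(LBINT t:{..x} \<union> {x<..}. std_normal_density t) =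
      (LBINT t:{..x}. std_normal_density t) + (LBINT t:{x<..}. std_normal_density t)"
    by (intro set_integral_Un set_integrable_std_normal) auto
  moreover have "{..x} \<union> {x<..} = (UNIV :: real set)" by auto
  ultimately show ?thesis
    by (simp add: std_normal_Phi_eq_LBINT set_lebesgue_integral_def)
qed

lemma std_normal_Phi_le_1: "std_normal_Phi x \<le> 1"
proof -
  have "(LBINT t:{x<..}. std_normal_density t) \<ge> 0"
    unfolding set_lebesgue_integral_def by (intro integral_nonneg_AE) auto
  thus ?thesis using std_normal_Phi_compl[of x] by simp
qed

text \<open>1 / x^2 is below 1 / x for x >= 1, and for smaller x the bound exceeds 1. It will be
  applied with x of order sqrt n.\<close>

lemma std_normal_Phi_tails:
  assumes x: "x > 0"
  shows "std_normal_Phi (- x) \<le> 1 / x" "1 - std_normal_Phi x \<le> 1 / x"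
proof -
  have *: "y \<le> 1 / x" if "y \<le> 1" "y \<le> 1 / x\<^sup>2" for y :: real
  proof (cases "x \<ge> 1")
    case True
    hence "1 / x\<^sup>2 \<le> 1 / x" using x by (simp add: field_simps power2_eq_square)
    thus ?thesis using that by simp
  next
    case False
    hence "1 \<le> 1 / x" using x by (simp add: field_simps)
    thus ?thesis using that by simp
  qed
  show "std_normal_Phi (- x) \<le> 1 / x"
    by (rule *) (use std_normal_tail[of "{..-x}" x] x in \<open>auto simp: std_normal_Phi_le_1 std_normal_Phi_eq_LBINT[symmetric]\<close>)
  show "1 - std_normal_Phi x \<le> 1 / x"
    by (rule *) (use std_normal_tail[of "{x<..}" x] x in \<open>auto simp: std_normal_Phi_nonneg std_normal_Phi_compl[symmetric]\<close>)
qed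

lemma normal_density_mono_dist:
  assumes "\<sigma> > 0" "\<bar>y - \<mu>\<bar> \<le> \<bar>x - \<mu>\<bar>"
  shows "normal_density \<mu> \<sigma> x \<le> normal_density \<mu> \<sigma> y"
proof -
  have "(y - \<mu>)\<^sup>2 \<le> (x - \<mu>)\<^sup>2" using assms(2) by (simp add: abs_le_square_iff)
  hence "- (x - \<mu>)\<^sup>2 / (2 * \<sigma>\<^sup>2) \<le> - (y - \<mu>)\<^sup>2 / (2 * \<sigma>\<^sup>2)" by (intro divide_right_mono) auto
  thus ?thesis unfolding normal_density_def by (intro mult_left_mono) auto
qed

lemma std_normal_Phi_shifted_deriv:
  assumes "\<sigma> > 0"
  shows "((\<lambda>x. std_normal_Phi ((x - \<mu>) / \<sigma>)) has_real_derivative normal_density \<mu> \<sigma> x) (at x)"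
proof -
  have "((\<lambda>x. std_normal_Phi ((x - \<mu>) / \<sigma>)) has_real_derivative std_normal_density ((x - \<mu>) / \<sigma>) * (1 / \<sigma>)) (at x)"
    by (rule DERIV_chain'[OF _ std_normal_Phi_deriv]) (use assms in \<open>auto intro!: derivative_eq_intros\<close>)
  also have "std_normal_density ((x - \<mu>) / \<sigma>) * (1 / \<sigma>) = normal_density \<mu> \<sigma> x"
    using assms by (simp add: normal_density_def real_sqrt_mult power_divide)
  finally show ?thesis .
qed

text \<open>Write the unimodal density as a sum of a monotone and an antitone function; the errors of the
  mean value theorem then telescope.\<close>

lemma normal_density_riemann_sum:
  assumes \<sigma>: "\<sigma> > 0"
  shows "\<bar>(\<Sum>j\<le>k. normal_density \<mu> \<sigma> (real j)) -
     (std_normal_Phi ((real k + 1 - \<mu>) / \<sigma>) - std_normal_Phi (- \<mu> / \<sigma>))\<bar> \<le> 2 * normal_density \<mu> \<sigma> \<mu>"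
proof -
  define f where "f = normal_density \<mu> \<sigma>"
  define f1 where "f1 x = f (min x \<mu>)" for x
  define f2 where "f2 x = f (max x \<mu>)" for x
  define G where "G x = std_normal_Phi ((x - \<mu>) / \<sigma>)" for x
  have f: "f x = f1 x + f2 x - f \<mu>" for x by (auto simp: f1_def f2_def min_def max_def)
  have mono1: "f1 x \<le> f1 y" if "x \<le> y" for x y
    unfolding f1_def f_def by (rule normal_density_mono_dist[OF \<sigma>]) (use that in \<open>auto simp: min_def\<close>)
  have mono2: "f2 y \<le> f2 x" if "x \<le> y" for x y
    unfolding f2_def f_def by (rule normal_density_mono_dist[OF \<sigma>]) (use that in \<open>auto simp: max_def\<close>)
  have bnd: "0 \<le> f x" "f x \<le> f \<mu>" for x
    unfolding f_def by (auto intro!: normal_density_mono_dist[OF \<sigma>])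
  have step: "\<bar>f (real j) - (G (real (Suc j)) - G (real j))\<bar> \<le>
      (f1 (real (Suc j)) - f1 (real j)) - (f2 (real (Suc j)) - f2 (real j))" for j
  proof -
    have "\<exists>z>real j. z < real (Suc j) \<and> G (real (Suc j)) - G (real j) = (real (Suc j) - real j) * f z"
      unfolding G_def f_def by (intro MVT2 std_normal_Phi_shifted_deriv \<sigma>) auto
    then obtain z where z: "real j < z" "z < real (Suc j)" "G (real (Suc j)) - G (real j) = f z" by auto
    show ?thesis unfolding z(3)
      using f[of z] f[of "real j"] mono1[of "real j" z] mono1[of z "real (Suc j)"] mono2[of "real j" z] mono2[of z "real (Suc j)"] z(1,2)
      by (auto simp: abs_le_iff)
  qed
  have "\<bar>(\<Sum>j\<le>k. f (real j)) - (G (real (Suc k)) - G (real 0))\<bar> =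
      \<bar>\<Sum>j<Suc k. f (real j) - (G (real (Suc j)) - G (real j))\<bar>"
    using sum_lessThan_telescope[of "\<lambda>j. G (real j)" "Suc k"]
    by (simp only: sum_subtractf[of "\<lambda>j. f (real j)"] lessThan_Suc_atMost)
  also have "\<dots> \<le> (\<Sum>j<Suc k. (f1 (real (Suc j)) - f1 (real j)) - (f2 (real (Suc j)) - f2 (real j)))"
    by (rule order.trans[OF sum_abs sum_mono]) (rule step)
  also have "\<dots> = (f1 (real (Suc k)) - f1 (real 0)) - (f2 (real (Suc k)) - f2 (real 0))"
    unfolding sum_subtractf[of "\<lambda>j. f1 (real (Suc j)) - f1 (real j)"]
    unfolding sum_lessThan_telescope[of "\<lambda>j. f1 (real j)"] sum_lessThan_telescope[of "\<lambda>j. f2 (real j)"] ..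
  \<comment> \<open>Each monotone part stays between 0 and \<open>f \<mu>\<close>, so its total
    change is at most \<open>f \<mu>\<close>.\<close>
  also have "\<dots> \<le> 2 * f \<mu>"
    using bnd(2)[of "min (real (Suc k)) \<mu>"] bnd(1)[of "min (real 0) \<mu>"]
      bnd(1)[of "max (real (Suc k)) \<mu>"] bnd(2)[of "max (real 0) \<mu>"]
    unfolding f1_def f2_def by linarith
  finally show ?thesis unfolding f_def G_def by (simp add: add.commute)
qed

text \<open>In the inversion integral a Gaussian replaces the characteristic function at cost O(1 /
  sqrt V). Its transform gives normal densities at the integers j <= k, and the k + 1 truncation
  errors produce the second term of the bound. The Riemann sum runs over [0, k + 1], whence the
  argument k + 1; the normal mass left of 0 is small because V <= \<open>\<mu>\<close>.\<close>

lemma bernoulli_sum_clt: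
  "\<exists>C>0. \<forall>(d::nat) (p::nat \<Rightarrow> real) (k::nat) \<mu> V.
     (\<forall>i<d. 0 \<le> p i \<and> p i \<le> 1) \<longrightarrow> \<mu> = (\<Sum>i<d. p i) \<longrightarrow> V = (\<Sum>i<d. p i * (1 - p i)) \<longrightarrow> V > 0 \<longrightarrow>
     \<bar>(\<Sum>j\<le>k. coeff (\<Prod>i<d. [:1 - p i, p i:]) j) - std_normal_Phi ((real k + 1 - \<mu>) / sqrt V)\<bar>
     \<le> C * (1 / sqrt V + (real k + 1) / (V * sqrt V))"
proof -
  \<comment> \<open>In the first entry, pi^2 sqrt (pi^3) comes from the Gaussian integral of
    \<open>diff_bound\<close> and 3 = 2 + 1 from the Riemann sum and the left tail. The second is
    the constant of \<open>gaussian_fourier_truncated\<close>.\<close>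
  define C where "C = max (pi\<^sup>2 * sqrt (pi ^ 3) + 3) (4 / pi\<^sup>2 * sqrt (4 * pi))"
  have C1: "pi\<^sup>2 * sqrt (pi ^ 3) + 3 \<le> C" and C2: "4 / pi\<^sup>2 * sqrt (4 * pi) \<le> C"
    unfolding C_def by auto
  have "pi\<^sup>2 * sqrt (pi ^ 3) + 3 > 0" by (intro add_nonneg_pos) auto
  hence C0: "C > 0" using C1 by linarith
  show ?thesis
  proof (intro exI[of _ C] conjI C0 allI impI)
    fix d and p :: "nat \<Rightarrow> real" and k :: nat and \<mu> V :: real
    assume p: "\<forall>i<d. 0 \<le> p i \<and> p i \<le> 1"
      and \<mu>_def: "\<mu> = (\<Sum>i<d. p i)" and V_def: "V = (\<Sum>i<d. p i * (1 - p i))" and V: "V > 0"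
    define \<sigma> where "\<sigma> = sqrt V"
    define F where "F = (\<Prod>i<d. [:1 - p i, p i:])"
    define \<phi> where "\<phi> t = poly (map_poly complex_of_real F) (cis t)" for t
    define g where "g t = cis (\<mu> * t) * complex_of_real (exp (- V * t\<^sup>2 / 2))" for t
    define K where "K t = (\<Sum>j\<le>k. cis (- (real j * t)))" for t
    define S where "S = (\<Sum>j\<le>k. coeff F j)"
    define f where "f = normal_density \<mu> \<sigma>"
    have \<sigma>: "\<sigma> > 0" "\<sigma>\<^sup>2 = V" using V by (auto simp: \<sigma>_def)
    have \<phi>: "\<phi> t = cis (\<mu> * t) * (\<Prod>i<d. centred_bernoulli_char (p i) t)" for t
    proof -
      have "\<phi> t = (\<Prod>i<d. of_real (1 - p i) + of_real (p i) * cis t)"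
        unfolding \<phi>_def F_def
      proof (induction d)
        case (Suc d)
        thus ?case
          unfolding prod.lessThan_Suc by (subst poly_map_poly_mult) (auto simp: map_poly_pCons)
      qed simp
      also have "\<dots> = (\<Prod>i<d. cis (p i * t) * centred_bernoulli_char (p i) t)"
        by (intro prod.cong refl) (simp add: centred_bernoulli_char_eq mult.left_commute cis_mult)
      also have "(\<Prod>i<d. cis (p i * t)) = cis (\<mu> * t)"
        unfolding \<mu>_def by (induction d) (simp_all add: cis_mult algebra_simps)
      hence "(\<Prod>i<d. cis (p i * t) * centred_bernoulli_char (p i) t) = cis (\<mu> * t) * (\<Prod>i<d. centred_bernoulli_char (p i) t)"
        by (simp add: prod.distrib)
      finally show ?thesis .
    qed
    have int\<phi>: "((\<lambda>t. \<phi> t * K t) has_integral of_real (2 * pi * S)) {-pi..pi}"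
      unfolding \<phi>_def K_def S_def by (rule poly_cis_partial_sums)
    have contg: "continuous_on A (\<lambda>t. cis (x * t) * complex_of_real (exp (- V * t\<^sup>2 / 2)))" for A x
      unfolding cis_conv_exp by (intro continuous_intros) auto
    have contK: "continuous_on A K" for A
      unfolding K_def cis_conv_exp by (intro continuous_intros)
    have intg: "(\<lambda>t. g t * K t) integrable_on {-pi..pi}"
      unfolding g_def by (intro integrable_continuous_real continuous_on_mult contg contK)
    have diff_bound: "norm ((\<phi> t - g t) * K t) \<le> 2 * pi * pi\<^sup>2 * exp (- (V / pi\<^sup>2) * t\<^sup>2)"
      if t: "t \<in> {-pi..pi}" for t
    \<comment> \<open>\<open>dirichlet_kernel_bound\<close> excludes 0, where the difference
      vanishes.\<close>
    proof (cases "t = 0")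
      case True
      have "\<phi> 0 = 1" unfolding \<phi> by (simp add: centred_bernoulli_char_def)
      hence "\<phi> t - g t = 0" using True by (simp add: g_def)
      thus ?thesis by simp
    next
      case False
      have at: "\<bar>t\<bar> \<le> pi" using t by auto
      \<comment> \<open>The factor V t^2 is traded for half of the Gaussian decay by y <= exp
        y.\<close>
      have e: "(V / pi\<^sup>2) * t\<^sup>2 \<le> exp ((V / pi\<^sup>2) * t\<^sup>2)"
        using exp_ge_add_one_self[of "(V / pi\<^sup>2) * t\<^sup>2"] by linarith
      have "norm (\<phi> t - g t) = norm ((\<Prod>i<d. centred_bernoulli_char (p i) t) - of_real (exp (- V * t\<^sup>2 / 2)))"
        unfolding \<phi> g_def right_diff_distrib[symmetric] norm_mult norm_cis by simp
      also have "\<dots> \<le> 2 * V * \<bar>t\<bar> ^ 3 * exp (- (2 / pi\<^sup>2) * V * t\<^sup>2)"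
        unfolding V_def using p by (intro centred_bernoulli_char_prod_approx at) auto
      finally have "norm ((\<phi> t - g t) * K t) \<le> 2 * V * \<bar>t\<bar> ^ 3 * exp (- (2 / pi\<^sup>2) * V * t\<^sup>2) * (pi / \<bar>t\<bar>)"
        unfolding norm_mult K_def using dirichlet_kernel_bound[OF False at, of k] V
        by (intro mult_mono) auto
      also have "\<dots> = 2 * pi * (V * t\<^sup>2) * exp (- (2 / pi\<^sup>2) * V * t\<^sup>2)"
        using False by (simp add: power3_eq_cube power2_eq_square field_simps)
      also have "V * t\<^sup>2 = pi\<^sup>2 * ((V / pi\<^sup>2) * t\<^sup>2)" by simp
      also have "2 * pi * (pi\<^sup>2 * ((V / pi\<^sup>2) * t\<^sup>2)) * exp (- (2 / pi\<^sup>2) * V * t\<^sup>2) \<le>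
          2 * pi * (pi\<^sup>2 * exp ((V / pi\<^sup>2) * t\<^sup>2)) * exp (- (2 / pi\<^sup>2) * V * t\<^sup>2)"
        by (intro mult_right_mono mult_left_mono e) auto
      also have "\<dots> = 2 * pi * pi\<^sup>2 * exp ((V / pi\<^sup>2) * t\<^sup>2 + - (2 / pi\<^sup>2) * V * t\<^sup>2)"
        unfolding exp_add by simp
      also have "(V / pi\<^sup>2) * t\<^sup>2 + - (2 / pi\<^sup>2) * V * t\<^sup>2 = - (V / pi\<^sup>2) * t\<^sup>2" by simp
      finally show ?thesis .
    qed
    have Vp: "V / pi\<^sup>2 > 0" using V by simp
    have "norm (integral {-pi..pi} (\<lambda>t. (\<phi> t - g t) * K t)) \<le>
        integral {-pi..pi} (\<lambda>t. 2 * pi * pi\<^sup>2 * exp (- (V / pi\<^sup>2) * t\<^sup>2))"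
    proof (rule integral_norm_bound_integral)
      show "(\<lambda>t. (\<phi> t - g t) * K t) integrable_on {-pi..pi}"
        unfolding left_diff_distrib using int\<phi> intg by (intro integrable_diff) (auto simp: integrable_on_def)
      show "(\<lambda>t. 2 * pi * pi\<^sup>2 * exp (- (V / pi\<^sup>2) * t\<^sup>2)) integrable_on {-pi..pi}"
        by (intro integrable_continuous_real continuous_intros)
    qed (rule diff_bound)
    also have "\<dots> \<le> 2 * pi * pi\<^sup>2 * sqrt (pi / (V / pi\<^sup>2))"
      unfolding integral_mult_right by (intro mult_left_mono gaussian_integral_interval_le Vp) auto
    also have "sqrt (pi / (V / pi\<^sup>2)) = sqrt (pi ^ 3) / \<sigma>"
      unfolding \<sigma>_def by (simp add: real_sqrt_divide[symmetric] power3_eq_cube power2_eq_square mult_ac)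
    finally have part1: "norm (of_real (2 * pi * S) - integral {-pi..pi} (\<lambda>t. g t * K t)) \<le>
        2 * pi * (pi\<^sup>2 * sqrt (pi ^ 3) / \<sigma>)"
      using integral_unique[OF int\<phi>] int\<phi> intg
      by (simp add: left_diff_distrib integral_diff has_integral_integrable)
    have gK: "integral {-pi..pi} (\<lambda>t. g t * K t) =
        (\<Sum>j\<le>k. integral {-pi..pi} (\<lambda>t. cis ((\<mu> - real j) * t) * of_real (exp (- V * t\<^sup>2 / 2))))"
    proof -
      have "g t * K t = (\<Sum>j\<le>k. cis ((\<mu> - real j) * t) * of_real (exp (- V * t\<^sup>2 / 2)))" for t
      proof -
        have "cis ((\<mu> - real j) * t) = cis (\<mu> * t) * cis (- (real j * t))" for j
          by (simp add: cis_mult algebra_simps)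
        thus ?thesis unfolding g_def K_def sum_distrib_left by (intro sum.cong refl) (simp only: mult_ac)
      qed
      thus ?thesis
        by (simp only:) (intro integral_sum finite_atMost integrable_continuous_real contg)
    qed
    have fj: "2 * pi * f (real j) = sqrt (2 * pi / V) * exp (- (\<mu> - real j)\<^sup>2 / (2 * V))" for j
    proof -
      have "2 * pi * V * (2 * pi / V) = (2 * pi)\<^sup>2" using V by (simp add: power2_eq_square)
      hence "sqrt (2 * pi * V) * sqrt (2 * pi / V) = 2 * pi"
        unfolding real_sqrt_mult[symmetric] by (simp only: real_sqrt_abs) simp
      hence "2 * pi * (1 / sqrt (2 * pi * V)) = sqrt (2 * pi / V)" using V by (simp add: field_simps)
      thus ?thesis unfolding f_def normal_density_def \<sigma>(2) power2_commute[of "real j"]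
        by (simp only: mult.assoc[symmetric])
    qed
    have "norm (integral {-pi..pi} (\<lambda>t. g t * K t) - of_real (2 * pi * (\<Sum>j\<le>k. f (real j)))) =
       norm (\<Sum>j\<le>k. integral {-pi..pi} (\<lambda>t. cis ((\<mu> - real j) * t) * of_real (exp (- V * t\<^sup>2 / 2))) -
         of_real (sqrt (2 * pi / V) * exp (- (\<mu> - real j)\<^sup>2 / (2 * V))))"
      unfolding gK sum_distrib_left fj of_real_sum sum_subtractf ..
    also have "\<dots> \<le> (\<Sum>j\<le>k. 4 / (V * pi\<^sup>2) * sqrt (4 * pi / V))"
      by (intro order.trans[OF norm_sum sum_mono] gaussian_fourier_truncated V)
    also have "\<dots> = (real k + 1) / (V * \<sigma>) * (4 / pi\<^sup>2 * sqrt (4 * pi))"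
      by (simp add: \<sigma>_def real_sqrt_divide mult_ac add.commute)
    also have "\<dots> \<le> (real k + 1) / (V * \<sigma>) * C"
      using C2 V \<sigma> by (intro mult_left_mono) auto
    finally have part2: "norm (integral {-pi..pi} (\<lambda>t. g t * K t) - of_real (2 * pi * (\<Sum>j\<le>k. f (real j))))
       \<le> (real k + 1) / (V * \<sigma>) * C" .
    have "2 * pi * \<bar>S - (\<Sum>j\<le>k. f (real j))\<bar> = \<bar>2 * pi * S - 2 * pi * (\<Sum>j\<le>k. f (real j))\<bar>"
      by (simp add: right_diff_distrib[symmetric] abs_mult)
    also have "\<dots> = norm (complex_of_real (2 * pi * S) - of_real (2 * pi * (\<Sum>j\<le>k. f (real j))))"
      by (simp only: of_real_diff[symmetric] norm_of_real)
    also have "\<dots> \<le> 2 * pi * (pi\<^sup>2 * sqrt (pi ^ 3) / \<sigma>) + (real k + 1) / (V * \<sigma>) * C"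
      using norm_triangle_ineq[of "of_real (2 * pi * S) - integral {-pi..pi} (\<lambda>t. g t * K t)"
         "integral {-pi..pi} (\<lambda>t. g t * K t) - of_real (2 * pi * (\<Sum>j\<le>k. f (real j)))"] part1 part2
      by simp
    also have "\<dots> \<le> 2 * pi * (pi\<^sup>2 * sqrt (pi ^ 3) / \<sigma>) + 2 * pi * ((real k + 1) / (V * \<sigma>) * C)"
    proof (intro add_left_mono)
      have "(real k + 1) / (V * \<sigma>) * C \<ge> 0" using V \<sigma> C0 by simp
      moreover have "2 * pi \<ge> 1" using pi_gt3 by simp
      ultimately show "(real k + 1) / (V * \<sigma>) * C \<le> 2 * pi * ((real k + 1) / (V * \<sigma>) * C)"
        by (simp only: mult_le_cancel_right1) auto
    qed
    also have "\<dots> = 2 * pi * (pi\<^sup>2 * sqrt (pi ^ 3) / \<sigma> + (real k + 1) / (V * \<sigma>) * C)"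
      by (simp only: distrib_left)
    finally have part12: "\<bar>S - (\<Sum>j\<le>k. f (real j))\<bar> \<le> pi\<^sup>2 * sqrt (pi ^ 3) / \<sigma> + (real k + 1) / (V * \<sigma>) * C"
      by (rule mult_left_le_imp_le) simp
    have f\<mu>: "f \<mu> \<le> 1 / \<sigma>"
    proof -
      have "f \<mu> = 1 / sqrt (2 * pi * \<sigma>\<^sup>2)" by (simp add: f_def normal_density_def)
      also have "\<dots> \<le> 1 / sqrt (\<sigma>\<^sup>2)"
        using \<sigma> pi_gt3 by (intro divide_left_mono real_sqrt_le_mono) (auto intro!: mult_pos_pos)
      finally show ?thesis using \<sigma>(1) by (simp only: real_sqrt_abs abs_of_pos)
    qed
    have part3: "\<bar>(\<Sum>j\<le>k. f (real j)) - (std_normal_Phi ((real k + 1 - \<mu>) / \<sigma>) - std_normal_Phi (- \<mu> / \<sigma>))\<bar> \<le> 2 / \<sigma>"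
      using normal_density_riemann_sum[OF \<sigma>(1), where \<mu> = \<mu> and k = k, folded f_def] f\<mu> by simp
    have "V \<le> \<mu>" unfolding V_def \<mu>_def using p by (intro sum_mono) (auto simp: mult_le_cancel_left2)
    hence "- \<mu> / \<sigma> \<le> - \<sigma>" using \<sigma> by (simp add: field_simps power2_eq_square)
    hence "std_normal_Phi (- \<mu> / \<sigma>) \<le> std_normal_Phi (- \<sigma>)" by (rule std_normal_Phi_mono)
    also have "\<dots> \<le> 1 / \<sigma>" by (rule std_normal_Phi_tails) fact
    finally have part4: "\<bar>std_normal_Phi (- \<mu> / \<sigma>)\<bar> \<le> 1 / \<sigma>" using std_normal_Phi_nonneg by simp
    have "\<bar>S - std_normal_Phi ((real k + 1 - \<mu>) / \<sigma>)\<bar> \<le>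
        pi\<^sup>2 * sqrt (pi ^ 3) / \<sigma> + (real k + 1) / (V * \<sigma>) * C + 2 / \<sigma> + 1 / \<sigma>"
      using part12 part3 part4 by (simp only: abs_le_iff) linarith
    also have "\<dots> = (pi\<^sup>2 * sqrt (pi ^ 3) + 3) * (1 / \<sigma>) + (real k + 1) / (V * \<sigma>) * C"
      by (simp add: add_divide_distrib distrib_right)
    also have "\<dots> \<le> C * (1 / \<sigma>) + (real k + 1) / (V * \<sigma>) * C"
      using C1 \<sigma> by (intro add_right_mono mult_right_mono) auto
    also have "\<dots> = C * (1 / \<sigma> + (real k + 1) / (V * \<sigma>))" by (simp only: distrib_left mult.commute)
    finally show "\<bar>(\<Sum>j\<le>k. coeff (\<Prod>i<d. [:1 - p i, p i:]) j) - std_normal_Phi ((real k + 1 - \<mu>) / sqrt V)\<bar>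
     \<le> C * (1 / sqrt V + (real k + 1) / (V * sqrt V))"
      unfolding S_def F_def \<sigma>_def .
  qed
qed

section \<open>From the generating polynomial to the normalised variable\<close>

text \<open>\<open>P\<close> is card S times the probability generating polynomial, so its
  derivatives at 1, divided by \<open>poly P 1\<close>, are factorial moments.\<close>

lemma pmf_of_set_pgf:
  fixes c :: "'a \<Rightarrow> nat"
  assumes S: "finite S" "S \<noteq> {}"
  defines "P \<equiv> \<Sum>\<xi>\<in>S. [:0, 1 :: real:] ^ c \<xi>"
  defines "E \<equiv> poly (pderiv P) 1 / poly P 1"
  shows "measure_pmf.expectation (pmf_of_set S) (\<lambda>\<xi>. real (c \<xi>)) = E"
    and "measure_pmf.variance (pmf_of_set S) (\<lambda>\<xi>. real (c \<xi>)) = poly (pderiv (pderiv P)) 1 / poly P 1 + E - E\<^sup>2"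
    and "measure_pmf.prob (pmf_of_set S) {\<xi>. c \<xi> \<le> k} = (\<Sum>j\<le>k. coeff P j) / poly P 1"
proof -
  have P: "P = (\<Sum>\<xi>\<in>S. monom 1 (c \<xi>))" by (simp add: P_def monom_altdef)
  have P1: "poly P 1 = card S" by (simp add: P poly_sum poly_monom)
  have Pd: "poly (pderiv P) 1 = (\<Sum>\<xi>\<in>S. real (c \<xi>))"
    by (simp add: P higher_pderiv_sum[of 1, simplified] pderiv_monom poly_sum poly_monom)
  have Pdd: "poly (pderiv (pderiv P)) 1 = (\<Sum>\<xi>\<in>S. real (c \<xi>) * (real (c \<xi>) - 1))"
    unfolding P higher_pderiv_sum[of 1, simplified] pderiv_monom poly_sum poly_monom
  proof (intro sum.cong refl)
    show "real (c \<xi> - 1) * (real (c \<xi>) * 1) * 1 ^ (c \<xi> - 1 - 1) = real (c \<xi>) * (real (c \<xi>) - 1)" for \<xi>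
      by (cases "c \<xi>") auto
  qed
  have int: "integrable (measure_pmf (pmf_of_set S)) f" for f :: "'a \<Rightarrow> real"
    by (rule integrable_measure_pmf_finite) (simp add: S)
  show E: "measure_pmf.expectation (pmf_of_set S) (\<lambda>\<xi>. real (c \<xi>)) = E"
    by (simp add: E_def integral_pmf_of_set[OF S(2,1)] P1 Pd)
  have "measure_pmf.variance (pmf_of_set S) (\<lambda>\<xi>. real (c \<xi>)) =
      measure_pmf.expectation (pmf_of_set S) (\<lambda>\<xi>. (real (c \<xi>))\<^sup>2) - E\<^sup>2"
    by (subst measure_pmf.variance_eq) (auto intro: int simp: E)
  also have "measure_pmf.expectation (pmf_of_set S) (\<lambda>\<xi>. (real (c \<xi>))\<^sup>2) =
      (\<Sum>\<xi>\<in>S. real (c \<xi>) * (real (c \<xi>) - 1) + real (c \<xi>)) / card S"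
    unfolding integral_pmf_of_set[OF S(2,1)] by (simp add: power2_eq_square algebra_simps)
  also have "\<dots> = poly (pderiv (pderiv P)) 1 / poly P 1 + E"
    by (simp add: sum.distrib P1 E_def Pd Pdd add_divide_distrib)
  finally show "measure_pmf.variance (pmf_of_set S) (\<lambda>\<xi>. real (c \<xi>)) =
      poly (pderiv (pderiv P)) 1 / poly P 1 + E - E\<^sup>2" .
  have "(\<Sum>j\<le>k. coeff P j) = (\<Sum>\<xi>\<in>S. \<Sum>j\<le>k. if c \<xi> = j then 1 else 0)"
    unfolding P coeff_sum by (subst sum.swap) (simp add: coeff_monom)
  also have "\<dots> = (\<Sum>\<xi>\<in>S. if c \<xi> \<le> k then 1 else 0)" by simp
  also have "\<dots> = card (S \<inter> {\<xi>. c \<xi> \<le> k})" using S by (simp add: sum.If_cases)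
  finally show "measure_pmf.prob (pmf_of_set S) {\<xi>. c \<xi> \<le> k} = (\<Sum>j\<le>k. coeff P j) / poly P 1"
    using measure_pmf_of_set[OF S(2,1)] by (simp add: P1)
qed

lemma std_normal_Phi_lipschitz: "\<bar>std_normal_Phi a - std_normal_Phi b\<bar> \<le> \<bar>a - b\<bar>"
proof -
  have d1: "std_normal_density z \<le> 1" for z
  proof -
    have "1 / sqrt (2 * pi) \<le> 1" using pi_gt3 by (simp add: real_le_rsqrt)
    moreover have "exp (- z\<^sup>2 / 2) \<le> 1" by simp
    ultimately show ?thesis unfolding std_normal_density_def using mult_mono[of "1 / sqrt (2 * pi)" 1 "exp (- z\<^sup>2 / 2)" 1] by simp
  qed
  have *: "\<bar>std_normal_Phi a - std_normal_Phi b\<bar> \<le> \<bar>a - b\<bar>" if ab: "a < b" for a b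
  proof -
    obtain z where "std_normal_Phi b - std_normal_Phi a = (b - a) * std_normal_density z"
      using MVT2[OF ab, of std_normal_Phi std_normal_density] std_normal_Phi_deriv by blast
    moreover have "(b - a) * std_normal_density z \<le> (b - a) * 1" using d1 ab by (intro mult_left_mono) auto
    moreover have "std_normal_Phi a \<le> std_normal_Phi b" using ab by (intro std_normal_Phi_mono) auto
    ultimately show ?thesis using ab by simp
  qed
  show ?thesis using *[of a b] *[of b a] by (cases a b rule: linorder_cases) (auto simp: abs_minus_commute)
qed

text \<open>The shift (l - 1) x is unbounded in x, so a Lipschitz estimate would not be uniform.
  Every point between x and l x has modulus at least |x| / 2 because l >= 1/2, and there |x| times
  the density is at most 2.\<close>

lemma std_normal_Phi_scale:
  assumes l: "l \<ge> 1 / 2"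
  shows "\<bar>std_normal_Phi (l * x) - std_normal_Phi x\<bar> \<le> 2 * \<bar>l - 1\<bar>"
proof -
  have dens: "\<bar>x\<bar> * std_normal_density z \<le> 2" if z: "\<bar>z\<bar> \<ge> \<bar>x\<bar> / 2" for z
  proof -
    have "(\<bar>x\<bar> / 2)\<^sup>2 \<le> \<bar>z\<bar>\<^sup>2" using z by (intro power_mono) auto
    hence z2: "x\<^sup>2 / 8 \<le> z\<^sup>2 / 2" by (simp add: power_divide)
    \<comment> \<open>The square yields |x| <= 2 (1 + x^2 / 8), matched to the exponent of the
      density at |x| / 2.\<close>
    have "0 \<le> (\<bar>x\<bar> - 2)\<^sup>2" by simp
    hence "\<bar>x\<bar> \<le> 2 * (1 + x\<^sup>2 / 8)" by (simp add: power2_eq_square algebra_simps)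
    also have "1 + x\<^sup>2 / 8 \<le> exp (x\<^sup>2 / 8)" by (rule exp_ge_add_one_self)
    also have "exp (x\<^sup>2 / 8) \<le> exp (z\<^sup>2 / 2)" using z2 by simp
    finally have "\<bar>x\<bar> * exp (- z\<^sup>2 / 2) \<le> 2 * exp (z\<^sup>2 / 2) * exp (- z\<^sup>2 / 2)" by (intro mult_right_mono) auto
    also have "\<dots> = 2" by (simp add: mult.assoc exp_add[symmetric])
    finally have "\<bar>x\<bar> * exp (- z\<^sup>2 / 2) \<le> 2" .
    moreover have "1 / sqrt (2 * pi) \<le> 1" using pi_gt3 by (simp add: real_le_rsqrt)
    ultimately have "(1 / sqrt (2 * pi)) * (\<bar>x\<bar> * exp (- z\<^sup>2 / 2)) \<le> 1 * 2" by (intro mult_mono) auto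
    thus ?thesis by (simp add: std_normal_density_def mult_ac)
  qed
  have main: "std_normal_Phi b - std_normal_Phi a \<le> 2 * \<bar>l - 1\<bar>"
    if ab: "a < b" "b - a = \<bar>l - 1\<bar> * \<bar>x\<bar>" and z: "\<And>z. a < z \<Longrightarrow> z < b \<Longrightarrow> \<bar>z\<bar> \<ge> \<bar>x\<bar> / 2" for a b
  proof -
    obtain z where z': "a < z" "z < b" "std_normal_Phi b - std_normal_Phi a = (b - a) * std_normal_density z"
      using MVT2[OF ab(1), of std_normal_Phi std_normal_density] std_normal_Phi_deriv by blast
    have "(b - a) * std_normal_density z = \<bar>l - 1\<bar> * (\<bar>x\<bar> * std_normal_density z)" using ab by simp
    also have "\<dots> \<le> \<bar>l - 1\<bar> * 2" using dens[OF z[OF z'(1,2)]] by (intro mult_left_mono) auto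
    finally show ?thesis using z'(3) by simp
  qed
  have diff: "\<bar>l * x - x\<bar> = \<bar>l - 1\<bar> * \<bar>x\<bar>" by (simp add: abs_mult[symmetric] algebra_simps)
  have half: "\<bar>z\<bar> \<ge> \<bar>x\<bar> / 2" if "(x < z \<and> z < l * x) \<or> (l * x < z \<and> z < x)" for z
  proof (cases "x \<ge> 0")
    case True
    hence "l * x \<ge> 1 / 2 * x" using l by (intro mult_right_mono) auto
    thus ?thesis using that True by linarith
  next
    case False
    hence "l * x \<le> 1 / 2 * x" using l by (intro mult_right_mono_neg) auto
    thus ?thesis using that False by linarith
  qed
  show ?thesis
  proof (cases "l * x" x rule: linorder_cases)
    case less
    thus ?thesis using main[of "l * x" x] half diff std_normal_Phi_mono[of "l * x" x] by auto
  next
    case greater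
    thus ?thesis using main[of x "l * x"] half diff std_normal_Phi_mono[of x "l * x"] by auto
  qed auto
qed

text \<open>Passes from the exact mean and variance to their linear main terms. The bound on
  \<open>H\<close> grows with k and serves for 0 <= y < n; for other y the probability is 0 or 1,
  and x lies in a tail at distance of order sqrt n.\<close>

lemma clt_transfer:
  fixes Pr :: "nat \<Rightarrow> real \<Rightarrow> real" and H :: "nat \<Rightarrow> nat \<Rightarrow> real" and \<mu> V :: "nat \<Rightarrow> real"
  assumes v: "v > 0" and e: "0 < e" "e < 1" and B: "B \<ge> 0" and C: "C \<ge> 0"
    and \<mu>: "\<And>n. n \<ge> n0 \<Longrightarrow> \<bar>\<mu> n - e * real n\<bar> \<le> B"
    and V: "\<And>n. n \<ge> n0 \<Longrightarrow> \<bar>V n - v * real n\<bar> \<le> B"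
    and clt: "\<And>n k. V n > 0 \<Longrightarrow> \<bar>H n k - std_normal_Phi ((real k + 1 - \<mu> n) / sqrt (V n))\<bar> \<le>
        C * (1 / sqrt (V n) + (real k + 1) / (V n * sqrt (V n)))"
    and Pr: "\<And>n y. 0 \<le> Pr n y" "\<And>n y. Pr n y \<le> 1" "\<And>n y. y < 0 \<Longrightarrow> Pr n y = 0"
      "\<And>n y. y \<ge> real n \<Longrightarrow> Pr n y = 1" "\<And>n y. y \<ge> 0 \<Longrightarrow> Pr n y = H n (nat \<lfloor>y\<rfloor>)"
  shows "\<exists>K. \<forall>n\<ge>1. \<forall>x. \<bar>Pr n (e * real n + x * sqrt (v * real n)) - std_normal_Phi x\<bar> \<le> K / sqrt (real n)"
proof -
  \<comment> \<open>From \<open>n1\<close> on, B <= v n / 2, so V n lies between v n / 2 and 2 v n,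
    and 1 / sqrt (V n) <= a / sqrt n.\<close>
  define n1 where "n1 = max n0 (nat \<lceil>2 * B / v\<rceil> + 1)"
  define a where "a = sqrt (2 / v)"
  define K1 where "K1 = C * (a + 2 / v * a)"
  define K2 where "K2 = (1 + B) * a"
  define K3 where "K3 = 4 * B / v"
  define K where "K = sqrt n1 + sqrt v / e + sqrt v / (1 - e) + K1 + K2 + K3"
  have a0: "a > 0" using v by (simp add: a_def)
  have K_parts: "sqrt n1 \<ge> 0" "sqrt v / e \<ge> 0" "sqrt v / (1 - e) \<ge> 0" "K1 \<ge> 0" "K2 \<ge> 0" "K3 \<ge> 0"
    using a0 v e B C by (auto simp: K1_def K2_def K3_def)
  show ?thesis
  proof (intro exI[of _ K] allI impI)
    fix n :: nat and x :: real assume n: "n \<ge> 1"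
    define y where "y = e * real n + x * sqrt (v * real n)"
    have sn: "sqrt (real n) > 0" using n by simp
    have le_K: "t / sqrt (real n) \<le> K / sqrt (real n)" if "t \<le> K" for t
      using that by (intro divide_right_mono) auto
    consider "n < n1" | "n \<ge> n1" "y < 0" | "n \<ge> n1" "y \<ge> real n" | "n \<ge> n1" "0 \<le> y" "y < real n"
      by linarith
    hence "\<bar>Pr n y - std_normal_Phi x\<bar> \<le> K / sqrt (real n)"
    proof cases
      case 1
      have "\<bar>Pr n y - std_normal_Phi x\<bar> \<le> 1"
        using Pr(1,2)[of n y] std_normal_Phi_nonneg[of x] std_normal_Phi_le_1[of x] by (simp add: abs_le_iff)
      also have "1 \<le> sqrt n1 / sqrt (real n)" using 1 sn by (simp add: le_divide_eq)
      also have "\<dots> \<le> K / sqrt (real n)" using K_parts by (intro le_K) (simp add: K_def)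
      finally show ?thesis .
    next
      case 2
      have "x * sqrt (v * real n) < - (e * real n)" using 2 by (simp add: y_def)
      hence "x * sqrt v * sqrt (real n) < - (e * sqrt (real n)) * sqrt (real n)"
        by (simp add: real_sqrt_mult mult.assoc)
      hence "x * sqrt v < - (e * sqrt (real n))" using sn by (simp only: mult_less_cancel_right_pos)
      hence "x \<le> - (e * sqrt (real n) / sqrt v)" using v by (simp add: field_simps)
      hence "std_normal_Phi x \<le> std_normal_Phi (- (e * sqrt (real n) / sqrt v))" by (rule std_normal_Phi_mono)
      also have "\<dots> \<le> 1 / (e * sqrt (real n) / sqrt v)" using v e sn by (intro std_normal_Phi_tails) simp
      also have "\<dots> = (sqrt v / e) / sqrt (real n)" by simp
      also have "\<dots> \<le> K / sqrt (real n)" using K_parts by (intro le_K) (simp add: K_def)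
      finally show ?thesis using Pr(3)[OF 2(2), of n] std_normal_Phi_nonneg[of x] by simp
    next
      case 3
      have "x * sqrt (v * real n) \<ge> (1 - e) * real n" using 3 by (simp add: y_def algebra_simps)
      hence "(1 - e) * sqrt (real n) * sqrt (real n) \<le> x * sqrt v * sqrt (real n)"
        by (simp add: real_sqrt_mult mult.assoc)
      hence "(1 - e) * sqrt (real n) \<le> x * sqrt v" using sn by (simp only: mult_le_cancel_right_pos)
      hence "(1 - e) * sqrt (real n) / sqrt v \<le> x" using v by (simp add: field_simps)
      hence "1 - std_normal_Phi x \<le> 1 - std_normal_Phi ((1 - e) * sqrt (real n) / sqrt v)"
        using std_normal_Phi_mono by simp
      also have "\<dots> \<le> 1 / ((1 - e) * sqrt (real n) / sqrt v)" using v e sn by (intro std_normal_Phi_tails) simp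
      also have "\<dots> = (sqrt v / (1 - e)) / sqrt (real n)" by simp
      also have "\<dots> \<le> K / sqrt (real n)" using K_parts by (intro le_K) (simp add: K_def)
      finally show ?thesis using Pr(4)[OF 3(2)] std_normal_Phi_le_1[of x] by simp
    next
      case 4
      have n0: "n \<ge> n0" using 4 by (simp add: n1_def)
      have "2 * B / v \<le> real n"
      proof -
        have "2 * B / v \<le> real (nat \<lceil>2 * B / v\<rceil> + 1)" by linarith
        also have "\<dots> \<le> real n" using 4 by (simp add: n1_def)
        finally show ?thesis .
      qed
      hence Bn: "2 * B \<le> v * real n" using v by (simp add: field_simps)
      have V2: "V n \<ge> v * real n / 2" "V n \<le> 2 * (v * real n)" using V[OF n0] Bn B by (auto simp: abs_le_iff)
      have vn: "v * real n > 0" using v n by simp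
      have V0: "V n > 0" using V2 vn by linarith
      have sqV: "sqrt (V n) > 0" using V0 by simp
      have invV: "1 / V n \<le> (2 / v) / real n"
      proof -
        have "1 / V n \<le> 1 / (v * real n / 2)" using V2 vn V0 by (intro divide_left_mono) auto
        thus ?thesis by simp
      qed
      hence "sqrt (1 / V n) \<le> sqrt ((2 / v) / real n)" by (rule real_sqrt_le_mono)
      hence inv_sqV: "1 / sqrt (V n) \<le> a / sqrt (real n)" by (simp add: real_sqrt_divide real_sqrt_mult a_def)
      define k where "k = nat \<lfloor>y\<rfloor>"
      have k: "real k \<le> y" "y < real k + 1" "real k + 1 \<le> real n"
      proof -
        have kk: "real k = of_int \<lfloor>y\<rfloor>" using 4 by (simp add: k_def)
        show "real k \<le> y" "y < real k + 1" unfolding kk by linarith+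
        have "real k < real n" using kk 4 by linarith
        hence "real (Suc k) \<le> real n" unfolding of_nat_le_iff by simp
        thus "real k + 1 \<le> real n" by simp
      qed
      have "(real k + 1) / (V n * sqrt (V n)) = (real k + 1) * (1 / V n) * (1 / sqrt (V n))" by simp
      also have "\<dots> \<le> real n * ((2 / v) / real n) * (a / sqrt (real n))"
        using k invV inv_sqV V0 v a0 by (intro mult_mono) auto
      also have "\<dots> = (2 / v * a) / sqrt (real n)" using n by simp
      finally have "1 / sqrt (V n) + (real k + 1) / (V n * sqrt (V n)) \<le> (a + 2 / v * a) / sqrt (real n)"
        using inv_sqV by (simp add: add_divide_distrib)
      hence "C * (1 / sqrt (V n) + (real k + 1) / (V n * sqrt (V n))) \<le> C * ((a + 2 / v * a) / sqrt (real n))"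
        using C by (rule mult_left_mono)
      with clt[OF V0, of k] have d1: "\<bar>H n k - std_normal_Phi ((real k + 1 - \<mu> n) / sqrt (V n))\<bar> \<le> K1 / sqrt (real n)"
        by (simp add: K1_def)
      \<comment> \<open>The normalised argument is l x + \<open>\<delta>\<close>: l is the ratio of
        the two standard deviations, \<open>\<delta>\<close> collects the rounding of y and the
        error of the mean.\<close>
      define l where "l = sqrt (v * real n) / sqrt (V n)"
      define \<delta> where "\<delta> = (real k + 1 - y + (e * real n - \<mu> n)) / sqrt (V n)"
      have arg: "(real k + 1 - \<mu> n) / sqrt (V n) = l * x + \<delta>"
        using sqV by (simp add: l_def \<delta>_def y_def field_simps)
      have "\<bar>\<delta>\<bar> = \<bar>real k + 1 - y + (e * real n - \<mu> n)\<bar> * (1 / sqrt (V n))"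
        using sqV by (simp add: \<delta>_def abs_divide)
      also have "\<dots> \<le> (1 + B) * (a / sqrt (real n))"
        using k \<mu>[OF n0] inv_sqV B sqV a0 by (intro mult_mono) (auto simp: abs_le_iff)
      finally have d2: "\<bar>std_normal_Phi ((real k + 1 - \<mu> n) / sqrt (V n)) - std_normal_Phi (l * x)\<bar> \<le> K2 / sqrt (real n)"
        using std_normal_Phi_lipschitz[of "l * x + \<delta>" "l * x"] unfolding arg K2_def by simp
      have l2: "l\<^sup>2 = v * real n / V n" using vn V0 by (simp add: l_def power_divide)
      have l0: "l \<ge> 0" using vn V0 by (simp add: l_def)
      have "(1 / 2)\<^sup>2 \<le> l\<^sup>2" unfolding l2 using V2 V0 vn by (simp add: power2_eq_square field_simps)
      hence lhalf: "1 / 2 \<le> l" using l0 by (rule power2_le_imp_le)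
      \<comment> \<open>Multiplying by l + 1 >= 1 leads to l^2 - 1, which is free of square
        roots.\<close>
      have "\<bar>l - 1\<bar> \<le> \<bar>l - 1\<bar> * (l + 1)" using l0 by (simp add: mult_le_cancel_left1)
      also have "\<dots> = \<bar>(l - 1) * (l + 1)\<bar>" using l0 by (simp add: abs_mult)
      also have "(l - 1) * (l + 1) = l\<^sup>2 - 1" by (simp add: power2_eq_square algebra_simps)
      also have "l\<^sup>2 - 1 = (v * real n - V n) * (1 / V n)" unfolding l2 using V0 by (simp add: field_simps)
      also have "\<bar>(v * real n - V n) * (1 / V n)\<bar> \<le> B * ((2 / v) / real n)"
        unfolding abs_mult using V[OF n0] invV V0 B by (intro mult_mono) (auto simp: abs_minus_commute)
      also have "\<dots> \<le> B * ((2 / v) / sqrt (real n))"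
      proof -
        have "1 \<le> sqrt (real n)" using n by simp
        hence "sqrt (real n) * 1 \<le> sqrt (real n) * sqrt (real n)" by (intro mult_left_mono) auto
        hence "sqrt (real n) \<le> real n" by simp
        thus ?thesis using v B n sn by (intro mult_left_mono divide_left_mono) auto
      qed
      finally have "2 * \<bar>l - 1\<bar> \<le> K3 / sqrt (real n)" by (simp add: K3_def)
      hence d3: "\<bar>std_normal_Phi (l * x) - std_normal_Phi x\<bar> \<le> K3 / sqrt (real n)"
        using std_normal_Phi_scale[OF lhalf, of x] by simp
      have "\<bar>H n k - std_normal_Phi x\<bar> \<le> K1 / sqrt (real n) + K2 / sqrt (real n) + K3 / sqrt (real n)"
        using d1 d2 d3 by linarith
      also have "\<dots> = (K1 + K2 + K3) / sqrt (real n)" by (simp add: add_divide_distrib)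
      also have "\<dots> \<le> K / sqrt (real n)" using K_parts by (intro le_K) (simp add: K_def)
      finally show ?thesis using Pr(5)[OF 4(2), of n] by (simp add: k_def)
    qed
    thus "\<bar>Pr n (e * real n + x * sqrt (v * real n)) - std_normal_Phi x\<bar> \<le> K / sqrt (real n)"
      unfolding y_def .
  qed
qed

text \<open>Already ((M - 1) w + 1)^2 exceeds the subtracted term, comparing term by term with (M -
  1)^2 >= M - 1 >= 1.\<close>

lemma v_coeff_pos:
  assumes M: "M \<ge> 2" and w: "w \<ge> 2"
  shows "v_coeff M w > 0"
proof -
  define K where "K = (M - 1) * real w + 1"
  have K: "K > 0" unfolding K_def using M by (intro add_nonneg_pos) auto
  have "M ^ 1 \<le> M ^ (w - 1)" using M w by (intro power_increasing) auto
  hence m: "M ^ (w - 1) \<ge> 1" using M by simp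
  have "(M - 1)\<^sup>2 * (real w)\<^sup>2 \<ge> (M - 1) * (real w)\<^sup>2"
    using M by (intro mult_right_mono) (auto simp: power2_eq_square)
  moreover have "2 * ((M - 1) * real w) \<ge> 2 * (1 * real w)" using M by (intro mult_left_mono mult_right_mono) auto
  moreover have "K\<^sup>2 = (M - 1)\<^sup>2 * (real w)\<^sup>2 + 2 * ((M - 1) * real w) + 1"
    by (simp add: K_def power2_eq_square algebra_simps)
  ultimately have "(M - 1) * (real w)\<^sup>2 + 2 * real w - 1 < 1 * K\<^sup>2" by linarith
  also have "\<dots> \<le> M ^ (w - 1) * K\<^sup>2" using m by (intro mult_right_mono) auto
  finally have "M ^ (w - 1) * K\<^sup>2 - ((M - 1) * (real w)\<^sup>2 + 2 * real w - 1) > 0" by simp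
  moreover have "M ^ (2 * w - 2) * K ^ 3 > 0" using M K by simp
  ultimately show ?thesis unfolding v_coeff_def K_def by (rule divide_pos_pos)
qed

lemma e_coeff_bounds:
  assumes M: "M \<ge> 2" and w: "w \<ge> 2"
  shows "0 < e_coeff M w" "e_coeff M w < 1"
proof -
  have "M ^ (w - 1) \<ge> 1" using M by simp
  moreover have "(M - 1) * real w \<ge> 1 * 2" using M w by (intro mult_mono) auto
  ultimately have "M ^ (w - 1) * ((M - 1) * real w + 1) \<ge> 1 * 3" by (intro mult_mono) auto
  thus "0 < e_coeff M w" "e_coeff M w < 1" by (auto simp: e_coeff_def)
qed

text \<open>The error tends to 0, so only the constant \<open>b\<close> survives;
  \<open>clt_transfer\<close> takes mean and variance in this form.\<close>

lemma bounded_if_bigo_geometric: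
  fixes f :: "nat \<Rightarrow> real"
  assumes f: "(\<lambda>n. f n - (a * real n + b)) \<in> O(\<lambda>n. real n ^ k * r ^ n)" and r: "0 < r" "r < 1"
  obtains B n0 where "B \<ge> 0" "\<And>n. n \<ge> n0 \<Longrightarrow> \<bar>f n - a * real n\<bar> \<le> B"
proof -
  have "(\<lambda>n. real n ^ k * r ^ n) \<longlonglongrightarrow> 0"
    using r by real_asymp
  hence "(\<lambda>n. real n ^ k * r ^ n) \<in> o(\<lambda>_. 1)" by (intro smalloI_tendsto) auto
  from smalloD_tendsto[OF landau_o.big_small_trans[OF f this]]
  have "(\<lambda>n. f n - (a * real n + b)) \<longlonglongrightarrow> 0" by simp
  from tendstoD[OF this zero_less_one]
  have "\<forall>\<^sub>F n in sequentially. \<bar>f n - (a * real n + b)\<bar> < 1" by (simp add: dist_real_def)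
  then obtain n0 where "\<And>n. n \<ge> n0 \<Longrightarrow> \<bar>f n - (a * real n + b)\<bar> < 1"
    unfolding eventually_sequentially by blast
  hence "\<bar>f n - a * real n\<bar> \<le> 1 + \<bar>b\<bar>" if "n \<ge> n0" for n using that by fastforce
  thus ?thesis by (intro that[of "1 + \<bar>b\<bar>" n0]) auto
qed

section \<open>Digit occurrences in random \<open>w\<close>-NAFs\<close>

theorem theorem5p1:
  fixes \<tau> :: complex and w :: nat and D :: "complex set" and M :: real
  assumes "algebraic_int \<tau>" and "cmod \<tau> > 1" and "w \<ge> 2"
    and "reduced_residue_digit_set \<tau> w D"
    and M: "M = cmod (alg_norm \<tau>)"
  shows
    "(\<lambda>n. real (wNAF_count D w n) - 1 / ((M - 1) * real w + 1) * M ^ (n + w))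
       \<in> O(\<lambda>n. (rho M w * M) ^ n)
     \<and> rho M w < 1
     \<and> (\<forall>\<eta>\<in>D - {0}.
        (\<lambda>n. measure_pmf.expectation (random_wNAF D w n) (occurrences n \<eta>)
             - (e_coeff M w * real n
                + (M - 1) * (real w - 1) * real w
                  / (M ^ (w - 1) * ((M - 1) * real w + 1)\<^sup>2)))
          \<in> O(\<lambda>n. real n * rho M w ^ n)
      \<and> (\<lambda>n. measure_pmf.variance (random_wNAF D w n) (occurrences n \<eta>)
             - (v_coeff M w * real n
                + (real w - 1) * real w
                  * (- (real w - 1)\<^sup>2 - M\<^sup>2 * (real w)\<^sup>2
                     + (M - 1) * M ^ (w - 1) * ((M - 1) * real w + 1)\<^sup>2
                     + 2 * M * ((real w)\<^sup>2 - real w + 1))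
                  / (M ^ (2 * w - 2) * ((M - 1) * real w + 1) ^ 4)))
          \<in> O(\<lambda>n. (real n)\<^sup>2 * rho M w ^ n)
      \<and> (\<exists>K. \<forall>n\<ge>1. \<forall>x.
           \<bar>measure_pmf.prob (random_wNAF D w n)
               {\<xi>. (occurrences n \<eta> \<xi> - e_coeff M w * real n) / sqrt (v_coeff M w * real n) \<le> x}
             - std_normal_Phi x\<bar> \<le> K / sqrt (real n)))"
proof -
  have \<tau>0: "\<tau> \<noteq> 0" using assms(2) by auto
  obtain f where f: "is_min_int_poly \<tau> f" by (rule is_min_int_poly_exists[OF assms(1)])
  define m where "m = nat \<bar>coeff f 0\<bar>"
  have m1: "m \<ge> 1" using coeff_0_min_int_poly[OF f \<tau>0] by (simp add: m_def)
  have Mm: "M = real m" unfolding M cmod_alg_norm[OF f] m_def by simp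
  \<comment> \<open>M = 1 occurs when \<open>\<tau>\<close> is a unit, such as the golden ratio.
    Then D = {0}, there is one word of each length, and the main term of the count is exact.\<close>
  have M': "M = 1 \<or> M \<ge> 2" using m1 Mm by auto
  have M0: "M > 0" using m1 Mm by simp
  have w1: "w \<ge> 1" and w0: "w > 0" using assms(3) by auto
  have D0: "0 \<in> D" using assms(4) by (simp add: reduced_residue_digit_set_def)
  note D = card_reduced_residue_digit_set[OF f \<tau>0 m_def assms(4) w1]
  define N where "N = (M - 1) * M ^ (w - 1)"
  have card: "real (card (D - {0})) = N"
    unfolding D(2) N_def Mm using m1 by (simp add: of_nat_diff)
  define P where "P = naf_gf w [:N - 1, 1:]"
  have P1: "poly (P n) 1 = naf_gf w N n" for n by (simp add: P_def poly_naf_gf)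
  note asym = naf_moment_asymptotics[OF M' assms(3), folded N_def, folded P_def]
  have count: "real (wNAF_count D w n) = poly (P n) 1" for n
    unfolding P1 wNAF_count_eq[OF w1 D0 D(1)] card ..
  note rho = rho_bounds[OF M0 w0]
  define E where "E n = poly (pderiv (P n)) 1 / poly (P n) 1" for n
  define V where "V n = poly (pderiv (pderiv (P n))) 1 / poly (P n) 1 + E n - (E n)\<^sup>2" for n
  note asymE = asym(2)[folded E_def]
  note asymV = asym(3)[folded E_def, folded V_def, unfolded N_def]
  have clt: "\<exists>K. \<forall>n\<ge>1. \<forall>x.
           \<bar>measure_pmf.prob (random_wNAF D w n)
               {\<xi>. (occurrences n \<eta> \<xi> - e_coeff M w * real n) / sqrt (v_coeff M w * real n) \<le> x}
             - std_normal_Phi x\<bar> \<le> K / sqrt (real n)" (is ?clt)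
    and mean: "measure_pmf.expectation (random_wNAF D w n) (occurrences n \<eta>) = E n"
    and var: "measure_pmf.variance (random_wNAF D w n) (occurrences n \<eta>) = V n"
    if \<eta>: "\<eta> \<in> D - {0}" for \<eta> n
  proof -
    \<comment> \<open>The existence of a nonzero digit excludes M = 1 and makes N - 1 >= 0, as
      \<open>naf_gf_bernoulli_product\<close> requires.\<close>
    have "card (D - {0}) > 0" using \<eta> D(1) by (auto simp: card_gt_0_iff)
    hence N1: "N \<ge> 1" using card by linarith
    have M2: "M \<ge> 2" using M' N1 by (auto simp: N_def)
    define c where "c n \<xi> = card {j \<in> {0..<int n}. \<xi> j = \<eta>}" for n and \<xi> :: "int \<Rightarrow> complex"
    have occ: "occurrences n \<eta> = (\<lambda>\<xi>. real (c n \<xi>))" for n by (simp add: occurrences_def c_def fun_eq_iff)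
    have gf: "(\<Sum>\<xi>\<in>wNAFs D w n. [:0, 1 :: real:] ^ c n \<xi>) = P n" for n
      using wNAFs_occurrence_gf[OF w1 D0 D(1) \<eta>, of n] unfolding c_def P_def card .
    have fin: "finite (wNAFs D w n)" for n by (rule finite_wNAFs[OF w1 D0 D(1)])
    have P_ge: "poly (P n) 1 \<ge> 1" for n unfolding P1 using N1 by (intro naf_gf_ge_1) simp
    have ne: "wNAFs D w n \<noteq> {}" for n
      using P_ge[of n] unfolding gf[symmetric] by (auto simp: poly_sum)
    show "measure_pmf.expectation (random_wNAF D w n) (occurrences n \<eta>) = E n" for n
      
      using pmf_of_set_pgf(1)[OF fin[of n] ne[of n], of "c n", unfolded gf]
      unfolding random_wNAF_def occ E_def .
    show "measure_pmf.variance (random_wNAF D w n) (occurrences n \<eta>) = V n" for n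
      
      using pmf_of_set_pgf(2)[OF fin[of n] ne[of n], of "c n", unfolded gf]
      unfolding random_wNAF_def occ V_def E_def .
    define Pr where "Pr n y = measure_pmf.prob (random_wNAF D w n) {\<xi>. real (c n \<xi>) \<le> y}" for n y
    define H where "H n k = (\<Sum>j\<le>k. coeff (P n) j) / poly (P n) 1" for n k
    obtain C where C: "C > 0" and bern: "\<And>(d::nat) (p::nat \<Rightarrow> real) (k::nat) \<mu> V.
       (\<forall>i<d. 0 \<le> p i \<and> p i \<le> 1) \<Longrightarrow> \<mu> = (\<Sum>i<d. p i) \<Longrightarrow> V = (\<Sum>i<d. p i * (1 - p i)) \<Longrightarrow> V > 0 \<Longrightarrow>
       \<bar>(\<Sum>j\<le>k. coeff (\<Prod>i<d. [:1 - p i, p i:]) j) - std_normal_Phi ((real k + 1 - \<mu>) / sqrt V)\<bar>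
       \<le> C * (1 / sqrt V + (real k + 1) / (V * sqrt V))"
      using bernoulli_sum_clt by blast
    have H_clt: "\<bar>H n k - std_normal_Phi ((real k + 1 - E n) / sqrt (V n))\<bar> \<le>
        C * (1 / sqrt (V n) + (real k + 1) / (V n * sqrt (V n)))" if V0: "V n > 0" for n k
    proof -
      obtain p :: "nat \<Rightarrow> real" and d where p: "\<And>i. i < d \<Longrightarrow> 0 < p i \<and> p i < 1"
        "naf_gf w [:N - 1, 1:] n = smult (naf_gf w (N - 1 + 1) n) (\<Prod>i<d. [:1 - p i, p i:])"
        by (rule naf_gf_bernoulli_product[of "N - 1" w n]) (use N1 in auto)
      define F where "F = (\<Prod>i<d. [:1 - p i, p i:])"
      define A where "A = poly (P n) 1"
      have A0: "A \<noteq> 0" using P_ge[of n] by (simp add: A_def)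
      have PF: "P n = smult A F" using p(2) unfolding P_def[symmetric] A_def F_def P1 by simp
      note mom = bernoulli_product_moments[of p d, folded F_def]
      \<comment> \<open>After division by \<open>A\<close>, the polynomial \<open>P n\<close> is
        that of a sum of Bernoulli variables, so \<open>E n\<close>, \<open>V n\<close> and
        \<open>H n k\<close> are its mean, variance and distribution function.\<close>
      have E: "E n = (\<Sum>i<d. p i)"
        using A0 unfolding E_def PF by (simp add: pderiv_smult mom(1,2))
      have "V n = poly (pderiv (pderiv F)) 1 + poly (pderiv F) 1 - (poly (pderiv F) 1)\<^sup>2"
        using A0 unfolding V_def E_def PF by (simp add: pderiv_smult mom(1))
      hence V: "V n = (\<Sum>i<d. p i * (1 - p i))" by (simp only: mom(3))
      have H: "H n k = (\<Sum>j\<le>k. coeff F j)"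
        using A0 unfolding H_def PF by (simp add: mom(1) sum_distrib_left[symmetric])
      show ?thesis
        unfolding H F_def using p(1) by (intro bern E V V0) (auto simp: less_imp_le)
    qed
    obtain B1 n1 where B1: "B1 \<ge> 0" "\<And>n. n \<ge> n1 \<Longrightarrow> \<bar>E n - e_coeff M w * real n\<bar> \<le> B1"
      using bounded_if_bigo_geometric[of E _ _ 1, simplified, OF asymE rho] by metis
    obtain B2 n2 where B2: "B2 \<ge> 0" "\<And>n. n \<ge> n2 \<Longrightarrow> \<bar>V n - v_coeff M w * real n\<bar> \<le> B2"
      using bounded_if_bigo_geometric[of V _ _ 2, OF asymV rho] by metis
    have ex: "\<exists>K. \<forall>n\<ge>1. \<forall>x. \<bar>Pr n (e_coeff M w * real n + x * sqrt (v_coeff M w * real n)) - std_normal_Phi x\<bar>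
        \<le> K / sqrt (real n)"
    proof (rule clt_transfer[where H = H and V = V and \<mu> = E and C = C and B = "max B1 B2" and ?n0.0 = "max n1 n2"])
      show "0 < v_coeff M w" by (rule v_coeff_pos[OF M2 assms(3)])
      show "0 < e_coeff M w" "e_coeff M w < 1" by (rule e_coeff_bounds[OF M2 assms(3)])+
      show "max B1 B2 \<ge> 0" using B1 by simp
      show "C \<ge> 0" using C by simp
      show "\<bar>E n - e_coeff M w * real n\<bar> \<le> max B1 B2" if "n \<ge> max n1 n2" for n
        using B1(2)[of n] that by simp
      show "\<bar>V n - v_coeff M w * real n\<bar> \<le> max B1 B2" if "n \<ge> max n1 n2" for n
        using B2(2)[of n] that by simp
      show "\<bar>H n k - std_normal_Phi ((real k + 1 - E n) / sqrt (V n))\<bar> \<le>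
        C * (1 / sqrt (V n) + (real k + 1) / (V n * sqrt (V n)))" if "V n > 0" for n k
        by (rule H_clt[OF that])
      show "0 \<le> Pr n y" "Pr n y \<le> 1" for n y by (simp_all add: Pr_def)
      show "Pr n y = 0" if "y < 0" for n y
      proof -
        have "{\<xi>. real (c n \<xi>) \<le> y} = {}" using that by (auto simp: not_le intro: less_le_trans)
        thus ?thesis by (simp add: Pr_def)
      qed
      show "Pr n y = 1" if "y \<ge> real n" for n y
      proof -
        have "c n \<xi> \<le> n" for \<xi>
        proof -
          have "c n \<xi> \<le> card {0..<int n}" unfolding c_def by (intro card_mono) auto
          thus ?thesis by simp
        qed
        hence "{\<xi>. real (c n \<xi>) \<le> y} = UNIV" using that by (auto intro: order.trans[rotated])
        thus ?thesis by (simp add: Pr_def)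
      qed
      show "Pr n y = H n (nat \<lfloor>y\<rfloor>)" if "y \<ge> 0" for n y
      proof -
        have "{\<xi>. real (c n \<xi>) \<le> y} = {\<xi>. c n \<xi> \<le> nat \<lfloor>y\<rfloor>}" using that by (auto simp: le_nat_floor le_floor_iff le_nat_iff)
        thus ?thesis unfolding Pr_def H_def random_wNAF_def
          using pmf_of_set_pgf(3)[OF fin[of n] ne[of n], of "c n", unfolded gf] by simp
      qed
    qed
    \<comment> \<open>Needs n >= 1: the square root is then positive and can be cleared from the
      inequality.\<close>
    have set_eq: "{\<xi>. (occurrences n \<eta> \<xi> - e_coeff M w * real n) / sqrt (v_coeff M w * real n) \<le> x} =
        {\<xi>. real (c n \<xi>) \<le> e_coeff M w * real n + x * sqrt (v_coeff M w * real n)}" if "n \<ge> 1" for n x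
    proof -
      have "sqrt (v_coeff M w * real n) > 0" using v_coeff_pos[OF M2 assms(3)] that by simp
      thus ?thesis unfolding occ by (auto simp: pos_divide_le_eq algebra_simps)
    qed
    from ex show ?clt
      unfolding Pr_def by (simp add: set_eq cong: imp_cong)
  qed
  show ?thesis
    unfolding count using asym(1) rho(2) asymE asymV mean var clt by simp
qed

end
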